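(* Let $S^3=\{0\}\times S^3$ be the singular orbit in the Bryant--Salamon $G_2$-manifold $\mathbb{R}^4\times S^3$. There is a one-parameter family of $SU(2)^3$-invariant $G_2$-instantons, with gauge group $SU(2)$, defined in a neighbourhood of $S^3$ and extending smoothly over $S^3$ on $P_{\mathrm{id}}$. The instantons are parametrized by $y_0\in\mathbb{R}$ and, written as $$A=A_1x\sum_{i=1}^3T_i\otimes\eta_i^++B_1y\sum_{i=1}^3T_i\otimes\eta_i^-,$$ satisfy $$x(t)=\frac2t+\frac{y_0^2-1}{4}t+O(t^3),\qquad y(t)=y_0+\frac{y_0}{2}\left(\frac{y_0^2}{2}-3\right)t^2+O(t^4).$$
   Context: Conventions: $SU(2)$ is identified with the unit quaternions; $\{T_i\}_{i=1}^3$ is a basis of $\mathfrak{su}(2)$ with $[T_i,T_j]=2\epsilon_{ijk}T_k$; $T_i^{\pm}=(T_i,\pm T_i)$; $\{\eta_i^{\pm}\}$ are the left-invariant 1-forms on $SU(2)^2$ dual to $\{T_i^{\pm}\}$. Manifold: $\mathbb{R}^4\times S^3\subset\mathbb{H}\times\mathbb{H}$ with $SU(2)^2$ acting by $(a_1,a_2)\cdot(p,q)=(a_1p,a_1q\bar a_2)$; the complement of $\{0\}\times S^3\cong SU(2)^2/\Delta SU(2)$ is identified with $\mathbb{R}^+_t\times SU(2)^2$ via $(t,a_1,a_2)\mapsto(ta_1,a_1\bar a_2)$. $SU(2)^3$ acts on $SU(2)^2$ by $(h_1,h_2,h_3)\cdot(g_1,g_2)=(h_1g_1h_3^{-1},h_2g_2h_3^{-1})$.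 Bryant--Salamon structure: define $r\in[1,\infty)$ by $t(r)=\int_1^r(1-s^{-3})^{-1/2}ds$ and $A_1=A_2=A_3=\frac r3\sqrt{1-r^{-3}}$, $B_1=B_2=B_3=\frac{r}{\sqrt3}$. With $\omega=4\sum_iA_iB_i\eta_i^-\wedge\eta_i^+$, $\Omega_1=8B_1B_2B_3\eta_{123}^--4\sum\epsilon_{ijk}A_iA_jB_k\eta_i^+\wedge\eta_j^+\wedge\eta_k^-$, $\Omega_2=-8A_1A_2A_3\eta_{123}^++4\sum\epsilon_{ijk}B_iB_jA_k\eta_i^-\wedge\eta_j^-\wedge\eta_k^+$, the $G_2$-structure is $\varphi=dt\wedge\omega+\Omega_1$, $\psi=*\varphi=\frac12\omega^2-dt\wedge\Omega_2$. A $G_2$-instanton is a connection with $F_A\wedge\psi=0$. $P_{\mathrm{id}}=SU(2)^2\times_{(\Delta SU(2),\mathrm{id})}SU(2)$, with identity isotropy homomorphism, is a homogeneous bundle over $S^3=SU(2)^2/\Delta SU(2)$, pulled back to $\mathbb{R}^4\times S^3$; its pullback to $\mathbb{R}^+\times SU(2)^2$ is canonically trivial and connections are written there as $\mathfrak{su}(2)$-valued 1-forms. *)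

theory Defs
  imports "HOL-Analysis.Analysis" "HOL-Library.Landau_Symbols"
begin

section \<open>Quaternions, $SU(2)$ and $\mathfrak{su}(2)$\<close>

text \<open>
  A quaternion is a pair (real part, imaginary part), so that the product norm on the type is the
  usual quaternionic norm. Imaginary quaternions form the Lie algebra of the group of unit
  quaternions; they are represented by their component in \<open>real^3\<close>.
\<close>

type_synonym su2 = "real ^ 3"
type_synonym quat = "real \<times> su2"

definition qmul :: "quat \<Rightarrow> quat \<Rightarrow> quat"  (infixl "\<odot>" 70) where
  "p \<odot> q = (fst p * fst q - snd p \<bullet> snd q,
            fst p *\<^sub>R snd q + fst q *\<^sub>R snd p + cross3 (snd p) (snd q))"

definition qcnj :: "quat \<Rightarrow> quat" where
  "qcnj p = (fst p, - snd p)"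

definition SU2 :: "quat set" where
  "SU2 = sphere 0 1"

definition qexp :: "su2 \<Rightarrow> quat" where
  "qexp u = (cos (norm u), (sin (norm u) / norm u) *\<^sub>R u)"

definition Ad :: "quat \<Rightarrow> su2 \<Rightarrow> su2" where
  "Ad g u = snd (g \<odot> (0, u) \<odot> qcnj g)"

definition bracket :: "su2 \<Rightarrow> su2 \<Rightarrow> su2" where
  "bracket u v = 2 *\<^sub>R cross3 u v"

lemma bracket_commutator: "(0, bracket u v) = (0, u) \<odot> (0, v) - (0, v) \<odot> (0, u)"
  by (simp add: qmul_def bracket_def inner_commute cross_skew[of v u] scaleR_2)

text \<open>The Levi-Civita symbol and the basis with \<open>[T\<^sub>i, T\<^sub>j] = 2 \<epsilon>\<^sub>i\<^sub>j\<^sub>k T\<^sub>k\<close>.\<close>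

definition T :: "3 \<Rightarrow> su2" where
  "T i = axis i 1"

definition eps :: "3 \<Rightarrow> 3 \<Rightarrow> 3 \<Rightarrow> real" where
  "eps i j k = cross3 (axis i 1) (axis j 1) $ k"

lemma eps_123: "eps 1 2 3 = 1"
  by (simp add: eps_def cross3_simps axis_def)

lemma eps_antisym: "eps j i k = - eps i j k" "eps i k j = - eps i j k"
  using exhaust_3[of i] exhaust_3[of j] exhaust_3[of k]
  by (auto simp: eps_def cross3_simps axis_def)

lemma bracket_T: "bracket (T i) (T j) = (\<Sum>k\<in>UNIV. (2 * eps i j k) *\<^sub>R T k)"
  by (auto simp: bracket_def T_def eps_def vec_eq_iff axis_def if_distrib cong: if_cong)

lemma qmul_assoc: "(p \<odot> q) \<odot> r = p \<odot> (q \<odot> r)"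
  by (simp add: qmul_def prod_eq_iff cross3_simps forall_3)

lemma qmul_one: "(1, 0) \<odot> p = p" "p \<odot> (1, 0) = p"
  by (simp_all add: qmul_def)

lemma qmul_qcnj:
  assumes "g \<in> SU2" shows "g \<odot> qcnj g = (1, 0)" "qcnj g \<odot> g = (1, 0)"
proof -
  have "norm g ^ 2 = 1" using assms by (simp add: SU2_def)
  then have "fst g * fst g + snd g \<bullet> snd g = 1"
    by (simp add: power2_norm_eq_inner inner_prod_def)
  then show "g \<odot> qcnj g = (1, 0)" "qcnj g \<odot> g = (1, 0)"
    by (simp_all add: qmul_def qcnj_def cross_minus_right cross_minus_left)
qed

lemma qcnj_mem: "g \<in> SU2 \<Longrightarrow> qcnj g \<in> SU2"
  by (simp add: SU2_def qcnj_def norm_prod_def)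

lemma qmul_mem:
  assumes "g \<in> SU2" "h \<in> SU2" shows "g \<odot> h \<in> SU2"
proof -
  have *: "q \<in> SU2 \<longleftrightarrow> q \<bullet> q = 1" for q
    by (simp add: SU2_def norm_eq_1)
  have "(g \<odot> h) \<bullet> (g \<odot> h) = (g \<bullet> g) * (h \<bullet> h)"
    by (simp add: qmul_def inner_prod_def cross3_simps power2_eq_square)
  with assms show ?thesis by (simp add: *)
qed

section \<open>Smooth functions and smooth forms on submanifolds\<close>

primrec Ck_on :: "nat \<Rightarrow> ('a::euclidean_space \<Rightarrow> 'b::real_normed_vector) \<Rightarrow> 'a set \<Rightarrow> bool" where
  "Ck_on 0 f S \<longleftrightarrow> continuous_on S f"
| "Ck_on (Suc k) f S \<longleftrightarrow> (\<forall>x\<in>S. f differentiable at x) \<and>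
     (\<forall>b\<in>Basis. Ck_on k (\<lambda>x. frechet_derivative f (at x) b) S)"

definition smooth_on :: "'a::euclidean_space set \<Rightarrow> ('a \<Rightarrow> 'b::real_normed_vector) \<Rightarrow> bool" where
  "smooth_on S f \<longleftrightarrow> (\<forall>k. Ck_on k f S)"

text \<open>
  A one-form on an embedded submanifold \<open>N\<close> with tangent spaces \<open>TN x\<close> is a function of a point and
  a vector of the ambient space; only its values at points of \<open>N\<close> on vectors tangent to \<open>N\<close> matter.
  It is smooth if it is the restriction of a smooth one-form on an open subset of the ambient space.
\<close>

definition smooth_one_form ::
    "'a::euclidean_space set \<Rightarrow> ('a \<Rightarrow> 'a set) \<Rightarrow> ('a \<Rightarrow> 'a \<Rightarrow> 'b::real_normed_vector) \<Rightarrow> bool" where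
  "smooth_one_form N TN \<theta> \<longleftrightarrow>
    (\<exists>W \<Theta>. open W \<and> N \<subseteq> W \<and> (\<forall>x\<in>W. linear (\<Theta> x)) \<and> (\<forall>v. smooth_on W (\<lambda>x. \<Theta> x v)) \<and>
       (\<forall>x\<in>N. \<forall>v\<in>TN x. \<Theta> x v = \<theta> x v))"

definition pullback ::
    "('a::real_normed_vector \<Rightarrow> 'b::real_normed_vector) \<Rightarrow> ('b \<Rightarrow> 'b \<Rightarrow> 'c) \<Rightarrow> 'a \<Rightarrow> 'a \<Rightarrow> 'c" where
  "pullback f \<theta> x v = \<theta> (f x) (frechet_derivative f (at x) v)"

section \<open>The bundle $P_{\mathrm{id}}$ over a neighbourhood of the singular orbit\<close>

text \<open>
  The map \<open>[(a\<^sub>1, a\<^sub>2), g] \<mapsto> (a\<^sub>1 g, a\<^sub>2 g)\<close> identifies the associated bundle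
  \<open>SU(2)\<^sup>2 \<times>\<^bsub>(\<Delta>SU(2), id)\<^esub> SU(2)\<close>, on which \<open>(a\<^sub>1 h, a\<^sub>2 h, g)\<close> and \<open>(a\<^sub>1, a\<^sub>2, h g)\<close> represent the
  same point, with \<open>SU(2)\<^sup>2\<close>, equivariantly for the right actions of \<open>SU(2)\<close> and the left actions of
  \<open>SU(2)\<^sup>2\<close>.
\<close>

lemma P_id_fibre:
  assumes "a1 \<in> SU2" "a2 \<in> SU2" "g \<in> SU2" "a1' \<in> SU2" "a2' \<in> SU2" "g' \<in> SU2"
  shows "(a1 \<odot> g, a2 \<odot> g) = (a1' \<odot> g', a2' \<odot> g') \<longleftrightarrow>
         (\<exists>h\<in>SU2. a1' = a1 \<odot> h \<and> a2' = a2 \<odot> h \<and> g = h \<odot> g')" (is "?L \<longleftrightarrow> ?R")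
proof
  assume ?L
  then have eq: "a1 \<odot> g = a1' \<odot> g'" "a2 \<odot> g = a2' \<odot> g'" by auto
  let ?h = "g \<odot> qcnj g'"
  have "?h \<in> SU2" using assms by (simp add: qmul_mem qcnj_mem)
  moreover have "a1' = a1 \<odot> ?h" "a2' = a2 \<odot> ?h"
    using eq assms by (simp_all flip: qmul_assoc) (simp_all add: qmul_assoc qmul_qcnj qmul_one)
  moreover have "g = ?h \<odot> g'"
    using assms by (simp add: qmul_assoc qmul_qcnj qmul_one)
  ultimately show ?R by blast
qed (auto simp: qmul_assoc)

text \<open>
  Pulling back along \<open>(p, q) \<mapsto> q\<close>, where \<open>q = b\<^sub>1 b\<^sub>2\<^sup>*\<close> is the point of \<open>S\<^sup>3\<close> below \<open>(b\<^sub>1, b\<^sub>2)\<close>, the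
  bundle over the part \<open>{|p| < \<epsilon>}\<close> of \<open>\<real>\<^sup>4 \<times> S\<^sup>3\<close> has as total space the triples \<open>(p, b\<^sub>1, b\<^sub>2)\<close>, the
  projection being \<open>(p, b\<^sub>1, b\<^sub>2) \<mapsto> (p, b\<^sub>1 b\<^sub>2\<^sup>*)\<close>. These tubes form a neighbourhood basis of \<open>S\<^sup>3\<close>
  consisting of \<open>SU(2)\<^sup>3\<close>-invariant sets.
\<close>

type_synonym bundle_pt = "quat \<times> quat \<times> quat"

definition P_id :: "real \<Rightarrow> bundle_pt set" where
  "P_id \<epsilon> = {(p, b1, b2). norm p < \<epsilon> \<and> b1 \<in> SU2 \<and> b2 \<in> SU2}"

definition TP_id :: "bundle_pt \<Rightarrow> bundle_pt set" where
  "TP_id = (\<lambda>(p, b1, b2). {(v, w1, w2). w1 \<bullet> b1 = 0 \<and> w2 \<bullet> b2 = 0})"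

definition right_act :: "quat \<Rightarrow> bundle_pt \<Rightarrow> bundle_pt" where
  "right_act g = (\<lambda>(p, b1, b2). (p, b1 \<odot> g, b2 \<odot> g))"

text \<open>
  The lift to the bundle of the action of \<open>SU(2)\<^sup>3\<close> on \<open>\<real>\<^sup>4 \<times> S\<^sup>3\<close>, which is
  \<open>(p, q) \<mapsto> (h\<^sub>1 p h\<^sub>3\<^sup>-\<^sup>1, h\<^sub>1 q h\<^sub>2\<^sup>-\<^sup>1)\<close>. The first two factors act on the homogeneous bundle by left
  multiplication, the third one acts on the base only.
\<close>

definition left_act :: "quat \<Rightarrow> quat \<Rightarrow> quat \<Rightarrow> bundle_pt \<Rightarrow> bundle_pt" where
  "left_act h1 h2 h3 = (\<lambda>(p, b1, b2). (h1 \<odot> p \<odot> qcnj h3, h1 \<odot> b1, h2 \<odot> b2))"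

definition connection :: "real \<Rightarrow> (bundle_pt \<Rightarrow> bundle_pt \<Rightarrow> su2) \<Rightarrow> bool" where
  "connection \<epsilon> \<theta> \<longleftrightarrow>
     smooth_one_form (P_id \<epsilon>) TP_id \<theta> \<and>
     (\<forall>z\<in>P_id \<epsilon>. \<forall>v\<in>TP_id z. \<forall>g\<in>SU2. pullback (right_act g) \<theta> z v = Ad (qcnj g) (\<theta> z v)) \<and>
     (\<forall>z\<in>P_id \<epsilon>. \<forall>\<xi>. \<theta> z (vector_derivative (\<lambda>s. right_act (qexp (s *\<^sub>R \<xi>)) z) (at 0)) = \<xi>)"

definition SU2_cubed_invariant :: "real \<Rightarrow> (bundle_pt \<Rightarrow> bundle_pt \<Rightarrow> su2) \<Rightarrow> bool" where
  "SU2_cubed_invariant \<epsilon> \<theta> \<longleftrightarrow>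
     (\<forall>h1\<in>SU2. \<forall>h2\<in>SU2. \<forall>h3\<in>SU2. \<forall>z\<in>P_id \<epsilon>. \<forall>v\<in>TP_id z.
        pullback (left_act h1 h2 h3) \<theta> z v = \<theta> z v)"

section \<open>Forms on the complement of the singular orbit\<close>

text \<open>
  The complement is \<open>\<real>\<^sup>+ \<times> SU(2)\<^sup>2\<close>, a Lie group with Lie algebra \<open>lie\<close>. Its tangent bundle is
  trivialised by the left-invariant vector fields, and a form of degree \<open>k\<close> at a point is a function
  of lists of \<open>k\<close> elements of \<open>lie\<close>.
\<close>

type_synonym cpl = "real \<times> quat \<times> quat"
type_synonym lie = "real \<times> su2 \<times> su2"

definition complement :: "real \<Rightarrow> cpl set" where
  "complement \<epsilon> = {(t, a1, a2). 0 < t \<and> t < \<epsilon> \<and> a1 \<in> SU2 \<and> a2 \<in> SU2}"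

definition left_inv :: "lie \<Rightarrow> cpl \<Rightarrow> cpl" where
  "left_inv = (\<lambda>(\<tau>, u1, u2) (t, a1, a2). (\<tau>, a1 \<odot> (0, u1), a2 \<odot> (0, u2)))"

definition flow :: "lie \<Rightarrow> real \<Rightarrow> cpl \<Rightarrow> cpl" where
  "flow = (\<lambda>(\<tau>, u1, u2) s (t, a1, a2). (t + s * \<tau>, a1 \<odot> qexp (s *\<^sub>R u1), a2 \<odot> qexp (s *\<^sub>R u2)))"

definition along :: "lie \<Rightarrow> (cpl \<Rightarrow> su2) \<Rightarrow> cpl \<Rightarrow> su2" where
  "along X f z = vector_derivative (\<lambda>s. f (flow X s z)) (at 0)"

definition lie_bracket :: "lie \<Rightarrow> lie \<Rightarrow> lie" where
  "lie_bracket = (\<lambda>(\<tau>, u1, u2) (\<sigma>, v1, v2). (0, bracket u1 v1, bracket u2 v2))"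

text \<open>
  The canonical trivialisation is the section \<open>(t, a\<^sub>1, a\<^sub>2) \<mapsto> [(a\<^sub>1, a\<^sub>2), 1]\<close>, lying over the point
  \<open>(t a\<^sub>1, a\<^sub>1 a\<^sub>2\<^sup>*)\<close>.
\<close>

definition canonical_section :: "cpl \<Rightarrow> bundle_pt" where
  "canonical_section = (\<lambda>(t, a1, a2). (t *\<^sub>R a1, a1, a2))"

definition local_form :: "(bundle_pt \<Rightarrow> bundle_pt \<Rightarrow> su2) \<Rightarrow> cpl \<Rightarrow> lie \<Rightarrow> su2" where
  "local_form \<theta> z X = pullback canonical_section \<theta> z (left_inv X z)"

text \<open>
  The curvature \<open>F\<^sub>A = dA + [A \<and> A]/2\<close>, evaluated on left-invariant vector fields with
  \<open>dA(X, Y) = X (A Y) - Y (A X) - A [X, Y]\<close>.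
\<close>

definition curvature :: "(cpl \<Rightarrow> lie \<Rightarrow> su2) \<Rightarrow> cpl \<Rightarrow> lie list \<Rightarrow> su2" where
  "curvature A z Xs = (let X = Xs ! 0; Y = Xs ! 1 in
     along X (\<lambda>w. A w Y) z - along Y (\<lambda>w. A w X) z - A z (lie_bracket X Y)
     + bracket (A z X) (A z Y))"

text \<open>
  The wedge product of a \<open>k\<close>-form with another form is the sum over shuffles: \<open>S\<close> is the set of
  positions of the arguments passed to \<open>\<alpha>\<close>, and the shuffle has \<open>\<Sum>S - (0 + \<dots> + (k-1))\<close> inversions.
\<close>

definition wedge ::
    "nat \<Rightarrow> ('v list \<Rightarrow> 'w::real_vector) \<Rightarrow> ('v list \<Rightarrow> real) \<Rightarrow> 'v list \<Rightarrow> 'w" where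
  "wedge k \<alpha> \<beta> Xs = (\<Sum>S | S \<subseteq> {..<length Xs} \<and> card S = k.
     ((-1) ^ (\<Sum>S + \<Sum>{..<k}) * \<beta> (nths Xs (- S))) *\<^sub>R \<alpha> (nths Xs S))"

definition dt :: "lie list \<Rightarrow> real" where
  "dt Xs = fst (hd Xs)"

definition T_plus :: "3 \<Rightarrow> lie" where "T_plus i = (0, T i, T i)"
definition T_minus :: "3 \<Rightarrow> lie" where "T_minus i = (0, T i, - T i)"

definition eta_plus :: "3 \<Rightarrow> lie list \<Rightarrow> real" where
  "eta_plus i Xs = (case hd Xs of (\<tau>, u1, u2) \<Rightarrow> (u1 $ i + u2 $ i) / 2)"

definition eta_minus :: "3 \<Rightarrow> lie list \<Rightarrow> real" where
  "eta_minus i Xs = (case hd Xs of (\<tau>, u1, u2) \<Rightarrow> (u1 $ i - u2 $ i) / 2)"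

lemma eta_dual:
  "eta_plus i [T_plus j] = (if i = j then 1 else 0)" "eta_plus i [T_minus j] = 0"
  "eta_minus i [T_minus j] = (if i = j then 1 else 0)" "eta_minus i [T_plus j] = 0"
  by (auto simp: eta_plus_def eta_minus_def T_plus_def T_minus_def T_def axis_def)

section \<open>The Bryant--Salamon structure\<close>

definition bs_t :: "real \<Rightarrow> real" where
  "bs_t r = integral {1..r} (\<lambda>s. (1 - 1 / s ^ 3) powr (- 1 / 2))"

definition bs_r :: "real \<Rightarrow> real" where
  "bs_r = the_inv_into {1..} bs_t"

definition A1 :: "real \<Rightarrow> real" where
  "A1 t = bs_r t / 3 * sqrt (1 - 1 / bs_r t ^ 3)"

definition B1 :: "real \<Rightarrow> real" where
  "B1 t = bs_r t / sqrt 3"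

definition omega :: "real \<Rightarrow> lie list \<Rightarrow> real" where
  "omega t Xs = 4 * (\<Sum>i\<in>UNIV. A1 t * B1 t * wedge 1 (eta_minus i) (eta_plus i) Xs)"

definition Omega1 :: "real \<Rightarrow> lie list \<Rightarrow> real" where
  "Omega1 t Xs =
     8 * B1 t ^ 3 * wedge 1 (eta_minus 1) (wedge 1 (eta_minus 2) (eta_minus 3)) Xs
     - 4 * (\<Sum>i\<in>UNIV. \<Sum>j\<in>UNIV. \<Sum>k\<in>UNIV. eps i j k * A1 t ^ 2 * B1 t *
              wedge 1 (eta_plus i) (wedge 1 (eta_plus j) (eta_minus k)) Xs)"

definition Omega2 :: "real \<Rightarrow> lie list \<Rightarrow> real" where
  "Omega2 t Xs =
     - 8 * A1 t ^ 3 * wedge 1 (eta_plus 1) (wedge 1 (eta_plus 2) (eta_plus 3)) Xs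
     + 4 * (\<Sum>i\<in>UNIV. \<Sum>j\<in>UNIV. \<Sum>k\<in>UNIV. eps i j k * B1 t ^ 2 * A1 t *
              wedge 1 (eta_minus i) (wedge 1 (eta_minus j) (eta_plus k)) Xs)"

definition phi :: "real \<Rightarrow> lie list \<Rightarrow> real" where
  "phi t Xs = wedge 1 dt (omega t) Xs + Omega1 t Xs"

text \<open>The four-form \<open>* \<phi>\<close>.\<close>

definition psi :: "real \<Rightarrow> lie list \<Rightarrow> real" where
  "psi t Xs = 1 / 2 * wedge 2 (omega t) (omega t) Xs - wedge 1 dt (Omega2 t) Xs"

text \<open>
  The equation \<open>F\<^sub>A \<and> \<psi> = 0\<close> is imposed on the complement of \<open>S\<^sup>3\<close>, where \<open>\<psi>\<close> is given by the formula
  above. Since \<open>\<psi>\<close> and the curvature of a connection on \<open>P_id\<close> are smooth across \<open>S\<^sup>3\<close>, which is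
  nowhere dense, this is the same as imposing it everywhere.
\<close>

definition G2_instanton :: "real \<Rightarrow> (bundle_pt \<Rightarrow> bundle_pt \<Rightarrow> su2) \<Rightarrow> bool" where
  "G2_instanton \<epsilon> \<theta> \<longleftrightarrow> connection \<epsilon> \<theta> \<and>
     (\<forall>z\<in>complement \<epsilon>. \<forall>Xs. length Xs = 6 \<longrightarrow>
        wedge 2 (curvature (local_form \<theta>) z) (psi (fst z)) Xs = 0)"

text \<open>The one-form \<open>A\<^sub>1 x \<Sum> T\<^sub>i \<otimes> \<eta>\<^sub>i\<^sup>+ + B\<^sub>1 y \<Sum> T\<^sub>i \<otimes> \<eta>\<^sub>i\<^sup>-\<close>.\<close>

definition ansatz :: "(real \<Rightarrow> real) \<Rightarrow> (real \<Rightarrow> real) \<Rightarrow> cpl \<Rightarrow> lie \<Rightarrow> su2" where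
  "ansatz x y z X = (let t = fst z in
     (A1 t * x t) *\<^sub>R (\<Sum>i\<in>UNIV. eta_plus i [X] *\<^sub>R T i) +
     (B1 t * y t) *\<^sub>R (\<Sum>i\<in>UNIV. eta_minus i [X] *\<^sub>R T i))"

definition expansion :: "real \<Rightarrow> (real \<Rightarrow> real) \<Rightarrow> (real \<Rightarrow> real) \<Rightarrow> bool" where
  "expansion y0 x y \<longleftrightarrow>
     (\<lambda>t. x t - (2 / t + (y0\<^sup>2 - 1) / 4 * t)) \<in> O[at_right 0](\<lambda>t. t ^ 3) \<and>
     (\<lambda>t. y t - (y0 + y0 / 2 * (y0\<^sup>2 / 2 - 3) * t\<^sup>2)) \<in> O[at_right 0](\<lambda>t. t ^ 4)"

text \<open>
  An \<open>SU(2)\<^sup>3\<close>-invariant instanton on the tube of radius \<open>\<epsilon>\<close> about \<open>S\<^sup>3\<close>, smooth on \<open>P_id\<close> and with the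
  stated form and asymptotics with parameter \<open>y0\<close>.
\<close>

definition instanton_with_parameter ::
    "real \<Rightarrow> real \<Rightarrow> (bundle_pt \<Rightarrow> bundle_pt \<Rightarrow> su2) \<Rightarrow> bool" where
  "instanton_with_parameter y0 \<epsilon> \<theta> \<longleftrightarrow>
     \<epsilon> > 0 \<and> G2_instanton \<epsilon> \<theta> \<and> SU2_cubed_invariant \<epsilon> \<theta> \<and>
     (\<exists>x y. (\<forall>z\<in>complement \<epsilon>. \<forall>X. local_form \<theta> z X = ansatz x y z X) \<and> expansion y0 x y)"

end

theory Submission
  imports Defs
begin

text \<open>
  Write \<open>f = A\<^sub>1 x\<close> and \<open>g = B\<^sub>1 y\<close>. Expanding \<open>F\<^sub>A \<and> \<psi>\<close> in the coframe \<open>dt, \<eta>\<^sup>+, \<eta>\<^sup>-\<close> reduces the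
  instanton equation to \<open>f' = (f - f\<^sup>2) / A\<^sub>1 + A\<^sub>1 (g\<^sup>2 - f) / B\<^sub>1\<^sup>2\<close> and \<open>g' = 2 g (f - 1) / A\<^sub>1\<close>.
  In the variable \<open>z = 1 - 1 / r\<^sup>3\<close>, with \<open>f = 1 + z h\<close>, this system has polynomial coefficients and a
  regular singular point at \<open>z = 0\<close>; its formal power series solutions converge, and they are determined
  by \<open>g(0) = y\<^sub>0 / sqrt 3\<close>. Moreover \<open>t\<^sup>2\<close> is an analytic function of \<open>z\<close> with non-zero derivative, so that
  \<open>z\<close>, \<open>g\<close> and \<open>(f - 1) / t\<^sup>2\<close> are smooth functions of \<open>t\<^sup>2 = |p|\<^sup>2\<close>. On the total space of the bundle
  the connection is
  \<open>(1 - \<beta>) b\<^sub>1\<^sup>* db\<^sub>1 + \<beta> b\<^sub>2\<^sup>* db\<^sub>2 + \<mu> Im (b\<^sub>1\<^sup>* dp p\<^sup>* b\<^sub>1)\<close>, where \<open>\<beta> = (f - g) / 2\<close> and \<open>\<mu> = (f - 1) / t\<^sup>2\<close>,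
  which is therefore smooth across the singular orbit. For uniqueness, two solutions with the same
  expansion differ by \<open>O(t\<^sup>2)\<close>, whereas a weighted sum of squares \<open>E\<close> of their difference satisfies
  \<open>t E' \<le> 3 E\<close>; hence \<open>E / t\<^sup>3\<close> is non-increasing and tends to \<open>0\<close> as \<open>t\<close> does, and \<open>E = 0\<close>.
\<close>

section \<open>Wedge products\<close>

text \<open>The variable \<open>z\<close> works because
  \<open>A\<^sub>1 d/dt = z (1 - z) d/dz\<close> and
  \<open>A\<^sub>1\<^sup>2 / B\<^sub>1\<^sup>2 = z / 3\<close>: all dependence on \<open>r\<close>
  cancels, whereas in the variable \<open>t\<close> the coefficients are only given implicitly. The
  pole \<open>2 / t\<close> of \<open>x\<close> together with \<open>A\<^sub>1 ~ t / 2\<close>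
  selects the zero \<open>f = 1\<close> of \<open>f - f\<^sup>2\<close> at the singular orbit.
  Linearised there, \<open>t d/dt\<close> has eigenvalues -2 and 0, so \<open>g(0)\<close> is the
  only free datum of a bounded solution. Since \<open>|p|\<close> is not smooth at
  \<open>p = 0\<close>, every coefficient must be a smooth function of \<open>s = t\<^sup>2\<close>
  on an open interval about 0, hence also for negative \<open>s\<close>, where \<open>t\<close> has
  no meaning. Uniqueness is a statement on germs: a competing instanton lives on its own tube and
  brings functions \<open>x\<close>, \<open>y\<close> known only by their asymptotics, so
  differentiability has to be recovered from the connection, and agreement on
  \<open>S\<^sup>3\<close> itself follows by continuity. Forms are plain functions of argument
  lists, with neither alternation nor multilinearity in the type, so the exterior algebra is derived
  from the shuffle sum.\<close>

lemma subsets_Suc_split: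
  "{S. S \<subseteq> {..<Suc n} \<and> card S = k} =
     (image Suc) ` {S. S \<subseteq> {..<n} \<and> card S = k} \<union>
     (if k = 0 then {} else (\<lambda>S. insert 0 (Suc ` S)) ` {S. S \<subseteq> {..<n} \<and> card S = k - 1})"
  (is "?L = ?R")
proof (intro set_eqI iffI)
  fix S assume S: "S \<in> ?L"
  define S' where "S' = {i. Suc i \<in> S}"
  have fin: "finite S" using S finite_subset by blast
  have sub: "S' \<subseteq> {..<n}" using S by (auto simp: S'_def)
  then have finS': "finite S'" using finite_subset by blast
  show "S \<in> ?R"
  proof (cases "0 \<in> S")
    case True
    have eq: "S = insert 0 (Suc ` S')"
      using True by (auto simp: S'_def image_iff) (metis not0_implies_Suc)
    have "card S = Suc (card S')"
      by (subst eq) (simp add: finS' card_image)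
    then show ?thesis using S sub eq by auto
  next
    case False
    have eq: "S = Suc ` S'"
      using False by (auto simp: S'_def image_iff) (metis not0_implies_Suc)
    have "card S = card S'"
      by (subst eq) (simp add: card_image)
    then show ?thesis using S sub eq by auto
  qed
next
  fix S assume S: "S \<in> ?R"
  show "S \<in> ?L"
  proof (cases "S \<in> (image Suc) ` {S. S \<subseteq> {..<n} \<and> card S = k}")
    case True then show ?thesis by (auto simp: card_image)
  next
    case False
    with S obtain S' where S': "k \<noteq> 0" "S = insert 0 (Suc ` S')" "S' \<subseteq> {..<n}" "card S' = k - 1"
      by (auto split: if_splits)
    have "finite S'" using S' finite_subset by blast
    then show ?thesis using S' by (auto simp: card_image)
  qed
qed

lemma sum_Suc_image: "finite S \<Longrightarrow> \<Sum>(Suc ` S) = \<Sum>S + card S"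
  by (subst sum.reindex) (auto simp: sum_Suc)

lemma compl_preimage:
  "{j. Suc j \<in> - Suc ` S} = - S" "{j. Suc j \<in> - insert 0 (Suc ` S)} = - S"
  "{j. Suc j \<in> Suc ` S} = S" "{j. Suc j \<in> insert 0 (Suc ` S)} = S" "{j. Suc j \<notin> Suc ` S} = - S"
  by auto

lemma wedge_Nil: "wedge k \<alpha> \<beta> [] = (if k = 0 then \<beta> [] *\<^sub>R \<alpha> [] else 0)"
proof -
  have "{S::nat set. S = {} \<and> card S = k} = (if k = 0 then {{}} else {})" by auto
  then show ?thesis by (simp add: wedge_def)
qed

text \<open>Shuffles are split by whether the first argument \<open>X\<close> is passed to \<alpha>
  or to \<beta>. In the second case all \<open>k + 1\<close> arguments of \<alpha> have to be moved
  past \<open>X\<close>, which gives the sign. This recursion replaces the shuffle sum in the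
  inductions on argument lists.\<close>

lemma wedge_Suc_Cons:
  "wedge (Suc k) \<alpha> \<beta> (X # Xs) =
     wedge k (\<lambda>Ys. \<alpha> (X # Ys)) \<beta> Xs + (-1) ^ Suc k *\<^sub>R wedge (Suc k) \<alpha> (\<lambda>Ys. \<beta> (X # Ys)) Xs"
proof -
  let ?F = "\<lambda>S. ((-1) ^ (\<Sum>S + \<Sum>{..<Suc k}) * \<beta> (nths (X # Xs) (- S))) *\<^sub>R \<alpha> (nths (X # Xs) S)"
  let ?A = "\<lambda>k. {S. S \<subseteq> {..<length Xs} \<and> card S = k}"
  have fin: "finite (?A j)" for j
    by (rule finite_subset[of _ "Pow {..<length Xs}"]) auto
  have finS: "finite S" if "S \<in> ?A j" for S j
    using that finite_subset by blast
  have inj1: "inj_on (image Suc) (?A j)" for j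
    by (meson inj_Suc inj_image_eq_iff inj_onI)
  have inj2: "inj_on (\<lambda>S. insert 0 (Suc ` S)) (?A j)" for j
    by (rule inj_on_inverseI[of _ "\<lambda>S. {j. Suc j \<in> S}"]) auto
  have "wedge (Suc k) \<alpha> \<beta> (X # Xs) =
      sum ?F ((image Suc) ` ?A (Suc k) \<union> (\<lambda>S. insert 0 (Suc ` S)) ` ?A k)"
    unfolding wedge_def by (rule sum.cong) (simp_all only: length_Cons subsets_Suc_split, simp_all)
  also have "\<dots> = sum ?F ((image Suc) ` ?A (Suc k)) + sum ?F ((\<lambda>S. insert 0 (Suc ` S)) ` ?A k)"
    by (rule sum.union_disjoint) (use fin in auto)
  also have "sum ?F ((image Suc) ` ?A (Suc k)) =
      (-1) ^ Suc k *\<^sub>R wedge (Suc k) \<alpha> (\<lambda>Ys. \<beta> (X # Ys)) Xs"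
    unfolding wedge_def scaleR_sum_right
  proof (subst sum.reindex[OF inj1], intro sum.cong refl)
    fix S assume S: "S \<in> ?A (Suc k)"
    have "\<Sum>(Suc ` S) = \<Sum>S + Suc k"
      using S finS[OF S] by (simp add: sum_Suc_image)
    then have "(-1::real) ^ (\<Sum>(Suc ` S) + \<Sum>{..<Suc k}) = (-1) ^ Suc k * (-1) ^ (\<Sum>S + \<Sum>{..<Suc k})"
      by (simp add: power_add del: sum.lessThan_Suc)
    then show "(?F \<circ> image Suc) S =
        (-1) ^ Suc k *\<^sub>R ((-1) ^ (\<Sum>S + \<Sum>{..<Suc k}) * \<beta> (X # nths Xs (- S))) *\<^sub>R \<alpha> (nths Xs S)"
      by (simp add: nths_Cons compl_preimage mult.assoc image_iff flip: Compl_eq del: sum.lessThan_Suc)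
  qed
  also have "sum ?F ((\<lambda>S. insert 0 (Suc ` S)) ` ?A k) = wedge k (\<lambda>Ys. \<alpha> (X # Ys)) \<beta> Xs"
    unfolding wedge_def
  proof (subst sum.reindex[OF inj2], intro sum.cong refl)
    fix S assume S: "S \<in> ?A k"
    have "\<Sum>(insert 0 (Suc ` S)) = \<Sum>S + k"
      using S finS[OF S] by (simp add: sum_Suc_image)
    \<comment> \<open>The position sum and the normalising sum over \<open>{..<Suc k}\<close> each
      grow by \<open>k\<close>, so the parity is unchanged.\<close>
    then have "(-1::real) ^ (\<Sum>(insert 0 (Suc ` S)) + \<Sum>{..<Suc k}) = (-1) ^ (\<Sum>S + \<Sum>{..<k} + 2 * k)"
      by (intro arg_cong[where f = "(^) (- 1)"]) simp
    then show "(?F \<circ> (\<lambda>S. insert 0 (Suc ` S))) S =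
        ((-1) ^ (\<Sum>S + \<Sum>{..<k}) * \<beta> (nths Xs (- S))) *\<^sub>R \<alpha> (X # nths Xs S)"
      by (simp add: nths_Cons compl_preimage power_add power_mult del: sum.lessThan_Suc)
  qed
  finally show ?thesis by (simp add: add.commute)
qed

lemma wedge_0: "wedge 0 \<alpha> \<beta> Xs = \<beta> Xs *\<^sub>R \<alpha> []"
proof -
  have "{S. S \<subseteq> {..<length Xs} \<and> card S = 0} = {{}}"
    using finite_subset by (auto simp: card_eq_0_iff)
  moreover have "nths Xs (- {}) = Xs" by (simp add: nths_all)
  ultimately show ?thesis by (simp add: wedge_def)
qed

lemma wedge_1_Cons:
  "wedge 1 \<alpha> \<beta> (X # Xs) = \<beta> Xs *\<^sub>R \<alpha> [X] - wedge 1 \<alpha> (\<lambda>Ys. \<beta> (X # Ys)) Xs"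
  using wedge_Suc_Cons[of 0 \<alpha> \<beta>] by (simp add: wedge_0)

lemma wedge_1_Nil: "wedge 1 \<alpha> \<beta> [] = 0"
  by (simp add: wedge_Nil)

text \<open>The coframe formulas for \<omega>, \<open>\<Omega>\<^sub>2\<close>, \<psi> and the
  curvature hold only on lists of the proper length; the shuffle sum evaluates its factors on no
  others.\<close>

lemma wedge_cong:
  assumes "\<And>Ys. length Ys = k \<Longrightarrow> \<alpha> Ys = \<alpha>' Ys" "\<And>Ys. length Ys + k = length Xs \<Longrightarrow> \<beta> Ys = \<beta>' Ys"
  shows "wedge k \<alpha> \<beta> Xs = wedge k \<alpha>' \<beta>' Xs"
  unfolding wedge_def
proof (intro sum.cong refl)
  fix S assume S: "S \<in> {S. S \<subseteq> {..<length Xs} \<and> card S = k}"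
  have 1: "{i. i < length Xs \<and> i \<in> S} = S" using S by auto
  have "{i. i < length Xs \<and> i \<in> - S} = {..<length Xs} - S" by auto
  then have 2: "card {i. i < length Xs \<and> i \<in> - S} + k = length Xs"
    using S card_Diff_subset[of S "{..<length Xs}"] card_mono[of "{..<length Xs}" S] finite_subset[of S "{..<length Xs}"] by auto
  have "\<alpha> (nths Xs S) = \<alpha>' (nths Xs S)" "\<beta> (nths Xs (- S)) = \<beta>' (nths Xs (- S))"
    using S 1 2 by (auto intro!: assms simp: length_nths)
  then show "((-1) ^ (\<Sum>S + \<Sum>{..<k}) * \<beta> (nths Xs (- S))) *\<^sub>R \<alpha> (nths Xs S) =
    ((-1) ^ (\<Sum>S + \<Sum>{..<k}) * \<beta>' (nths Xs (- S))) *\<^sub>R \<alpha>' (nths Xs S)" by simp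
qed

section \<open>Linearity of the wedge product in each factor\<close>

lemma wedge_add_right: "wedge k \<alpha> (\<lambda>Ys. \<beta> Ys + \<gamma> Ys) Xs = wedge k \<alpha> \<beta> Xs + wedge k \<alpha> \<gamma> Xs"
  by (simp add: wedge_def distrib_left scaleR_left_distrib sum.distrib)

lemma wedge_cmul_right: "wedge k \<alpha> (\<lambda>Ys. c * \<beta> Ys) Xs = c *\<^sub>R wedge k \<alpha> \<beta> Xs"
  by (simp add: wedge_def scaleR_sum_right mult_ac)

lemma wedge_minus_right: "wedge k \<alpha> (\<lambda>Ys. - \<beta> Ys) Xs = - wedge k \<alpha> \<beta> Xs"
  using wedge_cmul_right[of k \<alpha> "-1" \<beta> Xs] by simp

lemma wedge_zero_right: "wedge k \<alpha> (\<lambda>Ys. 0) Xs = 0"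
  by (simp add: wedge_def)

lemma wedge_add_left: "wedge k (\<lambda>Ys. \<alpha> Ys + \<gamma> Ys) \<beta> Xs = wedge k \<alpha> \<beta> Xs + wedge k \<gamma> \<beta> Xs"
  by (simp add: wedge_def scaleR_right_distrib sum.distrib)

lemma wedge_cmul_left: "wedge k (\<lambda>Ys. c * \<alpha> Ys) \<beta> Xs = c * wedge k \<alpha> \<beta> (Xs :: 'v list)" for \<alpha> :: "'v list \<Rightarrow> real"
  by (simp add: wedge_def sum_distrib_left mult_ac)

lemma wedge_component: "wedge k \<alpha> \<beta> Xs $ i = wedge k (\<lambda>Ys. \<alpha> Ys $ i) \<beta> Xs"
  by (simp add: wedge_def)

section \<open>Anticommutation of one-forms and associativity\<close>

text \<open>The first two summands are antisymmetric in \<open>a\<close> and \<open>b\<close>, and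
  the last has the shape of the left side with \<gamma> replaced by a partial evaluation; this is
  the induction step for anticommutation.\<close>

lemma wedge_1_1:
  fixes a b :: "'v list \<Rightarrow> real"
  shows "wedge 1 a (wedge 1 b \<gamma>) (X # Xs) =
     a [X] * wedge 1 b \<gamma> Xs - b [X] * wedge 1 a \<gamma> Xs + wedge 1 a (wedge 1 b (\<lambda>Ys. \<gamma> (X # Ys))) Xs"
proof -
  have "(\<lambda>Ys. wedge 1 b \<gamma> (X # Ys)) = (\<lambda>Ys. b [X] * \<gamma> Ys + - wedge 1 b (\<lambda>Ys. \<gamma> (X # Ys)) Ys)"
    by (simp add: wedge_1_Cons mult.commute fun_eq_iff del: One_nat_def)
  then show ?thesis
    by (simp only: wedge_1_Cons[of a "wedge 1 b \<gamma>"] wedge_add_right wedge_cmul_right wedge_minus_right) simp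
qed

lemma wedge_1_swap:
  fixes a b :: "'v list \<Rightarrow> real"
  shows "wedge 1 a (wedge 1 b \<gamma>) = (\<lambda>Xs. - wedge 1 b (wedge 1 a \<gamma>) Xs)"
proof
  fix Xs show "wedge 1 a (wedge 1 b \<gamma>) Xs = - wedge 1 b (wedge 1 a \<gamma>) Xs"
  proof (induction Xs arbitrary: \<gamma>)
    case Nil then show ?case by (simp add: wedge_1_Nil del: One_nat_def)
  next
    case (Cons X Xs) show ?case unfolding wedge_1_1 Cons.IH by simp
  qed
qed

lemma wedge_1_self:
  fixes a :: "'v list \<Rightarrow> real"
  shows "wedge 1 a (wedge 1 a \<gamma>) = (\<lambda>Xs. 0)"
  using wedge_1_swap[of a a \<gamma>] by (auto simp: fun_eq_iff)

text \<open>Both sides expand into the same three terms, according to whether the first argument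
  reaches \<open>a\<close>, \<beta> or \<gamma>. One-forms on the left suffice, since the forms
  below are sums of iterated products of one-forms.\<close>

lemma wedge_assoc_1:
  fixes a \<beta> :: "'v list \<Rightarrow> real"
  shows "wedge (Suc k) (wedge 1 a \<beta>) \<gamma> = wedge 1 a (wedge k \<beta> \<gamma>)"
proof
  fix Xs show "wedge (Suc k) (wedge 1 a \<beta>) \<gamma> Xs = wedge 1 a (wedge k \<beta> \<gamma>) Xs"
  proof (induction Xs arbitrary: k \<beta> \<gamma>)
    case Nil then show ?case by (simp add: wedge_Nil)
  next
    case (Cons X Xs)
    have 1: "(\<lambda>Ys. wedge 1 a \<beta> (X # Ys)) = (\<lambda>Ys. a [X] * \<beta> Ys + (-1) * wedge 1 a (\<lambda>Ys. \<beta> (X # Ys)) Ys)"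
      by (simp add: wedge_1_Cons mult.commute fun_eq_iff del: One_nat_def)
    have L: "wedge (Suc k) (wedge 1 a \<beta>) \<gamma> (X # Xs) =
        a [X] * wedge k \<beta> \<gamma> Xs - wedge k (wedge 1 a (\<lambda>Ys. \<beta> (X # Ys))) \<gamma> Xs
        + (-1) ^ Suc k * wedge 1 a (wedge k \<beta> (\<lambda>Ys. \<gamma> (X # Ys))) Xs"
      by (simp only: wedge_Suc_Cons 1 wedge_add_left wedge_cmul_left Cons.IH) simp
    show ?case
    proof (cases k)
      \<comment> \<open>For \<open>k = 0\<close> the factor \<beta> takes no argument, so the middle
        term drops out.\<close>
      case 0
      have "wedge 0 (wedge 1 a (\<lambda>Ys. \<beta> (X # Ys))) \<gamma> Xs = 0" by (simp add: wedge_0 wedge_Nil)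
      moreover have "(\<lambda>Ys. wedge 0 \<beta> \<gamma> (X # Ys)) = wedge 0 \<beta> (\<lambda>Ys. \<gamma> (X # Ys))"
        by (simp add: wedge_0 fun_eq_iff)
      ultimately show ?thesis unfolding 0 L[unfolded 0] wedge_1_Cons[of a "wedge 0 \<beta> \<gamma>"] by (simp del: One_nat_def)
    next
      case (Suc j)
      have "(\<lambda>Ys. wedge k \<beta> \<gamma> (X # Ys)) =
          (\<lambda>Ys. wedge j (\<lambda>Ys. \<beta> (X # Ys)) \<gamma> Ys + (-1) ^ k * wedge k \<beta> (\<lambda>Ys. \<gamma> (X # Ys)) Ys)"
        by (simp add: fun_eq_iff Suc wedge_Suc_Cons)
      moreover have "wedge k (wedge 1 a (\<lambda>Ys. \<beta> (X # Ys))) \<gamma> Xs = wedge 1 a (wedge j (\<lambda>Ys. \<beta> (X # Ys)) \<gamma>) Xs"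
        unfolding Suc by (rule Cons.IH)
      ultimately show ?thesis
        unfolding L wedge_1_Cons[of a "wedge k \<beta> \<gamma>"]
        by (simp only: wedge_add_right wedge_cmul_right) (simp del: One_nat_def)
    qed
  qed
qed

section \<open>The six-form of the instanton equation in a coframe\<close>

text \<open>The numeral \<open>1\<close> has to survive simplification, since it occurs as an index of \<open>coframe\<close>.\<close>

declare One_nat_def [simp del]

definition coframe :: "nat \<Rightarrow> lie list \<Rightarrow> real" where
  "coframe i = [dt, eta_plus 1, eta_plus 2, eta_plus 3, eta_minus 1, eta_minus 2, eta_minus 3] ! i"

abbreviation W :: "nat \<Rightarrow> (lie list \<Rightarrow> real) \<Rightarrow> lie list \<Rightarrow> real" where
  "W i \<equiv> wedge 1 (coframe i)"

text \<open>The zero-form 1 closes every product, so a product of coframe elements is a word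
  \<open>W i (W j (... one))\<close> and anticommutation applies at every position, including the
  last two.\<close>

abbreviation one :: "lie list \<Rightarrow> real" where "one \<equiv> (\<lambda>_. 1)"

lemma coframe_simps:
  "dt = coframe 0" "eta_plus 1 = coframe 1" "eta_plus 2 = coframe 2" "eta_plus 3 = coframe 3"
  "eta_minus 1 = coframe 4" "eta_minus 2 = coframe 5" "eta_minus 3 = coframe 6"
  by (simp_all add: coframe_def)

text \<open>The condition \<open>j < i\<close> orients anticommutation into a terminating rewrite
  rule that sorts products by index.\<close>

lemma W_swap: "j < i \<Longrightarrow> W i (W j \<gamma>) = (\<lambda>Xs. - W j (W i \<gamma>) Xs)"
  by (rule wedge_1_swap)

lemma less_numerals:
  "(0::nat) < 1" "(0::nat) < numeral n" "(1::nat) < numeral (num.Bit0 n)" "(1::nat) < numeral (num.Bit1 n)"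
  "(2::nat) < 3" "(2::nat) < 4" "(2::nat) < 5" "(2::nat) < 6" "(3::nat) < 4" "(3::nat) < 5"
  "(3::nat) < 6" "(4::nat) < 5" "(4::nat) < 6" "(5::nat) < 6"
  by simp_all

lemma W_one: "length Xs = 1 \<Longrightarrow> wedge 1 a one Xs = a Xs" for a :: "lie list \<Rightarrow> real"
  by (cases Xs) (auto simp: wedge_1_Cons wedge_1_Nil)

lemma wedge_two_one_forms:
  fixes a b :: "lie list \<Rightarrow> real"
  assumes "length Xs = 2" shows "wedge 1 a b Xs = wedge 1 a (wedge 1 b one) Xs"
  by (rule wedge_cong) (use assms in \<open>auto simp: W_one\<close>)

lemma wedge_three_one_forms:
  fixes a b :: "lie list \<Rightarrow> real"
  assumes "length Xs = 3" shows "wedge 1 a (wedge 1 b c) Xs = wedge 1 a (wedge 1 b (wedge 1 c one)) Xs"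
  by (rule wedge_cong) (use assms in \<open>auto intro: wedge_two_one_forms\<close>)

lemma wedge_2_W: "wedge 2 (W i (W j one)) \<gamma> = W i (W j \<gamma>)"
proof -
  have "wedge 2 (W i (W j one)) \<gamma> = W i (W j (wedge 0 one \<gamma>))"
    by (simp only: wedge_assoc_1 numeral_2_eq_2)
  also have "wedge 0 one \<gamma> = \<gamma>" by (simp add: wedge_0 fun_eq_iff)
  finally show ?thesis .
qed

lemma wedge_minus_left: "wedge k (\<lambda>Ys. - \<alpha> Ys) \<beta> Xs = - wedge k \<alpha> \<beta> (Xs :: 'v list)" for \<alpha> :: "'v list \<Rightarrow> real"
  using wedge_cmul_left[of k "-1" \<alpha>] by simp

lemma wedge_diff_right: "wedge k \<alpha> (\<lambda>Ys. \<beta> Ys - \<gamma> Ys) Xs = wedge k \<alpha> \<beta> Xs - wedge k \<alpha> \<gamma> Xs"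
  using wedge_add_right[of k \<alpha> \<beta> "\<lambda>Ys. - \<gamma> Ys"] by (simp add: wedge_minus_right)

lemma wedge_diff_left: "wedge k (\<lambda>Ys. \<alpha> Ys - \<gamma> Ys) \<beta> Xs = wedge k \<alpha> \<beta> Xs - wedge k \<gamma> \<beta> (Xs :: 'v list)" for \<alpha> :: "'v list \<Rightarrow> real"
  using wedge_add_left[of k \<alpha> "\<lambda>Ys. - \<gamma> Ys"] by (simp add: wedge_minus_left)

lemmas W_linear = ext[OF wedge_add_right]
  ext[OF wedge_cmul_right]
  ext[OF wedge_minus_right]
  ext[OF wedge_zero_right]
  ext[OF wedge_add_left]
  ext[OF wedge_cmul_left]
  ext[OF wedge_minus_left]
  ext[OF wedge_diff_right]
  ext[OF wedge_diff_left]

section \<open>Normal forms of \<omega>, \<open>\<Omega>\<^sub>2\<close>, \<psi> and the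
  curvature\<close>

definition omega_coframe :: "real \<Rightarrow> lie list \<Rightarrow> real" where
  "omega_coframe c Xs = - 4 * c * (W 1 (W 4 one) Xs + W 2 (W 5 one) Xs + W 3 (W 6 one) Xs)"

definition Omega2_coframe :: "real \<Rightarrow> real \<Rightarrow> lie list \<Rightarrow> real" where
  "Omega2_coframe a b Xs = - 8 * a^3 * W 1 (W 2 (W 3 one)) Xs
     + 8 * b^2 * a * (W 1 (W 5 (W 6 one)) Xs - W 2 (W 4 (W 6 one)) Xs + W 3 (W 4 (W 5 one)) Xs)"

lemma eps_values:
  "eps 1 2 3 = 1" "eps 2 3 1 = 1" "eps 3 1 2 = 1" "eps 1 3 2 = -1" "eps 3 2 1 = -1" "eps 2 1 3 = -1"
  "eps i i k = 0" "eps i k k = 0" "eps i k i = 0"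
  using exhaust_3[of i] exhaust_3[of k] by (auto simp: eps_def cross3_simps axis_def)

lemma omega_eq: "length Xs = 2 \<Longrightarrow> omega t Xs = omega_coframe (A1 t * B1 t) Xs"
  unfolding omega_def omega_coframe_def sum_3 coframe_simps
  by (simp add: wedge_two_one_forms[of _ "coframe i" "coframe j" for i j] W_swap W_linear)
     (simp add: algebra_simps)

lemma Omega2_eq: "length Xs = 3 \<Longrightarrow> Omega2 t Xs = Omega2_coframe (A1 t) (B1 t) Xs"
  unfolding Omega2_def Omega2_coframe_def sum_3 eps_values coframe_simps
  by (simp add: wedge_three_one_forms[of _ "coframe i" "coframe j" "coframe k" for i j k] W_swap W_linear)
     (simp add: algebra_simps)

text \<open>Half the square of \<omega> produces each pair \<open>i < j\<close> once with
  coefficient \<open>16 (a b)\<^sup>2\<close>; sorting \<open>\<eta>\<^sub>i\<^sup>+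
  \<eta>\<^sub>i\<^sup>- \<eta>\<^sub>j\<^sup>+ \<eta>\<^sub>j\<^sup>-\<close> gives the minus
  sign.\<close>

definition psi_coframe :: "real \<Rightarrow> real \<Rightarrow> lie list \<Rightarrow> real" where
  "psi_coframe a b Xs = - 16 * (a * b)^2 * (W 1 (W 2 (W 4 (W 5 one))) Xs + W 1 (W 3 (W 4 (W 6 one))) Xs
       + W 2 (W 3 (W 5 (W 6 one))) Xs) + 8 * a^3 * W 0 (W 1 (W 2 (W 3 one))) Xs
     - 8 * b^2 * a * (W 0 (W 1 (W 5 (W 6 one))) Xs - W 0 (W 2 (W 4 (W 6 one))) Xs + W 0 (W 3 (W 4 (W 5 one))) Xs)"

lemma psi_eq: assumes "length Xs = 4" shows "psi t Xs = psi_coframe (A1 t) (B1 t) Xs"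
proof -
  have "wedge 2 (omega t) (omega t) Xs = wedge 2 (omega_coframe (A1 t * B1 t)) (omega_coframe (A1 t * B1 t)) Xs"
    by (rule wedge_cong) (use assms in \<open>auto simp: omega_eq\<close>)
  moreover have "wedge 1 dt (Omega2 t) Xs = wedge 1 dt (Omega2_coframe (A1 t) (B1 t)) Xs"
    by (rule wedge_cong) (use assms in \<open>auto simp: Omega2_eq\<close>)
  ultimately show ?thesis
    unfolding psi_def psi_coframe_def coframe_simps omega_coframe_def[abs_def] Omega2_coframe_def[abs_def]
    by (simp add: W_linear wedge_2_W W_swap wedge_1_self)
       (simp add: algebra_simps power2_eq_square)
qed

text \<open>The \<open>T\<^sub>i\<close>-component of the curvature for cyclic
  \<open>(i, j, k)\<close>, with index \<open>i + 3\<close> for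
  \<open>\<eta>\<^sub>i\<^sup>-\<close>. The terms linear in \<open>f\<close> and \<open>g\<close>
  come from \<open>d\<eta>\<^sub>i\<^sup>+ = - 2 (\<eta>\<^sub>j\<^sup>+ \<eta>\<^sub>k\<^sup>+ +
  \<eta>\<^sub>j\<^sup>- \<eta>\<^sub>k\<^sup>-)\<close> and its analogue for
  \<open>\<eta>\<^sub>i\<^sup>-\<close>, the quadratic ones from the bracket of the form with
  itself.\<close>

definition F_coframe :: "nat \<Rightarrow> nat \<Rightarrow> nat \<Rightarrow> real \<Rightarrow> real \<Rightarrow> real \<Rightarrow> real \<Rightarrow> lie list \<Rightarrow> real" where
  "F_coframe i j k f g f' g' Xs = f' * W 0 (W i one) Xs + g' * W 0 (W (i + 3) one) Xs
     + 2 * (f^2 - f) * W j (W k one) Xs + 2 * g * (f - 1) * (W j (W (k + 3) one) Xs - W k (W (j + 3) one) Xs)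
     + 2 * (g^2 - f) * W (j + 3) (W (k + 3) one) Xs"

lemmas W_swaps = W_swap[OF less_numerals(1)] W_swap[OF less_numerals(2)] W_swap[OF less_numerals(3)]
  W_swap[OF less_numerals(4)] W_swap[OF less_numerals(5)] W_swap[OF less_numerals(6)]
  W_swap[OF less_numerals(7)] W_swap[OF less_numerals(8)] W_swap[OF less_numerals(9)]
  W_swap[OF less_numerals(10)] W_swap[OF less_numerals(11)] W_swap[OF less_numerals(12)]
  W_swap[OF less_numerals(13)] W_swap[OF less_numerals(14)] wedge_1_self real_scaleR_def
  mult_minus_right mult_zero_right add_0_left add_0_right minus_minus diff_0_right neg_equal_iff_equal

text \<open>For each component only two six-forms survive, and their coefficients are the same for
  all three cyclic triples. This is why the three \<open>su2\<close> components reduce to two scalar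
  equations.\<close>

lemma F_coframe_wedge_psi:
  assumes "(i,j,k) \<in> {(1,2,3),(2,3,1),(3,1,2)}"
  shows "wedge 2 (F_coframe i j k f g f' g') (psi_coframe a b) Xs =
     -16 * (a^2 * b^2 * f' + a * b^2 * (f^2 - f) - a^3 * (g^2 - f)) * W 0 (W i (W j (W k (W (j + 3) (W (k + 3) one))))) Xs
     + (-16) * (a^2 * b^2 * g' - 2 * a * b^2 * g * (f - 1)) * W 0 (W (i+3) (W (j + 3) (W (k+3) (W j (W k one))))) Xs"
proof -
  consider "i = 1" "j = 2" "k = 3" | "i = 2" "j = 3" "k = 1" | "i = 3" "j = 1" "k = 2"
    using assms by auto
  moreover have *: "(1::nat) + 3 = 4" "(2::nat) + 3 = 5" "(3::nat) + 3 = 6" by simp_all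
  ultimately show ?thesis
  proof cases
    case 1 show ?thesis unfolding 1 F_coframe_def[abs_def] psi_coframe_def[abs_def]
      by (simp only: * W_linear wedge_2_W W_swaps)
         (simp add: algebra_simps power2_eq_square power3_eq_cube)
  next
    case 2 show ?thesis unfolding 2 F_coframe_def[abs_def] psi_coframe_def[abs_def]
      by (simp only: * W_linear wedge_2_W W_swaps)
         (simp add: algebra_simps power2_eq_square power3_eq_cube)
  next
    case 3 show ?thesis unfolding 3 F_coframe_def[abs_def] psi_coframe_def[abs_def]
      by (simp only: * W_linear wedge_2_W W_swaps)
         (simp add: algebra_simps power2_eq_square power3_eq_cube)
  qed
qed

declare One_nat_def [simp]

section \<open>Smooth calculus\<close>

lemma Ck_on_cong:
  assumes "open S" "\<And>x. x \<in> S \<Longrightarrow> f x = g x"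
  shows "Ck_on k f S \<longleftrightarrow> Ck_on k g S"
  using assms
proof (induction k arbitrary: f g)
  case 0 then show ?case by (simp cong: continuous_on_cong)
next
  case (Suc k)
  have *: "(f has_derivative D) (at x) \<longleftrightarrow> (g has_derivative D) (at x)" if "x \<in> S" for x D
    by (rule iffI; erule has_derivative_transform_within_open[OF _ Suc.prems(1) that]) (simp_all add: Suc.prems(2))
  have "f differentiable at x \<longleftrightarrow> g differentiable at x" if "x \<in> S" for x
    unfolding differentiable_def using *[OF that] by simp
  moreover have "frechet_derivative f (at x) = frechet_derivative g (at x)" if "x \<in> S" for x
    unfolding frechet_derivative_def using *[OF that] by simp
  then have "Ck_on k (\<lambda>x. frechet_derivative f (at x) b) S \<longleftrightarrow>
      Ck_on k (\<lambda>x. frechet_derivative g (at x) b) S" for b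
    by (intro Suc.IH[OF Suc.prems(1)]) simp
  ultimately show ?case by simp
qed

lemma Ck_on_SucI:
  assumes "open S" "\<And>x. x \<in> S \<Longrightarrow> (f has_derivative D x) (at x)"
    and "\<And>b. b \<in> Basis \<Longrightarrow> Ck_on k (\<lambda>x. D x b) S"
  shows "Ck_on (Suc k) f S"
proof -
  have "f differentiable at x" if "x \<in> S" for x
    using assms(2)[OF that] by (auto simp: differentiable_def)
  moreover have "frechet_derivative f (at x) = D x" if "x \<in> S" for x
    using frechet_derivative_at[OF assms(2)[OF that]] by simp
  then have "Ck_on k (\<lambda>x. frechet_derivative f (at x) b) S \<longleftrightarrow> Ck_on k (\<lambda>x. D x b) S" for b
    by (intro Ck_on_cong[OF assms(1)]) simp
  ultimately show ?thesis using assms(3) by simp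
qed

lemma Ck_on_SucD:
  assumes "Ck_on (Suc k) f S" "x \<in> S"
  shows "(f has_derivative frechet_derivative f (at x)) (at x)"
  using assms by (auto simp: frechet_derivative_works)

lemma Ck_on_Suc_imp: "Ck_on (Suc k) f S \<Longrightarrow> Ck_on k f S"
proof (induction k arbitrary: f)
  case 0 then show ?case
    by (auto intro!: continuous_at_imp_continuous_on differentiable_imp_continuous_within)
next
  case (Suc k) then show ?case by simp
qed

lemma Ck_on_subset: "Ck_on k f S \<Longrightarrow> U \<subseteq> S \<Longrightarrow> Ck_on k f U"
proof (induction k arbitrary: f)
  case 0 then show ?case by (auto intro: continuous_on_subset)
next
  case (Suc k) then show ?case by auto
qed

lemma Ck_on_const: "open S \<Longrightarrow> Ck_on k (\<lambda>x. c) S"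
  by (induction k arbitrary: c) (auto intro!: Ck_on_SucI[where D = "\<lambda>x b. 0"])

lemma Ck_on_add:
  assumes "open S" "Ck_on k f S" "Ck_on k g S" shows "Ck_on k (\<lambda>x. f x + g x) S"
  using assms(2,3)
proof (induction k arbitrary: f g)
  case 0 then show ?case by (auto intro: continuous_on_add)
next
  case (Suc k)
  show ?case
    by (rule Ck_on_SucI[OF assms(1) has_derivative_add[OF Ck_on_SucD[OF Suc.prems(1)] Ck_on_SucD[OF Suc.prems(2)]]])
       (use Suc in auto)
qed

lemma Ck_on_linear:
  fixes L :: "'b::real_normed_vector \<Rightarrow> 'c::real_normed_vector"
  assumes "open S" "bounded_linear L" "Ck_on k f S" shows "Ck_on k (\<lambda>x. L (f x)) S"
  using assms(3)
proof (induction k arbitrary: f)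
  case 0 then show ?case by (auto intro: bounded_linear.continuous_on[OF assms(2)])
next
  case (Suc k)
  show ?case
    by (rule Ck_on_SucI[OF assms(1) bounded_linear.has_derivative[OF assms(2) Ck_on_SucD[OF Suc.prems]]])
       (use Suc in auto)
qed

lemma Ck_on_ident: assumes "open S" shows "Ck_on k (\<lambda>x. x) S"
  by (cases k) (auto intro!: Ck_on_SucI[where D = "\<lambda>x b. b"] assms Ck_on_const)

lemma Ck_on_bilinear:
  assumes "open S" "bounded_bilinear B" "Ck_on k f S" "Ck_on k g S"
  shows "Ck_on k (\<lambda>x. B (f x) (g x)) S"
  using assms(3,4)
proof (induction k arbitrary: f g)
  case 0 then show ?case by (auto intro: bounded_bilinear.continuous_on[OF assms(2)])
next
  case (Suc k)
  show ?case
  proof (rule Ck_on_SucI[OF assms(1) bounded_bilinear.FDERIV[OF assms(2) Ck_on_SucD[OF Suc.prems(1)] Ck_on_SucD[OF Suc.prems(2)]]])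
    fix b :: 'a assume "b \<in> Basis"
    then show "Ck_on k (\<lambda>x. B (f x) (frechet_derivative g (at x) b) + B (frechet_derivative f (at x) b) (g x)) S"
      using Suc.prems Suc.prems[THEN Ck_on_Suc_imp] by (intro Ck_on_add assms(1) Suc.IH) auto
  qed
qed

lemma Ck_on_mult:
  fixes f g :: "'a::euclidean_space \<Rightarrow> real"
  shows "open S \<Longrightarrow> Ck_on k f S \<Longrightarrow> Ck_on k g S \<Longrightarrow> Ck_on k (\<lambda>x. f x * g x) S"
  by (rule Ck_on_bilinear[OF _ bounded_bilinear_mult])

lemma Ck_on_real_SucI:
  fixes h :: "real \<Rightarrow> 'b::real_normed_vector"
  assumes "open I" "\<And>x. x \<in> I \<Longrightarrow> (h has_vector_derivative h' x) (at x)" "Ck_on k h' I"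
  shows "Ck_on (Suc k) h I"
  by (rule Ck_on_SucI[OF assms(1) assms(2)[unfolded has_vector_derivative_def]]) (use assms(3) in auto)

lemma Ck_on_real_SucD:
  fixes h :: "real \<Rightarrow> 'b::real_normed_vector"
  assumes "Ck_on (Suc k) h I"
  shows "\<And>x. x \<in> I \<Longrightarrow> (h has_vector_derivative frechet_derivative h (at x) 1) (at x)"
    and "Ck_on k (\<lambda>x. frechet_derivative h (at x) 1) I"
proof -
  fix x assume "x \<in> I"
  then have D: "(h has_derivative frechet_derivative h (at x)) (at x)" by (rule Ck_on_SucD[OF assms])
  have "frechet_derivative h (at x) y = y *\<^sub>R frechet_derivative h (at x) 1" for y
    using linear.scaleR[OF has_derivative_linear[OF D], of y 1] by simp
  then have "frechet_derivative h (at x) = (\<lambda>y. y *\<^sub>R frechet_derivative h (at x) 1)" by blast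
  with D show "(h has_vector_derivative frechet_derivative h (at x) 1) (at x)"
    by (simp add: has_vector_derivative_def)
qed (use assms in simp)

text \<open>The induction varies \<open>h\<close>, because the chain rule produces the composition
  of its derivative with \<open>q\<close>. A real intermediate variable is enough: the coefficients
  of the connection depend on \<open>p\<close> only through \<open>p \<bullet> p\<close>.\<close>

lemma Ck_on_compose_real:
  fixes h :: "real \<Rightarrow> 'b::real_normed_vector"
  assumes "open S" "q ` S \<subseteq> I" "Ck_on k h I" "Ck_on k q S"
  shows "Ck_on k (\<lambda>x. h (q x)) S"
  using assms(3,4)
proof (induction k arbitrary: h)
  case 0 then show ?case
    using assms(2) by (auto intro: continuous_on_compose2)
next
  case (Suc k)
  let ?h' = "\<lambda>x. frechet_derivative h (at x) 1"
  show ?case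
  proof (rule Ck_on_SucI[OF assms(1)])
    fix x assume x: "x \<in> S"
    have "(h has_derivative (\<lambda>y. y *\<^sub>R ?h' (q x))) (at (q x))"
      using Ck_on_real_SucD(1)[OF Suc.prems(1)] x assms(2) by (auto simp: has_vector_derivative_def)
    from diff_chain_at[OF Ck_on_SucD[OF Suc.prems(2) x] this]
    show "((\<lambda>x. h (q x)) has_derivative (\<lambda>b. frechet_derivative q (at x) b *\<^sub>R ?h' (q x))) (at x)"
      by (simp add: o_def)
  next
    fix b :: 'a assume "b \<in> Basis"
    then show "Ck_on k (\<lambda>x. frechet_derivative q (at x) b *\<^sub>R ?h' (q x)) S"
      using Suc.prems(2) Suc.prems(2)[THEN Ck_on_Suc_imp] Ck_on_real_SucD(2)[OF Suc.prems(1)]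
      by (intro Ck_on_bilinear[OF assms(1) bounded_bilinear_scaleR] Suc.IH) auto
  qed
qed

lemma smooth_on_const: "open S \<Longrightarrow> smooth_on S (\<lambda>x. c)"
  and smooth_on_ident: "open S \<Longrightarrow> smooth_on S (\<lambda>x. x)"
  by (simp_all add: smooth_on_def Ck_on_const Ck_on_ident)

lemma smooth_on_subset: "smooth_on S f \<Longrightarrow> U \<subseteq> S \<Longrightarrow> smooth_on U f"
  unfolding smooth_on_def using Ck_on_subset by blast

lemma smooth_on_add: "open S \<Longrightarrow> smooth_on S f \<Longrightarrow> smooth_on S g \<Longrightarrow> smooth_on S (\<lambda>x. f x + g x)"
  by (simp add: smooth_on_def Ck_on_add)

lemma smooth_on_bilinear:
  "open S \<Longrightarrow> bounded_bilinear B \<Longrightarrow> smooth_on S f \<Longrightarrow> smooth_on S g \<Longrightarrow> smooth_on S (\<lambda>x. B (f x) (g x))"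
  by (simp add: smooth_on_def Ck_on_bilinear)

lemma smooth_on_linear:
  "open S \<Longrightarrow> bounded_linear L \<Longrightarrow> smooth_on S f \<Longrightarrow> smooth_on S (\<lambda>x. L (f x))"
  by (simp add: smooth_on_def Ck_on_linear)

lemma smooth_on_compose_real:
  fixes h :: "real \<Rightarrow> 'b::real_normed_vector"
  shows "open S \<Longrightarrow> q ` S \<subseteq> I \<Longrightarrow> smooth_on I h \<Longrightarrow> smooth_on S q \<Longrightarrow> smooth_on S (\<lambda>x. h (q x))"
  by (auto simp: smooth_on_def Ck_on_compose_real)

lemma smooth_on_mult:
  fixes f g :: "'a::euclidean_space \<Rightarrow> real"
  shows "open S \<Longrightarrow> smooth_on S f \<Longrightarrow> smooth_on S g \<Longrightarrow> smooth_on S (\<lambda>x. f x * g x)"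
  by (rule smooth_on_bilinear[OF _ bounded_bilinear_mult])

lemma smooth_on_scaleR:
  "open S \<Longrightarrow> smooth_on S f \<Longrightarrow> smooth_on S g \<Longrightarrow> smooth_on S (\<lambda>x. f x *\<^sub>R g x)"
  by (rule smooth_on_bilinear[OF _ bounded_bilinear_scaleR])

section \<open>Smoothness of special functions and solutions; Taylor expansion\<close>

lemma smooth_on_inverse: "smooth_on {0<..} (inverse :: real \<Rightarrow> real)"
proof -
  have "Ck_on k (inverse :: real \<Rightarrow> real) {0<..}" for k
  proof (induction k)
    case 0 then show ?case by (auto intro!: continuous_intros)
  next
    case (Suc k)
    show ?case
    proof (rule Ck_on_real_SucI[of _ _ "\<lambda>x. (-1) * (inverse x * inverse x)"])
      show "(inverse has_vector_derivative - 1 * (inverse x * inverse x)) (at x)" if "x \<in> {0<..}" for x :: real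
        using that DERIV_inverse[of x]
        by (simp add: has_real_derivative_iff_has_vector_derivative[symmetric] power2_eq_square)
      show "Ck_on k (\<lambda>x::real. -1 * (inverse x * inverse x)) {0<..}"
        by (intro Ck_on_mult Ck_on_const Suc) auto
    qed auto
  qed
  then show ?thesis by (simp add: smooth_on_def)
qed

lemma smooth_on_powr: "smooth_on {0<..} (\<lambda>x::real. x powr a)"
proof -
  have "Ck_on k (\<lambda>x::real. x powr a) {0<..}" for k
  proof (induction k arbitrary: a)
    case 0 then show ?case by (auto intro!: continuous_intros)
  next
    case (Suc k)
    show ?case
    proof (rule Ck_on_real_SucI[of _ _ "\<lambda>x. a * x powr (a - 1)"])
      show "((\<lambda>x. x powr a) has_vector_derivative a * x powr (a - 1)) (at x)" if "x \<in> {0<..}" for x :: real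
        using that has_real_derivative_powr[of x a]
        by (simp add: has_real_derivative_iff_has_vector_derivative[symmetric])
      show "Ck_on k (\<lambda>x::real. a * x powr (a - 1)) {0<..}"
        by (intro Ck_on_mult Ck_on_const Suc) auto
    qed auto
  qed
  then show ?thesis by (simp add: smooth_on_def)
qed

text \<open>The derivative is again a power series, with coefficients \<open>diffs c\<close> and
  convergent on the same interval, so the induction runs over all coefficient sequences.\<close>

lemma smooth_on_power_series:
  fixes c :: "nat \<Rightarrow> real"
  assumes "\<And>x. \<bar>x\<bar> < R \<Longrightarrow> summable (\<lambda>n. c n * x ^ n)"
  shows "smooth_on {-R<..<R} (\<lambda>x. \<Sum>n. c n * x ^ n)"
proof -
  have D: "((\<lambda>x. \<Sum>n. c n * x ^ n) has_real_derivative (\<Sum>n. diffs c n * x ^ n)) (at x)"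
    if "\<And>x. \<bar>x\<bar> < R \<Longrightarrow> summable (\<lambda>n. c n * x ^ n)" "\<bar>x\<bar> < R" for c :: "nat \<Rightarrow> real" and x
    using that by (intro termdiffs_strong'[of R]) auto
  have "Ck_on k (\<lambda>x. \<Sum>n. c n * x ^ n) {-R<..<R}" for k
    using assms
  proof (induction k arbitrary: c)
    case 0
    show ?case unfolding Ck_on.simps
      by (intro continuous_at_imp_continuous_on ballI DERIV_isCont[OF D] 0) auto
  next
    case (Suc k)
    have "summable (\<lambda>n. diffs c n * x ^ n)" if "\<bar>x\<bar> < R" for x
      by (rule termdiff_converges[of x R]) (use that Suc.prems in auto)
    then have "Ck_on k (\<lambda>x. \<Sum>n. diffs c n * x ^ n) {-R<..<R}" by (rule Suc.IH)
    moreover have "((\<lambda>x. \<Sum>n. c n * x ^ n) has_vector_derivative (\<Sum>n. diffs c n * x ^ n)) (at x)"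
      if "x \<in> {-R<..<R}" for x
      unfolding has_real_derivative_iff_has_vector_derivative[symmetric] using that by (intro D Suc.prems) auto
    ultimately show ?case by (intro Ck_on_real_SucI[of _ _ "\<lambda>x. \<Sum>n. diffs c n * x ^ n"]) auto
  qed
  then show ?thesis by (simp add: smooth_on_def)
qed

text \<open>Bootstrapping: if \<open>z\<close> is of class \<open>C\<^sup>k\<close>, then so is its
  derivative \<open>m (z s)\<close>, hence \<open>z\<close> gains one order. This supplies the
  smoothness of the inverse function \<open>Z\<close>.\<close>

lemma smooth_on_solution:
  fixes z m :: "real \<Rightarrow> real"
  assumes "open J" "open I" "z ` J \<subseteq> I" "smooth_on I m"
    and "\<And>s. s \<in> J \<Longrightarrow> (z has_real_derivative m (z s)) (at s)"
  shows "smooth_on J z"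
proof -
  have "Ck_on k z J" for k
  proof (induction k)
    case 0
    have "isCont z s" if "s \<in> J" for s
      using assms(5)[OF that] by (rule DERIV_isCont)
    then show ?case by (simp add: continuous_at_imp_continuous_on)
  next
    case (Suc k)
    show ?case
    proof (rule Ck_on_real_SucI[OF assms(1)])
      show "(z has_vector_derivative m (z s)) (at s)" if "s \<in> J" for s
        using assms(5)[OF that] by (simp add: has_real_derivative_iff_has_vector_derivative)
      show "Ck_on k (\<lambda>s. m (z s)) J"
        by (rule Ck_on_compose_real[OF assms(1,3) _ Suc.IH]) (use assms(4) in \<open>simp add: smooth_on_def\<close>)
    qed
  qed
  then show ?thesis by (simp add: smooth_on_def)
qed

lemma smooth_on_taylor:
  fixes f :: "real \<Rightarrow> real"
  assumes "smooth_on {-R<..<R} f" "R > 0" "(f has_real_derivative d) (at 0)"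
  shows "(\<lambda>s. f s - (f 0 + d * s)) \<in> O[nhds 0](\<lambda>s. s ^ 2)"
proof -
  let ?f' = "\<lambda>x. frechet_derivative f (at x) 1"
  have C: "Ck_on (Suc (Suc 0)) f {-R<..<R}" using assms(1) unfolding smooth_on_def by blast
  have D: "(f has_real_derivative ?f' x) (at x)" if "\<bar>x\<bar> < R" for x
    unfolding has_real_derivative_iff_has_vector_derivative
    by (rule Ck_on_real_SucD(1)[OF C]) (use that in auto)
  define e where "e = frechet_derivative ?f' (at 0) 1"
  have "(?f' has_real_derivative e) (at 0)"
    unfolding has_real_derivative_iff_has_vector_derivative e_def
    by (rule Ck_on_real_SucD(1)[OF Ck_on_real_SucD(2)[OF C]]) (use assms(2) in simp)
  moreover have d: "?f' 0 = d" using DERIV_unique[OF D[of 0] assms(3)] assms(2) by simp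
  ultimately have "((\<lambda>x. (?f' x - d) / x) \<longlongrightarrow> e) (at 0)"
    by (simp add: has_field_derivative_iff)
  then have "eventually (\<lambda>x. dist ((?f' x - d) / x) e < 1) (at 0)"
    by (rule tendstoD) simp
  then obtain r where r: "r > 0" "\<And>x. x \<noteq> 0 \<Longrightarrow> \<bar>x\<bar> < r \<Longrightarrow> \<bar>(?f' x - d) / x - e\<bar> < 1"
    by (auto simp: eventually_at dist_real_def)
  \<comment> \<open>The difference quotient of \<open>?f'\<close> at 0 tends to \<open>e\<close>, so
    near 0 it is bounded by \<open>\<bar>e\<bar> + 1\<close>; the mean value inequality for
    \<open>f s - d * s\<close> then gives the quadratic remainder.\<close>
  define K where "K = \<bar>e\<bar> + 1"
  have K: "\<bar>?f' x - d\<bar> \<le> K * \<bar>x\<bar>" if "\<bar>x\<bar> < r" for x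
  proof (cases "x = 0")
    case False
    have "\<bar>(?f' x - d) / x\<bar> \<le> K" using r(2)[OF False that] by (simp add: K_def)
    then show ?thesis using False by (simp add: abs_divide field_simps)
  qed (simp add: d)
  have bound: "\<bar>f s - (f 0 + d * s)\<bar> \<le> K * s ^ 2" if "\<bar>s\<bar> < min r R" for s
  proof -
    have "norm ((f s - d * s) - (f 0 - d * 0)) \<le> (K * \<bar>s\<bar>) * norm (s - 0)"
    proof (rule field_differentiable_bound[of "ball 0 (min r R) \<inter> {-\<bar>s\<bar>..\<bar>s\<bar>}"])
      show "((\<lambda>s. f s - d * s) has_field_derivative ?f' z - d)
          (at z within ball 0 (min r R) \<inter> {- \<bar>s\<bar>..\<bar>s\<bar>})" if "z \<in> ball 0 (min r R) \<inter> {-\<bar>s\<bar>..\<bar>s\<bar>}" for z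
        using that by (auto intro!: derivative_eq_intros DERIV_subset[OF D])
      show "norm (?f' z - d) \<le> K * \<bar>s\<bar>" if "z \<in> ball 0 (min r R) \<inter> {-\<bar>s\<bar>..\<bar>s\<bar>}" for z
      proof -
        have "\<bar>?f' z - d\<bar> \<le> K * \<bar>z\<bar>" using that by (intro K) auto
        also have "\<dots> \<le> K * \<bar>s\<bar>" using that by (intro mult_left_mono) (auto simp: K_def)
        finally show ?thesis by simp
      qed
    qed (use that in \<open>auto intro: convex_Int\<close>)
    then show ?thesis by (simp add: power2_eq_square algebra_simps)
  qed
  have "eventually (\<lambda>s. \<bar>s\<bar> < min r R) (nhds 0)"
    using eventually_nhds_ball[of "min r R" "0::real"] r(1) assms(2)
    by (auto elim: eventually_mono simp: dist_real_def)
  then have "eventually (\<lambda>s. norm (f s - (f 0 + d * s)) \<le> K * norm (s ^ 2)) (nhds 0)"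
    by eventually_elim (use bound in auto)
  then show ?thesis by (rule bigoI)
qed

section \<open>Connections on the bundle\<close>

lemma bounded_bilinear_qmul: "bounded_bilinear (\<odot>)"
  unfolding bilinear_conv_bounded_bilinear[symmetric] bilinear_def
  by (auto intro!: linearI simp: qmul_def cross3_simps vec_eq_iff forall_3)

lemma bounded_linear_qcnj: "bounded_linear qcnj"
  unfolding linear_conv_bounded_linear[symmetric] by (auto intro!: linearI simp: qcnj_def)

lemma qcnj_qmul: "qcnj (p \<odot> q) = qcnj q \<odot> qcnj p"
  by (simp add: qmul_def qcnj_def cross3_simps vec_eq_iff forall_3)

lemma qcnj_qcnj [simp]: "qcnj (qcnj p) = p"
  by (simp add: qcnj_def)

lemma qmul_real: "(c, 0) \<odot> p = c *\<^sub>R p" "p \<odot> (c, 0) = c *\<^sub>R p"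
  by (cases p, simp add: qmul_def)+

lemma norm_qmul: "norm (p \<odot> q) = norm p * norm q"
proof -
  have "(p \<odot> q) \<bullet> (p \<odot> q) = (p \<bullet> p) * (q \<bullet> q)"
    by (simp add: qmul_def inner_prod_def cross3_simps power2_eq_square)
  then show ?thesis by (simp add: norm_eq_sqrt_inner real_sqrt_mult)
qed

lemma SU2_inner: "g \<in> SU2 \<Longrightarrow> g \<bullet> g = 1"
  by (simp add: SU2_def norm_eq_1)

lemma qmul_cancel:
  assumes "g \<in> SU2"
  shows "qcnj g \<odot> (g \<odot> p) = p" "g \<odot> (qcnj g \<odot> p) = p" "(p \<odot> g) \<odot> qcnj g = p" "(p \<odot> qcnj g) \<odot> g = p"
  using qmul_qcnj[OF assms] by (simp_all add: qmul_assoc[symmetric] qmul_one) (simp_all add: qmul_assoc qmul_one)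

text \<open>Taking imaginary parts commutes with conjugation because the real part is central. This
  covers ambient vectors, for which \<open>qcnj b \<odot> w\<close> need not be purely
  imaginary.\<close>

lemma snd_conj:
  assumes "g \<in> SU2" shows "snd (qcnj g \<odot> q \<odot> g) = Ad (qcnj g) (snd q)"
proof -
  obtain c u where q: "q = (c, 0) + (0, u)" by (cases q) simp
  have "qcnj g \<odot> q \<odot> g = c *\<^sub>R (1, 0) + qcnj g \<odot> (0, u) \<odot> g"
    unfolding q bounded_bilinear.add_left[OF bounded_bilinear_qmul] bounded_bilinear.add_right[OF bounded_bilinear_qmul]
      qmul_real bounded_bilinear.scaleR_left[OF bounded_bilinear_qmul] qmul_qcnj[OF assms] by simp
  then show ?thesis by (simp add: Ad_def q)
qed

lemma Ad_pure:
  assumes "g \<in> SU2" shows "(0, Ad g u) = g \<odot> (0, u) \<odot> qcnj g"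
proof -
  have "fst (g \<odot> (0, u) \<odot> qcnj g) = 0"
    by (simp add: qmul_def qcnj_def cross3_simps)
  then show ?thesis by (simp add: Ad_def prod_eq_iff)
qed

lemma Ad_linear: "bounded_linear (Ad g)"
  unfolding linear_conv_bounded_linear[symmetric] Ad_def
  by (auto intro!: linearI simp: qmul_def qcnj_def cross3_simps vec_eq_iff forall_3)

lemma Ad_Ad_qcnj: assumes "g \<in> SU2" shows "Ad (qcnj g) (Ad g u) = u" "Ad g (Ad (qcnj g) u) = u"
proof -
  have "(0, Ad (qcnj g) (Ad g u)) = (0::real, u)" "(0, Ad g (Ad (qcnj g) u)) = (0::real, u)"
    using assms qcnj_mem[OF assms] by (simp_all add: Ad_pure qmul_assoc qmul_cancel qmul_qcnj qmul_one)
  then show "Ad (qcnj g) (Ad g u) = u" "Ad g (Ad (qcnj g) u) = u" by simp_all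
qed

text \<open>The real part of \<open>qcnj b \<odot> w\<close> is \<open>w \<bullet> b\<close>, so
  tangency means that this quaternion is purely imaginary.\<close>

lemma tangent_pure:
  assumes "b \<in> SU2" "w \<bullet> b = 0" shows "w = b \<odot> (0, snd (qcnj b \<odot> w))"
proof -
  have "fst (qcnj b \<odot> w) = 0" using assms(2) by (simp add: qmul_def qcnj_def inner_prod_def inner_commute mult.commute)
  then have "(0, snd (qcnj b \<odot> w)) = qcnj b \<odot> w" by (simp add: prod_eq_iff)
  then show ?thesis by (simp add: qmul_cancel[OF assms(1)])
qed

lemma qexp_mem: "qexp u \<in> SU2"
  by (cases "u = 0") (simp_all add: SU2_def qexp_def norm_prod_def)

lemma qexp_deriv: "((\<lambda>s. qexp (s *\<^sub>R \<xi>)) has_vector_derivative (0, \<xi>)) (at 0)"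
proof (cases "\<xi> = 0")
  case True then show ?thesis by (simp add: qexp_def zero_prod_def[symmetric])
next
  case False
  \<comment> \<open>Since sine is odd, the sign of \<open>s\<close> cancels between
    \<open>sin\<close> and the norm; the resulting formula is visibly smooth at
    \<open>s = 0\<close>.\<close>
  have eq: "qexp (s *\<^sub>R \<xi>) = (cos (s * norm \<xi>), (sin (s * norm \<xi>) / norm \<xi>) *\<^sub>R \<xi>)" for s
    using False by (cases "s \<ge> 0") (auto simp: qexp_def)
  have "((\<lambda>s. (cos (s * norm \<xi>), (sin (s * norm \<xi>) / norm \<xi>) *\<^sub>R \<xi>)) has_vector_derivative (0, 1 *\<^sub>R \<xi>)) (at 0)"
    by (intro has_vector_derivative_Pair bounded_linear.has_vector_derivative[OF bounded_linear_scaleR_left])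
       (auto intro!: derivative_eq_intros simp: False simp flip: has_real_derivative_iff_has_vector_derivative)
  then show ?thesis by (simp add: eq)
qed

section \<open>Derivatives of the actions and of the canonical section\<close>

lemma frechet_derivative_linear: "bounded_linear f \<Longrightarrow> frechet_derivative f (at x) = f"
  using frechet_derivative_at[OF bounded_linear_imp_has_derivative] by metis

lemmas blin_qmul_left = bounded_bilinear.bounded_linear_left[OF bounded_bilinear_qmul]
lemmas blin_qmul_right = bounded_bilinear.bounded_linear_right[OF bounded_bilinear_qmul]

lemma bounded_linear_right_act: "bounded_linear (right_act g)"
  unfolding right_act_def case_prod_beta
  by (intro bounded_linear_Pair bounded_linear_fst bounded_linear_compose[OF blin_qmul_left]
      bounded_linear_compose[OF bounded_linear_fst] bounded_linear_compose[OF bounded_linear_snd] bounded_linear_snd)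

lemma bounded_linear_left_act: "bounded_linear (left_act h1 h2 h3)"
  unfolding left_act_def case_prod_beta
  by (intro bounded_linear_Pair bounded_linear_fst bounded_linear_compose[OF blin_qmul_left] bounded_linear_compose[OF blin_qmul_right]
      bounded_linear_compose[OF bounded_linear_fst] bounded_linear_compose[OF bounded_linear_snd] bounded_linear_snd)

lemma vertical_deriv:
  "vector_derivative (\<lambda>s. right_act (qexp (s *\<^sub>R \<xi>)) (p, b1, b2)) (at 0) = (0, b1 \<odot> (0, \<xi>), b2 \<odot> (0, \<xi>))"
proof -
  have "((\<lambda>s. (p, b1 \<odot> qexp (s *\<^sub>R \<xi>), b2 \<odot> qexp (s *\<^sub>R \<xi>))) has_vector_derivative
      (0, b1 \<odot> (0, \<xi>), b2 \<odot> (0, \<xi>))) (at 0)"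
    by (intro has_vector_derivative_Pair has_vector_derivative_const
        bounded_linear.has_vector_derivative[OF blin_qmul_right] qexp_deriv)
  then show ?thesis by (simp add: right_act_def vector_derivative_at)
qed

lemma canonical_section_deriv:
  "frechet_derivative canonical_section (at (t, a1, a2)) (\<tau>, v1, v2) = (t *\<^sub>R v1 + \<tau> *\<^sub>R a1, v1, v2)"
proof -
  have "(canonical_section has_derivative (\<lambda>(\<tau>, v1, v2). (t *\<^sub>R v1 + \<tau> *\<^sub>R a1, v1, v2))) (at (t, a1, a2))"
    unfolding canonical_section_def case_prod_beta
    by (auto intro!: derivative_eq_intros)
  then show ?thesis by (simp add: frechet_derivative_at[symmetric])
qed

lemma local_form_eq:
  "local_form \<theta> (t, a1, a2) (\<tau>, u1, u2) =
     \<theta> (t *\<^sub>R a1, a1, a2) (t *\<^sub>R (a1 \<odot> (0, u1)) + \<tau> *\<^sub>R a1, a1 \<odot> (0, u1), a2 \<odot> (0, u2))"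
  by (simp add: local_form_def pullback_def left_inv_def canonical_section_deriv) (simp add: canonical_section_def)

lemma inner_qmul_pure: "(b \<odot> (0, u)) \<bullet> b = 0"
  by (cases b) (simp add: qmul_def cross3_simps inner_commute)

text \<open>
  Away from the singular orbit every tangent vector is the sum of a translate of a tangent vector to
  the canonical section and a vertical vector, so equivariance determines a connection from its
  local form.
\<close>

lemma connection_from_local_form:
  assumes conn: "connection \<epsilon> \<theta>" and z: "(p, b1, b2) \<in> P_id \<epsilon>" and p: "p \<noteq> 0"
    and V: "(v, w1, w2) \<in> TP_id (p, b1, b2)"
    and a1: "a1 = (1 / norm p) *\<^sub>R p" and g: "g = qcnj a1 \<odot> b1" and a2: "a2 = b2 \<odot> qcnj g"
    and \<tau>: "\<tau> = fst (qcnj a1 \<odot> v)" and u1: "u1 = (1 / norm p) *\<^sub>R snd (qcnj a1 \<odot> v)"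
    and \<xi>: "\<xi> = snd (qcnj b1 \<odot> w1) - Ad (qcnj g) u1"
    and u2: "u2 = Ad g (snd (qcnj b2 \<odot> w2) - \<xi>)"
  shows "\<theta> (p, b1, b2) (v, w1, w2) = Ad (qcnj g) (local_form \<theta> (norm p, a1, a2) (\<tau>, u1, u2)) + \<xi>"
    and "(norm p, a1, a2) \<in> complement \<epsilon>"
proof -
  have b: "b1 \<in> SU2" "b2 \<in> SU2" "norm p < \<epsilon>" using z by (auto simp: P_id_def)
  have w: "w1 \<bullet> b1 = 0" "w2 \<bullet> b2 = 0" using V by (auto simp: TP_id_def)
  have a1_mem: "a1 \<in> SU2" using p by (simp add: a1 SU2_def)
  then have mem: "a1 \<in> SU2" "g \<in> SU2" "a2 \<in> SU2"
    unfolding g a2 using b by (simp_all add: qmul_mem qcnj_mem)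
  have 1: "a1 \<odot> g = b1" "a2 \<odot> g = b2" "norm p *\<^sub>R a1 = p"
    using mem p unfolding g a2 by (simp_all add: qmul_cancel, simp_all add: a1)
  show compl: "(norm p, a1, a2) \<in> complement \<epsilon>"
    using mem p b by (simp add: complement_def)
  \<comment> \<open>\<open>U\<close> is tangent to the image of the canonical section at
    \<open>(p, a1, a2)\<close>; the given vector will be its translate under
    \<open>right_act g\<close> plus a vertical vector.\<close>
  define U where "U = (norm p *\<^sub>R (a1 \<odot> (0, u1)) + \<tau> *\<^sub>R a1, a1 \<odot> (0, u1), a2 \<odot> (0, u2))"
  have "a1 \<odot> (\<tau>, norm p *\<^sub>R u1) = v"
    using p by (simp add: \<tau> u1 qmul_cancel mem)
  also have "(\<tau>, norm p *\<^sub>R u1) = (\<tau>, 0) + norm p *\<^sub>R (0, u1)" by simp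
  finally have v: "norm p *\<^sub>R (a1 \<odot> (0, u1)) + \<tau> *\<^sub>R a1 = v"
    by (simp only: bounded_bilinear.add_right[OF bounded_bilinear_qmul] qmul_real
        bounded_bilinear.scaleR_right[OF bounded_bilinear_qmul] add.commute)
  have conj: "(a \<odot> (0, u)) \<odot> g = (a \<odot> g) \<odot> (0, Ad (qcnj g) u)" for a u
    using Ad_pure[of "qcnj g" u] mem by (simp add: qcnj_mem qmul_assoc qmul_cancel)
  \<comment> \<open>The \<open>b1\<close>-component determines \<xi>; \<open>u2\<close> is chosen so
    that the same vertical vector also accounts for the \<open>b2\<close>-component.\<close>
  have "b1 \<odot> (0, Ad (qcnj g) u1) + b1 \<odot> (0, \<xi>) = b1 \<odot> (0, snd (qcnj b1 \<odot> w1))"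
    by (simp add: bounded_bilinear.add_right[OF bounded_bilinear_qmul, symmetric] \<xi>)
  then have w1: "(a1 \<odot> (0, u1)) \<odot> g + b1 \<odot> (0, \<xi>) = w1"
    using tangent_pure[OF b(1) w(1)] by (simp add: conj 1)
  have "b2 \<odot> (0, Ad (qcnj g) u2) + b2 \<odot> (0, \<xi>) = b2 \<odot> (0, snd (qcnj b2 \<odot> w2))"
    by (simp add: bounded_bilinear.add_right[OF bounded_bilinear_qmul, symmetric] u2 Ad_Ad_qcnj mem)
  then have w2: "(a2 \<odot> (0, u2)) \<odot> g + b2 \<odot> (0, \<xi>) = w2"
    using tangent_pure[OF b(2) w(2)] by (simp add: conj 1)
  let ?z = "(p, b1, b2)" and ?y = "(p, a1, a2)"
  have y: "?y \<in> P_id \<epsilon>" using mem b by (simp add: P_id_def)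
  have z_eq: "right_act g ?y = ?z" by (simp add: right_act_def 1)
  have V_eq: "(v, w1, w2) = right_act g U + (0, b1 \<odot> (0, \<xi>), b2 \<odot> (0, \<xi>))"
    by (simp add: U_def right_act_def v w1 w2)
  have T1: "U \<in> TP_id ?y" by (simp add: U_def TP_id_def inner_qmul_pure)
  have T3: "(0, b1 \<odot> (0, \<xi>), b2 \<odot> (0, \<xi>)) \<in> TP_id ?z" by (simp add: TP_id_def inner_qmul_pure)
  have T2: "right_act g U \<in> TP_id ?z"
    by (simp add: U_def right_act_def TP_id_def conj 1 inner_qmul_pure)
  obtain Wd \<Theta> where \<Theta>: "P_id \<epsilon> \<subseteq> Wd" "\<And>x. x \<in> Wd \<Longrightarrow> linear (\<Theta> x)"
      "\<And>x v. x \<in> P_id \<epsilon> \<Longrightarrow> v \<in> TP_id x \<Longrightarrow> \<Theta> x v = \<theta> x v"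
    using conn unfolding connection_def smooth_one_form_def by metis
  \<comment> \<open>A connection is known to be linear only on tangent vectors, through its ambient
    extension \<Theta>; hence the tangency of all three vectors enters.\<close>
  have "\<theta> ?z (v, w1, w2) = \<theta> ?z (right_act g U) + \<theta> ?z (0, b1 \<odot> (0, \<xi>), b2 \<odot> (0, \<xi>))"
    using linear_add[OF \<Theta>(2), of ?z "right_act g U" "(0, b1 \<odot> (0, \<xi>), b2 \<odot> (0, \<xi>))"] \<Theta>(1,3) z V T2 T3
    by (auto simp flip: V_eq)
  also have "\<theta> ?z (0, b1 \<odot> (0, \<xi>), b2 \<odot> (0, \<xi>)) = \<xi>"
    using conn z vertical_deriv[of \<xi> p b1 b2] unfolding connection_def by metis
  also have "\<theta> ?z (right_act g U) = pullback (right_act g) \<theta> ?y U"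
    by (simp add: pullback_def frechet_derivative_linear[OF bounded_linear_right_act] z_eq)
  also have "\<dots> = Ad (qcnj g) (\<theta> ?y U)"
    using conn y T1 mem unfolding connection_def by blast
  also have "\<theta> ?y U = local_form \<theta> (norm p, a1, a2) (\<tau>, u1, u2)"
    by (simp add: local_form_eq U_def 1)
  finally show "\<theta> ?z (v, w1, w2) = Ad (qcnj g) (local_form \<theta> (norm p, a1, a2) (\<tau>, u1, u2)) + \<xi>" .
qed

text \<open>The tangent spaces do not depend on \<open>p\<close>, so a fixed \<open>V\<close> stays
  tangent while \<open>p\<close> runs along the real ray to 0, where the ambient extension is
  continuous.\<close>

lemma connection_continuous_radially:
  assumes "connection \<epsilon> \<theta>" "0 < \<epsilon>" "b1 \<in> SU2" "b2 \<in> SU2" "V \<in> TP_id (0, b1, b2)"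
  shows "((\<lambda>s. \<theta> ((s, 0), b1, b2) V) \<longlongrightarrow> \<theta> (0, b1, b2) V) (at_right 0)"
proof -
  obtain Wd \<Theta> where \<Theta>: "open Wd" "P_id \<epsilon> \<subseteq> Wd" "\<And>v. smooth_on Wd (\<lambda>x. \<Theta> x v)"
      "\<And>x v. x \<in> P_id \<epsilon> \<Longrightarrow> v \<in> TP_id x \<Longrightarrow> \<Theta> x v = \<theta> x v"
    using assms(1) unfolding connection_def smooth_one_form_def by metis
  have mem: "((s, 0), b1, b2) \<in> P_id \<epsilon>" if "\<bar>s\<bar> < \<epsilon>" for s
    using that assms by (simp add: P_id_def norm_prod_def)
  have TV: "V \<in> TP_id (q, b1, b2)" for q using assms(5) by (simp add: TP_id_def)
  have "Ck_on 0 (\<lambda>x. \<Theta> x V) Wd" using \<Theta>(3) unfolding smooth_on_def by blast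
  then have "isCont (\<lambda>x. \<Theta> x V) ((0, 0), b1, b2)"
    using \<Theta>(1,2) mem[of 0] assms(2) by (auto simp: continuous_on_eq_continuous_at)
  then have "((\<lambda>s. \<Theta> ((s, 0), b1, b2) V) \<longlongrightarrow> \<Theta> ((0, 0), b1, b2) V) (at_right 0)"
    by (rule isCont_tendsto_compose) (intro tendsto_intros)
  moreover have "eventually (\<lambda>s. \<bar>s\<bar> < \<epsilon>) (at_right 0)"
    using assms(2) eventually_at_right_real[of 0 \<epsilon>] by (auto elim: eventually_mono)
  then have "eventually (\<lambda>s. \<Theta> ((s, 0), b1, b2) V = \<theta> ((s, 0), b1, b2) V) (at_right 0)"
    by eventually_elim (use \<Theta>(4) mem TV in auto)
  ultimately show ?thesis
    using \<Theta>(4)[OF mem[of 0] TV] assms(2) by (simp add: tendsto_cong zero_prod_def)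
qed

text \<open>Off the singular orbit the local form determines both connections; at
  \<open>p = 0\<close> the values agree as limits along a ray.\<close>

lemma connection_eqI:
  assumes conn: "connection \<epsilon> \<theta>" "connection \<epsilon>' \<theta>'" and \<rho>: "0 < \<rho>" "\<rho> \<le> \<epsilon>" "\<rho> \<le> \<epsilon>'"
    and local: "\<And>z X. z \<in> complement \<rho> \<Longrightarrow> local_form \<theta> z X = local_form \<theta>' z X"
    and z: "z \<in> P_id \<rho>" and V: "V \<in> TP_id z"
  shows "\<theta> z V = \<theta>' z V"
proof -
  have nz: "\<theta> (p, b1, b2) V = \<theta>' (p, b1, b2) V"
    if z: "(p, b1, b2) \<in> P_id \<rho>" and V: "V \<in> TP_id (p, b1, b2)" and p: "p \<noteq> 0" for p b1 b2 V
  proof -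
    obtain v w1 w2 where V': "V = (v, w1, w2)" by (cases V)
    have z': "(p, b1, b2) \<in> P_id \<epsilon>" "(p, b1, b2) \<in> P_id \<epsilon>'" using z \<rho> by (auto simp: P_id_def)
    note * = connection_from_local_form[OF _ _ p V[unfolded V'] refl refl refl refl refl refl refl]
    have "(norm p, (1 / norm p) *\<^sub>R p, b2 \<odot> qcnj (qcnj ((1 / norm p) *\<^sub>R p) \<odot> b1)) \<in> complement \<rho>"
      using *(2)[OF conn(1) z'(1)] z by (auto simp: complement_def P_id_def)
    from local[OF this] show ?thesis
      unfolding V' *(1)[OF conn(1) z'(1)] *(1)[OF conn(2) z'(2)] by simp
  qed
  obtain p b1 b2 where z': "z = (p, b1, b2)" by (cases z)
  show ?thesis
  proof (cases "p = 0")
    case False then show ?thesis using nz z V by (simp add: z')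
  next
    case True
    have b: "b1 \<in> SU2" "b2 \<in> SU2" using z by (auto simp: z' P_id_def)
    have V0: "V \<in> TP_id (q, b1, b2)" for q using V by (simp add: z' TP_id_def)
    have "eventually (\<lambda>s. s \<in> {0<..<\<rho>}) (at_right 0)" using \<rho>(1) by (rule eventually_at_right_real)
    then have "eventually (\<lambda>s. \<theta> ((s, 0), b1, b2) V = \<theta>' ((s, 0), b1, b2) V) (at_right 0)"
    proof eventually_elim
      case (elim s)
      then have "((s, 0), b1, b2) \<in> P_id \<rho>" "(s, 0) \<noteq> (0 :: quat)"
        using b by (simp_all add: P_id_def norm_prod_def zero_prod_def)
      then show ?case by (intro nz V0)
    qed
    moreover have lim: "((\<lambda>s. \<theta> ((s, 0), b1, b2) V) \<longlongrightarrow> \<theta> (0, b1, b2) V) (at_right 0)"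
      "((\<lambda>s. \<theta>' ((s, 0), b1, b2) V) \<longlongrightarrow> \<theta>' (0, b1, b2) V) (at_right 0)"
      using \<rho> by (intro connection_continuous_radially[OF conn(1)] connection_continuous_radially[OF conn(2)] b V0; simp)+
    ultimately have "((\<lambda>s. \<theta>' ((s, 0), b1, b2) V) \<longlongrightarrow> \<theta> (0, b1, b2) V) (at_right 0)"
      using tendsto_cong by force
    then have "\<theta> (0, b1, b2) V = \<theta>' (0, b1, b2) V"
      using lim(2) by (rule tendsto_unique[OF trivial_limit_at_right_real])
    then show ?thesis by (simp add: z' True)
  qed
qed

text \<open>Differentiability of the coefficient functions of an arbitrary competing instanton is
  drawn from here. Over \<open>a1 = a2 = 1\<close> the tangent vector is affine in the radius,
  \<open>s *\<^sub>R ?V1 + ?V2\<close>, so only values of the ambient form on fixed vectors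
  occur.\<close>

lemma connection_along_section:
  assumes "connection \<epsilon> \<theta>" "0 < t" "t < \<epsilon>"
  shows "(\<lambda>t. local_form \<theta> (t, (1, 0), (1, 0)) X) differentiable (at t)"
proof -
  obtain \<tau> u1 u2 where X: "X = (\<tau>, u1, u2)" by (cases X)
  obtain Wd \<Theta> where \<Theta>: "open Wd" "P_id \<epsilon> \<subseteq> Wd" "\<And>x. x \<in> Wd \<Longrightarrow> linear (\<Theta> x)" "\<And>v. smooth_on Wd (\<lambda>x. \<Theta> x v)"
      "\<And>x v. x \<in> P_id \<epsilon> \<Longrightarrow> v \<in> TP_id x \<Longrightarrow> \<Theta> x v = \<theta> x v"
    using assms(1) unfolding connection_def smooth_one_form_def by metis
  let ?\<gamma> = "\<lambda>t::real. ((t, 0), (1, 0), (1, 0)) :: bundle_pt"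
  let ?V1 = "((0, u1), 0, 0) :: bundle_pt" and ?V2 = "((\<tau>, 0), (0, u1), (0, u2)) :: bundle_pt"
  have mem: "?\<gamma> s \<in> P_id \<epsilon>" if "s \<in> {0<..<\<epsilon>}" for s
    using that by (simp add: P_id_def SU2_def norm_prod_def)
  have "(\<lambda>x. \<Theta> x V) differentiable (at (?\<gamma> t))" for V
  proof -
    have "Ck_on (Suc 0) (\<lambda>x. \<Theta> x V) Wd" using \<Theta>(4) unfolding smooth_on_def by blast
    then show ?thesis using mem[of t] assms \<Theta>(2) by auto
  qed
  moreover have "?\<gamma> differentiable (at t)" by (auto intro!: derivative_eq_intros simp: differentiable_def)
  ultimately have D: "(\<lambda>s. \<Theta> (?\<gamma> s) V) differentiable (at t)" for V
    using differentiable_chain_at[of ?\<gamma> t "\<lambda>x. \<Theta> x V"] by (simp add: o_def)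
  have "(\<lambda>s. s *\<^sub>R \<Theta> (?\<gamma> s) ?V1 + \<Theta> (?\<gamma> s) ?V2) differentiable (at t)"
    by (intro differentiable_add differentiable_scaleR D differentiable_ident)
  then obtain D where D: "((\<lambda>s. s *\<^sub>R \<Theta> (?\<gamma> s) ?V1 + \<Theta> (?\<gamma> s) ?V2) has_derivative D) (at t)"
    unfolding differentiable_def by blast
  have eq: "local_form \<theta> (s, (1, 0), (1, 0)) X = s *\<^sub>R \<Theta> (?\<gamma> s) ?V1 + \<Theta> (?\<gamma> s) ?V2"
    if s: "s \<in> {0<..<\<epsilon>}" for s
  proof -
    let ?V = "(s *\<^sub>R ((1, 0) \<odot> (0, u1)) + \<tau> *\<^sub>R (1, 0), (1, 0) \<odot> (0, u1), (1, 0) \<odot> (0, u2))"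
    have "?V \<in> TP_id (?\<gamma> s)" by (simp add: TP_id_def inner_qmul_pure)
    then have "local_form \<theta> (s, (1, 0), (1, 0)) X = \<Theta> (?\<gamma> s) ?V"
      using \<Theta>(5)[OF mem[OF s]] by (simp add: X local_form_eq)
    also have "?V = s *\<^sub>R ?V1 + ?V2" by (simp add: qmul_one)
    also have "\<Theta> (?\<gamma> s) (s *\<^sub>R ?V1 + ?V2) = s *\<^sub>R \<Theta> (?\<gamma> s) ?V1 + \<Theta> (?\<gamma> s) ?V2"
      using \<Theta>(3)[OF subsetD[OF \<Theta>(2) mem[OF s]]] by (simp only: linear_add linear_scale)
    finally show ?thesis .
  qed
  have "((\<lambda>t. local_form \<theta> (t, (1, 0), (1, 0)) X) has_derivative D) (at t)"
    by (rule has_derivative_transform_within_open[OF D, of "{0<..<\<epsilon>}"]) (use assms(2,3) in \<open>simp_all add: eq\<close>)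
  then show ?thesis unfolding differentiable_def by blast
qed

section \<open>The invariant connections\<close>

text \<open>An affine combination of the flat connections
  \<open>b\<^sub>1\<^sup>* db\<^sub>1\<close> and \<open>b\<^sub>2\<^sup>* db\<^sub>2\<close>, hence
  correct on vertical vectors, plus a term that vanishes on them. With \<open>p \<bullet> p\<close>
  as argument, smoothness at \<open>p = 0\<close> reduces to that of \<beta> and \<mu> at 0.\<close>

definition invariant_form :: "(real \<Rightarrow> real) \<Rightarrow> (real \<Rightarrow> real) \<Rightarrow> bundle_pt \<Rightarrow> bundle_pt \<Rightarrow> su2" where
  "invariant_form \<beta> \<mu> = (\<lambda>(p, b1, b2) (v, w1, w2).
     (1 - \<beta> (p \<bullet> p)) *\<^sub>R snd (qcnj b1 \<odot> w1) + \<beta> (p \<bullet> p) *\<^sub>R snd (qcnj b2 \<odot> w2)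
     + \<mu> (p \<bullet> p) *\<^sub>R snd (qcnj b1 \<odot> (v \<odot> qcnj p) \<odot> b1))"

lemma invariant_form_linear: "linear (invariant_form \<beta> \<mu> z)"
proof -
  obtain p b1 b2 where "z = (p, b1, b2)" by (cases z)
  then have eq: "invariant_form \<beta> \<mu> z = (\<lambda>V. (1 - \<beta> (p \<bullet> p)) *\<^sub>R snd (qcnj b1 \<odot> fst (snd V)) + \<beta> (p \<bullet> p) *\<^sub>R snd (qcnj b2 \<odot> snd (snd V))
     + \<mu> (p \<bullet> p) *\<^sub>R snd (qcnj b1 \<odot> (fst V \<odot> qcnj p) \<odot> b1))"
    by (auto simp: invariant_form_def fun_eq_iff)
  show ?thesis
    unfolding eq linear_conv_bounded_linear
    by (intro bounded_linear_add bounded_linear_const_scaleR bounded_linear_compose[OF bounded_linear_snd]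
        bounded_linear_compose[OF blin_qmul_left] bounded_linear_compose[OF blin_qmul_right] bounded_linear_fst
        bounded_linear_snd bounded_linear_compose[OF bounded_linear_fst])
qed

lemma invariant_form_right_act:
  assumes "g \<in> SU2"
  shows "invariant_form \<beta> \<mu> (right_act g z) (right_act g V) = Ad (qcnj g) (invariant_form \<beta> \<mu> z V)"
proof -
  obtain p b1 b2 v w1 w2 where "z = (p, b1, b2)" "V = (v, w1, w2)" by (cases z, cases V)
  moreover have "qcnj (b \<odot> g) \<odot> (w \<odot> g) = qcnj g \<odot> (qcnj b \<odot> w) \<odot> g" for b w
    by (simp add: qcnj_qmul qmul_assoc)
  moreover have "qcnj (b \<odot> g) \<odot> x \<odot> (b \<odot> g) = qcnj g \<odot> (qcnj b \<odot> x \<odot> b) \<odot> g" for b x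
    by (simp add: qcnj_qmul qmul_assoc)
  ultimately show ?thesis
    by (simp add: invariant_form_def right_act_def snd_conj[OF assms] linear_add[OF bounded_linear.linear[OF Ad_linear]]
        linear_scale[OF bounded_linear.linear[OF Ad_linear]])
qed

text \<open>The factor \<open>h3\<close> cancels in \<open>v \<odot> qcnj p\<close>, while
  \<open>h1\<close> and \<open>h2\<close> cancel against the conjugates of the
  \<open>b\<close>-components, and the length of \<open>p\<close> is preserved.\<close>

lemma invariant_form_left_act:
  assumes "h1 \<in> SU2" "h2 \<in> SU2" "h3 \<in> SU2"
  shows "invariant_form \<beta> \<mu> (left_act h1 h2 h3 z) (left_act h1 h2 h3 V) = invariant_form \<beta> \<mu> z V"
proof -
  obtain p b1 b2 v w1 w2 where "z = (p, b1, b2)" "V = (v, w1, w2)" by (cases z, cases V)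
  moreover have "norm (h1 \<odot> p \<odot> qcnj h3) = norm p"
    using assms qcnj_mem[OF assms(3)] by (simp add: norm_qmul SU2_def)
  then have "(h1 \<odot> p \<odot> qcnj h3) \<bullet> (h1 \<odot> p \<odot> qcnj h3) = p \<bullet> p"
    by (simp add: norm_eq)
  ultimately show ?thesis
    by (simp add: invariant_form_def left_act_def qcnj_qmul qmul_assoc qmul_cancel assms)
qed

lemma invariant_form_vertical:
  assumes "b1 \<in> SU2" "b2 \<in> SU2"
  shows "invariant_form \<beta> \<mu> (p, b1, b2) (0, b1 \<odot> (0, \<xi>), b2 \<odot> (0, \<xi>)) = \<xi>"
proof -
  have "(0 :: quat) \<odot> q = 0" "q \<odot> 0 = 0" for q
    by (simp_all add: qmul_def zero_prod_def)
  then show ?thesis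
    using assms by (simp add: invariant_form_def qmul_cancel flip: scaleR_add_left)
qed

lemma local_form_invariant_form:
  assumes "a1 \<in> SU2" "a2 \<in> SU2"
  shows "local_form (invariant_form \<beta> \<mu>) (t, a1, a2) (\<tau>, u1, u2) =
     (1 + t\<^sup>2 * \<mu> (t\<^sup>2) - \<beta> (t\<^sup>2)) *\<^sub>R u1 + \<beta> (t\<^sup>2) *\<^sub>R u2"
proof -
  have "t *\<^sub>R a1 \<bullet> t *\<^sub>R a1 = t\<^sup>2" using SU2_inner[OF assms(1)] by (simp add: power2_eq_square)
  \<comment> \<open>The radial direction contributes only to the real part
    \<open>t * \<tau>\<close>, which is discarded: the local form has no \<open>dt\<close>
    component.\<close>
  moreover have "qcnj a1 \<odot> ((t *\<^sub>R (a1 \<odot> (0, u1)) + \<tau> *\<^sub>R a1) \<odot> qcnj (t *\<^sub>R a1)) \<odot> a1 = (t * \<tau>, t\<^sup>2 *\<^sub>R u1)"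
    by (simp add: linear_scale[OF bounded_linear.linear[OF bounded_linear_qcnj]]
        bounded_bilinear.scaleR_left[OF bounded_bilinear_qmul] bounded_bilinear.scaleR_right[OF bounded_bilinear_qmul]
        bounded_bilinear.add_left[OF bounded_bilinear_qmul] bounded_bilinear.add_right[OF bounded_bilinear_qmul]
        qmul_assoc qmul_cancel assms qmul_one qmul_qcnj qmul_real power2_eq_square scaleR_add_right)
  ultimately show ?thesis
    using assms by (simp add: local_form_eq invariant_form_def qmul_cancel algebra_simps)
qed

text \<open>The defining formula makes sense for all quaternions \<open>b1\<close>,
  \<open>b2\<close>, so it is its own smooth extension to the ambient open set
  \<open>p \<bullet> p < R\<close>.\<close>

lemma invariant_form_smooth:
  assumes "smooth_on {-R<..<R} \<beta>" "smooth_on {-R<..<R} \<mu>" "0 < \<epsilon>" "\<epsilon>\<^sup>2 \<le> R"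
  shows "smooth_one_form (P_id \<epsilon>) TP_id (invariant_form \<beta> \<mu>)"
proof -
  define Wd :: "bundle_pt set" where "Wd = {z. fst z \<bullet> fst z < R}"
  have op: "open Wd" unfolding Wd_def by (intro open_Collect_less continuous_intros)
  have sub: "P_id \<epsilon> \<subseteq> Wd"
  proof
    fix z :: bundle_pt assume "z \<in> P_id \<epsilon>"
    then have "norm (fst z) ^ 2 < \<epsilon> ^ 2" by (auto simp: P_id_def intro: power_strict_mono)
    then show "z \<in> Wd" using assms(4) by (simp add: Wd_def power2_norm_eq_inner)
  qed
  note lin = smooth_on_linear[OF op] and bil = smooth_on_bilinear[OF op]
  have id: "smooth_on Wd (\<lambda>z. z)" by (rule smooth_on_ident[OF op])
  have c: "smooth_on Wd (\<lambda>z. fst z)" "smooth_on Wd (\<lambda>z. fst (snd z))" "smooth_on Wd (\<lambda>z. snd (snd z))"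
    by (intro lin[OF bounded_linear_fst] lin[OF bounded_linear_snd] id)+
  have q: "smooth_on Wd (\<lambda>z. fst z \<bullet> fst z)" by (intro bil[OF bounded_bilinear_inner] c)
  have im: "(\<lambda>z. fst z \<bullet> fst z) ` Wd \<subseteq> {-R<..<R}"
  proof
    fix s assume "s \<in> (\<lambda>z. fst z \<bullet> fst z) ` Wd"
    then obtain z :: bundle_pt where "s = fst z \<bullet> fst z" "s < R" unfolding Wd_def by blast
    moreover have "0 \<le> fst z \<bullet> fst z" by (rule inner_ge_zero)
    ultimately show "s \<in> {-R<..<R}" unfolding greaterThanLessThan_iff by linarith
  qed
  have \<beta>: "smooth_on Wd (\<lambda>z. \<beta> (fst z \<bullet> fst z))" and \<mu>: "smooth_on Wd (\<lambda>z. \<mu> (fst z \<bullet> fst z))"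
    by (rule smooth_on_compose_real[OF op im assms(1) q], rule smooth_on_compose_real[OF op im assms(2) q])
  have \<beta>': "smooth_on Wd (\<lambda>z. 1 + - \<beta> (fst z \<bullet> fst z))"
    by (rule smooth_on_add[OF op smooth_on_const[OF op] lin[OF bounded_linear_minus[OF bounded_linear_ident] \<beta>]])
  have qm: "smooth_on Wd (\<lambda>z. qcnj (f z) \<odot> g z)" if "smooth_on Wd f" "smooth_on Wd g" for f g
    by (rule bil[OF bounded_bilinear_qmul lin[OF bounded_linear_qcnj that(1)] that(2)])
  have "smooth_on Wd (\<lambda>z. v \<odot> qcnj (fst z))" for v
    by (rule bil[OF bounded_bilinear_qmul smooth_on_const[OF op] lin[OF bounded_linear_qcnj c(1)]])
  then have "smooth_on Wd (\<lambda>z. qcnj (fst (snd z)) \<odot> (v \<odot> qcnj (fst z)) \<odot> fst (snd z))" for v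
    by (intro bil[OF bounded_bilinear_qmul qm[OF c(2)] c(2)])
  note smooth_on_add[OF op smooth_on_add[OF op
      smooth_on_scaleR[OF op \<beta>' lin[OF bounded_linear_snd qm[OF c(2) smooth_on_const[OF op]]]]
      smooth_on_scaleR[OF op \<beta> lin[OF bounded_linear_snd qm[OF c(3) smooth_on_const[OF op]]]]]
      smooth_on_scaleR[OF op \<mu> lin[OF bounded_linear_snd this]]]
  then have "smooth_on Wd (\<lambda>z. invariant_form \<beta> \<mu> z V)" for V
    by (cases V) (simp add: invariant_form_def case_prod_beta)
  then show ?thesis
    unfolding smooth_one_form_def using op sub invariant_form_linear by blast
qed

lemma invariant_form_connection:
  assumes "smooth_on {-R<..<R} \<beta>" "smooth_on {-R<..<R} \<mu>" "0 < \<epsilon>" "\<epsilon>\<^sup>2 \<le> R"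
  shows "connection \<epsilon> (invariant_form \<beta> \<mu>)" "SU2_cubed_invariant \<epsilon> (invariant_form \<beta> \<mu>)"
proof -
  show "connection \<epsilon> (invariant_form \<beta> \<mu>)"
    unfolding connection_def
  proof (intro conjI ballI allI invariant_form_smooth[OF assms])
    show "pullback (right_act g) (invariant_form \<beta> \<mu>) z v = Ad (qcnj g) (invariant_form \<beta> \<mu> z v)"
      if "g \<in> SU2" for g z v
      using that by (simp add: pullback_def frechet_derivative_linear[OF bounded_linear_right_act] invariant_form_right_act)
    show "invariant_form \<beta> \<mu> z (vector_derivative (\<lambda>s. right_act (qexp (s *\<^sub>R \<xi>)) z) (at 0)) = \<xi>"
      if "z \<in> P_id \<epsilon>" for z \<xi>
      using that by (cases z) (auto simp: vertical_deriv P_id_def invariant_form_vertical)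
  qed
  show "SU2_cubed_invariant \<epsilon> (invariant_form \<beta> \<mu>)"
    unfolding SU2_cubed_invariant_def
    by (simp add: pullback_def frechet_derivative_linear[OF bounded_linear_left_act] invariant_form_left_act)
qed

section \<open>Power series solution of the singular system\<close>

text \<open>
  The coefficients of the solution of \<open>z (1 - z) h' = - 2 h + z h - z h\<^sup>2 + (g\<^sup>2 - 1 - z h) / 3\<close> and
  \<open>(1 - z) g' = 2 g h\<close> with \<open>g(0) = c\<close>; the factor \<open>n + 3\<close> does not vanish because the eigenvalue of the
  singular equation at \<open>z = 0\<close> is \<open>- 2\<close>.
\<close>

function h_coeff g_coeff :: "real \<Rightarrow> nat \<Rightarrow> real" where
  "g_coeff c 0 = c"
| "g_coeff c (Suc n) =
     (real n * g_coeff c n + 2 * (\<Sum>i\<le>n. g_coeff c i * h_coeff c (n - i))) / (real n + 1)"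
| "h_coeff c 0 = (c\<^sup>2 - 1) / 6"
| "h_coeff c (Suc n) =
     ((real n + 2 / 3) * h_coeff c n - (\<Sum>i\<le>n. h_coeff c i * h_coeff c (n - i))
      + (\<Sum>i\<le>Suc n. g_coeff c i * g_coeff c (Suc n - i)) / 3) / (real n + 3)"
  by pat_completeness auto
termination
  \<comment> \<open>\<open>h\<close> at \<open>n + 1\<close> calls \<open>g\<close> at
    \<open>n + 1\<close>, whereas \<open>g\<close> at \<open>n + 1\<close> calls both only up to
    \<open>n\<close>; hence weight \<open>2 n + 1\<close> for \<open>h\<close> and
    \<open>2 n\<close> for \<open>g\<close>.\<close>
  by (relation "Wellfounded.measure (case_sum (\<lambda>(c, n). 2 * n + 1) (\<lambda>(c, n). 2 * n))") auto

section \<open>Convergence of the formal solution\<close>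

text \<open>The triangle \<open>i + j \<le> m\<close> lies inside the square, so weighted absolute
  partial sums are submultiplicative.\<close>

lemma cauchy_product_abs_le:
  fixes a b :: "nat \<Rightarrow> real"
  assumes "\<rho> \<ge> 0"
  shows "(\<Sum>n\<le>m. \<bar>\<Sum>i\<le>n. a i * b (n - i)\<bar> * \<rho> ^ n) \<le> (\<Sum>n\<le>m. \<bar>a n\<bar> * \<rho> ^ n) * (\<Sum>n\<le>m. \<bar>b n\<bar> * \<rho> ^ n)"
proof -
  let ?f = "\<lambda>i j. (\<bar>a i\<bar> * \<rho> ^ i) * (\<bar>b j\<bar> * \<rho> ^ j)"
  have "\<bar>\<Sum>i\<le>n. a i * b (n - i)\<bar> * \<rho> ^ n \<le> (\<Sum>i\<le>n. ?f i (n - i))" for n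
  proof -
    have "\<bar>\<Sum>i\<le>n. a i * b (n - i)\<bar> * \<rho> ^ n \<le> (\<Sum>i\<le>n. \<bar>a i * b (n - i)\<bar>) * \<rho> ^ n"
      using assms by (intro mult_right_mono sum_abs) auto
    also have "\<dots> = (\<Sum>i\<le>n. ?f i (n - i))"
      unfolding sum_distrib_right
      by (intro sum.cong refl) (auto simp: abs_mult mult_ac simp flip: power_add)
    finally show ?thesis .
  qed
  then have "(\<Sum>n\<le>m. \<bar>\<Sum>i\<le>n. a i * b (n - i)\<bar> * \<rho> ^ n) \<le> (\<Sum>n\<le>m. \<Sum>i\<le>n. ?f i (n - i))"
    by (intro sum_mono)
  also have "\<dots> = (\<Sum>(i, j)\<in>{(i, j). i + j \<le> m}. ?f i j)"
    by (rule sum.triangle_reindex_eq[symmetric])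
  also have "\<dots> \<le> (\<Sum>(i, j)\<in>{..m} \<times> {..m}. ?f i j)"
    using assms by (intro sum_mono2) auto
  also have "\<dots> = (\<Sum>n\<le>m. \<bar>a n\<bar> * \<rho> ^ n) * (\<Sum>n\<le>m. \<bar>b n\<bar> * \<rho> ^ n)"
    by (simp add: sum_product sum.cartesian_product)
  finally show ?thesis .
qed

text \<open>In the recursion for \<open>h (Suc n)\<close> the square of \<open>g\<close> is not
  shifted by an index, so its terms gain no factor \<rho> later. Splitting off the constant term
  \<open>c\<close> of \<open>g\<close> leaves \<open>e\<close>, whose sums can be made small
  instead.\<close>

lemma coeff_bounds:
  fixes c :: real
  defines "h \<equiv> h_coeff c" and "g \<equiv> g_coeff c"
  defines "e \<equiv> (\<lambda>n. if n = 0 then 0 else g n)"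
  shows g_coeff_le: "\<bar>g (Suc n)\<bar> \<le> \<bar>g n\<bar> + 2 * \<bar>\<Sum>i\<le>n. g i * h (n - i)\<bar>"
    and h_coeff_le: "\<bar>h (Suc n)\<bar> \<le> \<bar>h n\<bar> + \<bar>\<Sum>i\<le>n. h i * h (n - i)\<bar>
      + (2 * \<bar>c\<bar> * \<bar>e (Suc n)\<bar> + \<bar>\<Sum>i\<le>Suc n. e i * e (Suc n - i)\<bar>)"
proof -
  let ?S = "\<Sum>i\<le>n. g i * h (n - i)"
  have "\<bar>g (Suc n)\<bar> = \<bar>real n * g n + 2 * ?S\<bar> / (real n + 1)"
    by (simp add: g_def h_def)
  also have "\<dots> \<le> (real n * \<bar>g n\<bar> + 2 * \<bar>?S\<bar>) / (real n + 1)"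
    using abs_triangle_ineq[of "real n * g n" "2 * ?S"] by (intro divide_right_mono) (auto simp: abs_mult)
  also have "\<dots> \<le> \<bar>g n\<bar> + 2 * \<bar>?S\<bar>"
    by (simp add: divide_le_eq algebra_simps)
  finally show "\<bar>g (Suc n)\<bar> \<le> \<bar>g n\<bar> + 2 * \<bar>?S\<bar>" .
  let ?P = "\<Sum>i\<le>n. h i * h (n - i)" and ?Q = "\<Sum>i\<le>Suc n. g i * g (Suc n - i)"
    and ?R = "\<Sum>i\<le>Suc n. e i * e (Suc n - i)"
  \<comment> \<open>The first and last terms of the convolution both contain \<open>g 0\<close>;
    they give \<open>2 * c * e (Suc n)\<close>, and the rest involves no constant term.\<close>
  have "?Q = g 0 * g (Suc n) + (\<Sum>i\<le>n. g (Suc i) * g (n - i))"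
    by (simp add: sum.atMost_Suc_shift del: sum.atMost_Suc)
  also have "(\<Sum>i\<le>n. g (Suc i) * g (n - i)) = (\<Sum>i<n. g (Suc i) * g (n - i)) + g (Suc n) * g 0"
    by (simp add: lessThan_Suc_atMost[symmetric])
  also have "(\<Sum>i<n. g (Suc i) * g (n - i)) = (\<Sum>i<n. e (Suc i) * e (n - i))"
    by (intro sum.cong) (auto simp: e_def)
  also have "\<dots> = ?R"
    by (simp add: sum.atMost_Suc_shift del: sum.atMost_Suc) (simp add: lessThan_Suc_atMost[symmetric] e_def)
  finally have Q: "?Q = 2 * c * e (Suc n) + ?R"
    by (simp add: e_def g_def)
  have "\<bar>h (Suc n)\<bar> = \<bar>(real n + 2 / 3) * h n - ?P + ?Q / 3\<bar> / (real n + 3)"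
    by (simp add: g_def h_def)
  also have "\<dots> \<le> ((real n + 2 / 3) * \<bar>h n\<bar> + \<bar>?P\<bar> + \<bar>?Q\<bar> / 3) / (real n + 3)"
  proof (intro divide_right_mono)
    have "\<bar>(real n + 2 / 3) * h n\<bar> = (real n + 2 / 3) * \<bar>h n\<bar>" by (simp add: abs_mult)
    then show "\<bar>(real n + 2 / 3) * h n - ?P + ?Q / 3\<bar> \<le> (real n + 2 / 3) * \<bar>h n\<bar> + \<bar>?P\<bar> + \<bar>?Q\<bar> / 3"
      by linarith
  qed auto
  also have "\<dots> \<le> \<bar>h n\<bar> + \<bar>?P\<bar> + \<bar>?Q\<bar>"
  proof -
    have "(real n + 2 / 3) * a + p + q / 3 \<le> (a + p + q) * (real n + 3)" if "0 \<le> a" "0 \<le> p" "0 \<le> q" for a p q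
    proof -
      have "(a + p + q) * (real n + 3) - ((real n + 2 / 3) * a + p + q / 3) =
          p * real n + q * real n + 7 / 3 * a + 2 * p + 8 / 3 * q"
        by (simp add: field_simps)
      moreover have "0 \<le> p * real n + q * real n + 7 / 3 * a + 2 * p + 8 / 3 * q"
        using that by (intro add_nonneg_nonneg mult_nonneg_nonneg) auto
      ultimately show ?thesis by linarith
    qed
    from this[of "\<bar>h n\<bar>" "\<bar>?P\<bar>" "\<bar>?Q\<bar>"]
    have "(real n + 2 / 3) * \<bar>h n\<bar> + \<bar>?P\<bar> + \<bar>?Q\<bar> / 3 \<le> (\<bar>h n\<bar> + \<bar>?P\<bar> + \<bar>?Q\<bar>) * (real n + 3)"
      by (simp del: sum.atMost_Suc)
    then show ?thesis by (simp add: divide_le_eq del: sum.atMost_Suc)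
  qed
  also have "\<bar>?Q\<bar> \<le> 2 * \<bar>c\<bar> * \<bar>e (Suc n)\<bar> + \<bar>?R\<bar>"
    unfolding Q using abs_triangle_ineq[of "2 * c * e (Suc n)" ?R] by (simp add: abs_mult)
  finally show "\<bar>h (Suc n)\<bar> \<le> \<bar>h n\<bar> + \<bar>?P\<bar> + (2 * \<bar>c\<bar> * \<bar>e (Suc n)\<bar> + \<bar>?R\<bar>)" by simp
qed

lemma coeff_summable:
  obtains \<rho> where "\<rho> > 0" "summable (\<lambda>n. \<bar>h_coeff c n\<bar> * \<rho> ^ n)" "summable (\<lambda>n. \<bar>g_coeff c n\<bar> * \<rho> ^ n)"
proof -
  define h g where "h = h_coeff c" and "g = g_coeff c"
  define e where "e = (\<lambda>n. if n = 0 then 0 else g n)"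
  \<comment> \<open>\<open>C\<close> leaves a margin of 1 above \<open>\<bar>h 0\<bar>\<close>. Half
    of it pays for the shifted terms through \<open>\<rho> * (C + C * C) \<le> 1 / 2\<close>, the
    other half for the unshifted ones through \<delta>; the second bound in \<rho> keeps the sums of
    \<open>e\<close> below \<delta>.\<close>
  define C where "C = \<bar>h 0\<bar> + 1"
  define \<delta> where "\<delta> = 1 / (4 * \<bar>c\<bar> + 4)"
  define \<rho> where "\<rho> = min (1 / (2 * (C + C * C))) (\<delta> / ((\<bar>c\<bar> + \<delta>) * (1 + 2 * C)))"
  have C: "C \<ge> 1" by (simp add: C_def)
  have \<delta>: "\<delta> > 0" "\<delta> \<le> 1" by (auto simp: \<delta>_def divide_simps)
  have \<delta>2: "2 * \<bar>c\<bar> * \<delta> + \<delta> * \<delta> \<le> 1 / 2"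
  proof -
    have "2 * \<bar>c\<bar> * \<delta> + \<delta> * \<delta> \<le> (2 * \<bar>c\<bar> + 2) * \<delta>"
      using mult_right_mono[OF \<delta>(2), of \<delta>] \<delta>(1) by (simp add: algebra_simps)
    also have "\<dots> = 1 / 2" by (simp add: \<delta>_def field_simps)
    finally show ?thesis .
  qed
  have pos: "(\<bar>c\<bar> + \<delta>) * (1 + 2 * C) > 0" "2 * (C + C * C) > 0"
    using \<delta> C by (auto intro!: mult_pos_pos add_pos_pos add_nonneg_pos)
  then have \<rho>: "\<rho> > 0" using \<delta> by (auto simp: \<rho>_def)
  have \<rho>1: "\<rho> * (C + C * C) \<le> 1 / 2"
  proof -
    have "\<rho> \<le> 1 / (2 * (C + C * C))" by (simp add: \<rho>_def)
    then show ?thesis using pos(2) by (simp add: field_simps)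
  qed
  have \<rho>2: "\<rho> * ((\<bar>c\<bar> + \<delta>) * (1 + 2 * C)) \<le> \<delta>"
  proof -
    have "\<rho> \<le> \<delta> / ((\<bar>c\<bar> + \<delta>) * (1 + 2 * C))" by (simp add: \<rho>_def)
    then show ?thesis using pos(1) by (simp add: pos_le_divide_eq)
  qed
  let ?N = "\<lambda>a m. \<Sum>n\<le>m. \<bar>a n\<bar> * \<rho> ^ n"
  have N_nonneg: "0 \<le> ?N a m" for a :: "nat \<Rightarrow> real" and m using \<rho> by (intro sum_nonneg) auto
  have N_g: "?N g m = \<bar>c\<bar> + ?N e m" for m
    by (induction m) (simp_all add: e_def g_def)
  have "?N h m \<le> C \<and> ?N e m \<le> \<delta>" for m
  proof (induction m)
    case 0 then show ?case using \<delta> by (simp add: C_def e_def)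
  next
    case (Suc m)
    have G: "?N g m \<le> \<bar>c\<bar> + \<delta>" using Suc N_g by simp
    have "?N e (Suc m) = (\<Sum>n\<le>m. \<bar>g (Suc n)\<bar> * \<rho> ^ Suc n)"
      by (simp add: sum.atMost_Suc_shift e_def del: power_Suc sum.atMost_Suc)
    also have "\<dots> \<le> (\<Sum>n\<le>m. (\<bar>g n\<bar> + 2 * \<bar>\<Sum>i\<le>n. g i * h (n - i)\<bar>) * \<rho> ^ Suc n)"
      using \<rho> g_coeff_le[of c] unfolding h_def g_def by (intro sum_mono mult_right_mono) auto
    also have "\<dots> = \<rho> * (?N g m + 2 * (\<Sum>n\<le>m. \<bar>\<Sum>i\<le>n. g i * h (n - i)\<bar> * \<rho> ^ n))"
      by (simp add: sum.distrib sum_distrib_left distrib_left distrib_right mult_ac)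
    also have "\<dots> \<le> \<rho> * (?N g m + 2 * (?N g m * ?N h m))"
      using \<rho> cauchy_product_abs_le[of \<rho> g h m] by (intro mult_left_mono add_left_mono) auto
    also have "\<dots> = \<rho> * (?N g m * (1 + 2 * ?N h m))" by (simp add: algebra_simps)
    also have "\<dots> \<le> \<rho> * ((\<bar>c\<bar> + \<delta>) * (1 + 2 * C))"
      using Suc G \<rho> N_nonneg \<delta> by (intro mult_left_mono mult_mono) (auto intro!: add_nonneg_nonneg)
    \<comment> \<open>The bound for \<open>e\<close> at \<open>Suc m\<close> precedes that for
      \<open>h\<close>, which uses it at the same index.\<close>
    finally have E: "?N e (Suc m) \<le> \<delta>" using \<rho>2 by simp
    have "?N h (Suc m) = \<bar>h 0\<bar> + (\<Sum>n\<le>m. \<bar>h (Suc n)\<bar> * \<rho> ^ Suc n)"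
      by (simp add: sum.atMost_Suc_shift del: power_Suc sum.atMost_Suc)
    also have "(\<Sum>n\<le>m. \<bar>h (Suc n)\<bar> * \<rho> ^ Suc n) \<le> (\<Sum>n\<le>m. (\<bar>h n\<bar> + \<bar>\<Sum>i\<le>n. h i * h (n - i)\<bar>
        + (2 * \<bar>c\<bar> * \<bar>e (Suc n)\<bar> + \<bar>\<Sum>i\<le>Suc n. e i * e (Suc n - i)\<bar>)) * \<rho> ^ Suc n)"
      using \<rho> h_coeff_le[of c] unfolding h_def g_def e_def
      by (intro sum_mono mult_right_mono) (auto simp del: sum.atMost_Suc)
    also have "\<dots> = \<rho> * (?N h m + (\<Sum>n\<le>m. \<bar>\<Sum>i\<le>n. h i * h (n - i)\<bar> * \<rho> ^ n))
        + (2 * \<bar>c\<bar> * (\<Sum>n\<le>m. \<bar>e (Suc n)\<bar> * \<rho> ^ Suc n)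
        + (\<Sum>n\<le>m. \<bar>\<Sum>i\<le>Suc n. e i * e (Suc n - i)\<bar> * \<rho> ^ Suc n))"
      by (simp add: sum.distrib sum_distrib_left distrib_left distrib_right mult_ac del: sum.atMost_Suc)
    also have "(\<Sum>n\<le>m. \<bar>e (Suc n)\<bar> * \<rho> ^ Suc n) = ?N e (Suc m)"
      by (simp add: sum.atMost_Suc_shift e_def del: power_Suc sum.atMost_Suc)
    also have "(\<Sum>n\<le>m. \<bar>\<Sum>i\<le>Suc n. e i * e (Suc n - i)\<bar> * \<rho> ^ Suc n) =
        (\<Sum>n\<le>Suc m. \<bar>\<Sum>i\<le>n. e i * e (n - i)\<bar> * \<rho> ^ n)"
      unfolding sum.atMost_Suc_shift[of _ m] by (simp add: e_def del: power_Suc sum.atMost_Suc)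
    also have "\<rho> * (?N h m + (\<Sum>n\<le>m. \<bar>\<Sum>i\<le>n. h i * h (n - i)\<bar> * \<rho> ^ n)) \<le> \<rho> * (?N h m + ?N h m * ?N h m)"
      using \<rho> cauchy_product_abs_le[of \<rho> h h m] by (intro mult_left_mono add_left_mono) auto
    also have "\<dots> \<le> \<rho> * (C + C * C)"
      using Suc \<rho> N_nonneg C by (intro mult_left_mono add_mono mult_mono) auto
    also have "(\<Sum>n\<le>Suc m. \<bar>\<Sum>i\<le>n. e i * e (n - i)\<bar> * \<rho> ^ n) \<le> ?N e (Suc m) * ?N e (Suc m)"
      using \<rho> by (intro cauchy_product_abs_le) auto
    also have "2 * \<bar>c\<bar> * ?N e (Suc m) + ?N e (Suc m) * ?N e (Suc m) \<le> 2 * \<bar>c\<bar> * \<delta> + \<delta> * \<delta>"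
      using E N_nonneg \<delta> by (intro add_mono mult_left_mono mult_mono) (auto simp del: sum.atMost_Suc)
    finally have "?N h (Suc m) \<le> \<bar>h 0\<bar> + (\<rho> * (C + C * C) + (2 * \<bar>c\<bar> * \<delta> + \<delta> * \<delta>))" by simp
    then have "?N h (Suc m) \<le> C" using \<rho>1 \<delta>2 unfolding C_def by linarith
    with E show ?case by simp
  qed
  then have bnd: "?N h m \<le> C" "?N g m \<le> \<bar>c\<bar> + \<delta>" for m using N_g by auto
  have "summable (\<lambda>n. \<bar>a n\<bar> * \<rho> ^ n)" if "\<And>m. ?N a m \<le> K" for a :: "nat \<Rightarrow> real" and K
  proof (rule summableI_nonneg_bounded)
    show "(\<Sum>n<m. \<bar>a n\<bar> * \<rho> ^ n) \<le> K" for m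
      by (rule order_trans[OF sum_mono2 that[of m]]) (use \<rho> in auto)
  qed (use \<rho> in auto)
  from this[OF bnd(1)] this[OF bnd(2)]
  have "summable (\<lambda>n. \<bar>h n\<bar> * \<rho> ^ n)" "summable (\<lambda>n. \<bar>g n\<bar> * \<rho> ^ n)" .
  with \<rho> that show thesis unfolding h_def g_def by blast
qed


text \<open>The recursion is the coefficientwise form of both equations: they are checked as
  identities of formal power series and then evaluated inside the common interval of
  convergence.\<close>

lemma singular_system_solution:
  obtains R :: real and h h' g g' where "0 < R" "R \<le> 1" "smooth_on {-R<..<R} h" "smooth_on {-R<..<R} g"
    "\<And>x. \<bar>x\<bar> < R \<Longrightarrow> (h has_real_derivative h' x) (at x)"
    "\<And>x. \<bar>x\<bar> < R \<Longrightarrow> (g has_real_derivative g' x) (at x)"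
    "\<And>x. \<bar>x\<bar> < R \<Longrightarrow>
       (1 - x) * (x * h' x) = - 2 * h x + x * h x - x * (h x)\<^sup>2 + ((g x)\<^sup>2 - 1 - x * h x) / 3"
    "\<And>x. \<bar>x\<bar> < R \<Longrightarrow> (1 - x) * g' x = 2 * (g x * h x)"
    "g 0 = c" "h 0 = (c\<^sup>2 - 1) / 6"
proof -
  obtain \<rho> where \<rho>: "\<rho> > 0" "summable (\<lambda>n. \<bar>h_coeff c n\<bar> * \<rho> ^ n)" "summable (\<lambda>n. \<bar>g_coeff c n\<bar> * \<rho> ^ n)"
    by (rule coeff_summable)
  define R where "R = min \<rho> 1"
  define H G where "H = Abs_fps (h_coeff c)" and "G = Abs_fps (g_coeff c)"
  have nth: "fps_nth H = h_coeff c" "fps_nth G = g_coeff c" by (simp_all add: H_def G_def fun_eq_iff)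
  have "summable (\<lambda>n. h_coeff c n * \<rho> ^ n)" "summable (\<lambda>n. g_coeff c n * \<rho> ^ n)"
    by (rule summable_rabs_cancel, use \<rho> in \<open>simp add: abs_mult\<close>)+
  then have "norm \<rho> \<le> fps_conv_radius H" "norm \<rho> \<le> fps_conv_radius G"
    unfolding fps_conv_radius_def nth by - (rule conv_radius_geI, assumption)+
  then have rad: "ereal (norm x) < fps_conv_radius H" "ereal (norm x) < fps_conv_radius G" if "\<bar>x\<bar> < R" for x
  proof -
    have "ereal (norm x) < ereal (norm \<rho>)" using that \<rho>(1) by (simp add: R_def)
    then show "ereal (norm x) < fps_conv_radius H" "ereal (norm x) < fps_conv_radius G"
      using less_le_trans \<open>norm \<rho> \<le> fps_conv_radius H\<close> \<open>norm \<rho> \<le> fps_conv_radius G\<close> by blast+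
  qed
  note rad' = rad[THEN less_le_trans[OF _ fps_conv_radius_deriv]]
  have pair: "ereal \<bar>x\<bar> < fps_conv_radius (F * K)"
    if "ereal \<bar>x\<bar> < fps_conv_radius F" "ereal \<bar>x\<bar> < fps_conv_radius K" for F K :: "real fps" and x
    using that by (intro less_le_trans[OF _ fps_conv_radius_mult]) simp
  have D: "(eval_fps F has_real_derivative eval_fps (fps_deriv F) x) (at x)"
    if "ereal \<bar>x\<bar> < fps_conv_radius F" for F x
    using that by (intro has_field_derivative_eval_fps) simp
  have sm: "smooth_on {-R<..<R} (eval_fps F)" if "\<And>x. \<bar>x\<bar> < R \<Longrightarrow> ereal \<bar>x\<bar> < fps_conv_radius F" for F :: "real fps"
    unfolding eval_fps_def by (rule smooth_on_power_series, rule summable_fps, use that in simp)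
  have eqG: "fps_deriv G - fps_X * fps_deriv G = fps_const 2 * (G * H)"
  proof (rule fps_ext)
    fix n
    show "fps_nth (fps_deriv G - fps_X * fps_deriv G) n = fps_nth (fps_const 2 * (G * H)) n"
    proof -
      have "fps_nth (fps_X * fps_deriv G) n = real n * g_coeff c n"
        by (cases n) (simp_all add: nth)
      moreover have "fps_nth (G * H) n = (\<Sum>i\<le>n. g_coeff c i * h_coeff c (n - i))"
        by (simp add: nth fps_mult_nth atLeast0AtMost)
      moreover have "(real n + 1) * g_coeff c (Suc n) =
          real n * g_coeff c n + 2 * (\<Sum>i\<le>n. g_coeff c i * h_coeff c (n - i))"
        by simp
      ultimately show ?thesis by (simp add: nth add.commute[of 1] del: g_coeff.simps)
    qed
  qed
  have eqH: "fps_X * fps_deriv H - fps_X * (fps_X * fps_deriv H) =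
      fps_const (-2) * H + fps_X * H - fps_X * (H * H) + fps_const (1/3) * (G * G - 1 - fps_X * H)"
  proof (rule fps_ext)
    fix n
    show "fps_nth (fps_X * fps_deriv H - fps_X * (fps_X * fps_deriv H)) n =
      fps_nth (fps_const (-2) * H + fps_X * H - fps_X * (H * H) + fps_const (1/3) * (G * G - 1 - fps_X * H)) n"
    proof (cases n)
      \<comment> \<open>The constant coefficient reads
        \<open>0 = - 2 h(0) + (c\<^sup>2 - 1) / 3\<close>, which is the origin of the value of
        \<open>h_coeff c 0\<close>.\<close>
      case 0 then show ?thesis by (simp add: nth fps_mult_nth power2_eq_square field_simps)
    next
      case (Suc m)
      have "fps_nth (fps_X * (fps_X * fps_deriv H)) (Suc m) = real m * h_coeff c m"
        by (cases m) (simp_all add: nth)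
      moreover have "fps_nth (fps_X * fps_deriv H) (Suc m) = (real m + 1) * h_coeff c (Suc m)"
        by (simp add: nth)
      moreover have "(real m + 3) * h_coeff c (Suc m) =
          (real m + 2 / 3) * h_coeff c m - fps_nth (H * H) m + fps_nth (G * G) (Suc m) / 3"
        by (simp add: nth fps_mult_nth atLeast0AtMost del: sum.atMost_Suc)
      moreover have "fps_nth (fps_const (-2) * H + fps_X * H - fps_X * (H * H) + fps_const (1/3) * (G * G - 1 - fps_X * H)) (Suc m) =
          - 2 * h_coeff c (Suc m) + h_coeff c m - fps_nth (H * H) m + (fps_nth (G * G) (Suc m) - h_coeff c m) / 3"
        by (simp add: nth del: h_coeff.simps)
      moreover have "b - a = r" if "a = u * y" "b = (u + 1) * x" "(u + 3) * x = (u + 2 / 3) * y - p + q / 3"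
          "r = - 2 * x + y - p + (q - y) / 3" for a b r u x y p q :: real
      proof -
        have "(u + 1) * x - u * y = ((u + 3) * x - (u + 2 / 3) * y) - 2 * x + 2 / 3 * y" by (simp add: algebra_simps)
        then show ?thesis using that by (simp add: field_simps)
      qed
      ultimately show ?thesis unfolding Suc fps_sub_nth[of "fps_X * fps_deriv H"] by blast
    qed
  qed
  show thesis
  proof (rule that[of R "eval_fps H" "eval_fps G" "eval_fps (fps_deriv H)" "eval_fps (fps_deriv G)"])
    show "0 < R" "R \<le> 1" using \<rho>(1) by (auto simp: R_def)
    show "smooth_on {-R<..<R} (eval_fps H)" "smooth_on {-R<..<R} (eval_fps G)" using rad by (auto intro!: sm)
    show "eval_fps G 0 = c" "eval_fps H 0 = (c\<^sup>2 - 1) / 6" by (simp_all add: eval_fps_at_0 nth)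
    fix x :: real assume x: "\<bar>x\<bar> < R"
    note r = rad[OF x] rad'[OF x]
    show "(eval_fps H has_real_derivative eval_fps (fps_deriv H) x) (at x)"
      "(eval_fps G has_real_derivative eval_fps (fps_deriv G) x) (at x)"
      using r by (auto intro: D)
    have X: "ereal \<bar>x\<bar> < fps_conv_radius fps_X" by simp
    have cst: "ereal \<bar>x\<bar> < fps_conv_radius (fps_const a)" for a :: real by simp
    have add: "ereal \<bar>x\<bar> < fps_conv_radius (F + K)" "ereal \<bar>x\<bar> < fps_conv_radius (F - K)"
      if "ereal \<bar>x\<bar> < fps_conv_radius F" "ereal \<bar>x\<bar> < fps_conv_radius K" for F K :: "real fps"
      by - (rule less_le_trans[OF _ fps_conv_radius_add], use that in simp,
        rule less_le_trans[OF _ fps_conv_radius_diff], use that in simp)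
    have one: "ereal \<bar>x\<bar> < fps_conv_radius (1 :: real fps)" by simp
    show "(1 - x) * eval_fps (fps_deriv G) x = 2 * (eval_fps G x * eval_fps H x)"
      using arg_cong[OF eqG, of "\<lambda>F. eval_fps F x"] r
      by (simp add: eval_fps_mult eval_fps_diff pair cst X) (simp add: algebra_simps)
    show "(1 - x) * (x * eval_fps (fps_deriv H) x) = - 2 * eval_fps H x + x * eval_fps H x - x * (eval_fps H x)\<^sup>2
        + ((eval_fps G x)\<^sup>2 - 1 - x * eval_fps H x) / 3"
      using arg_cong[OF eqH, of "\<lambda>F. eval_fps F x"] r
      by (simp add: eval_fps_mult eval_fps_diff eval_fps_add pair add cst one X power2_eq_square)
         (simp add: algebra_simps)
  qed
qed

section \<open>The Bryant--Salamon coefficients near the singular orbit\<close>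

text \<open>
  Substituting \<open>w\<^sup>2 = 1 - 1 / r\<^sup>3\<close> in the definition of \<open>t\<close> gives \<open>dt = 2/3 (1 - w\<^sup>2) powr (-4/3) dw\<close>, and
  integrating the binomial series termwise gives \<open>t = w k(w\<^sup>2)\<close>.
\<close>

definition k_coeff :: "nat \<Rightarrow> real" where
  "k_coeff n = 2 / 3 * (((- (4 / 3)) gchoose n) * (-1) ^ n) / (2 * real n + 1)"

definition k_fun :: "real \<Rightarrow> real" where
  "k_fun x = (\<Sum>n. k_coeff n * x ^ n)"

definition k_fun' :: "real \<Rightarrow> real" where
  "k_fun' x = (\<Sum>n. diffs k_coeff n * x ^ n)"

section \<open>The series \<open>k\<close> and its differential equation\<close>

lemma binomial_sums:
  fixes x :: real
  assumes "\<bar>x\<bar> < 1"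
  shows "(\<lambda>n. ((a gchoose n) * (-1) ^ n) * x ^ n) sums (1 - x) powr a"
  using gen_binomial_real[of "- x" a] assms by (simp add: power_minus[of x] mult.assoc)

lemma k_coeff_summable:
  assumes "\<bar>x\<bar> < 1" shows "summable (\<lambda>n. k_coeff n * x ^ n)"
proof -
  let ?c = "\<lambda>n. ((- (4 / 3)) gchoose n) * (-1) ^ n :: real"
  obtain y where y: "\<bar>x\<bar> < y" "y < 1" using dense[OF assms] by blast
  have "summable (\<lambda>n. ?c n * y ^ n)" using binomial_sums[of y] y by (auto intro: sums_summable)
  then have "summable (\<lambda>n. norm (?c n * x ^ n))" by (rule powser_insidea) (use y in simp)
  then show ?thesis
  proof (rule summable_comparison_test')
    fix n
    have "norm (k_coeff n * x ^ n) = norm (?c n * x ^ n) * (2 / 3 / (2 * real n + 1))"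
      by (simp add: k_coeff_def abs_mult)
    also have "\<dots> \<le> norm (?c n * x ^ n) * 1"
      by (intro mult_left_mono) (auto simp: divide_le_eq)
    finally show "norm (k_coeff n * x ^ n) \<le> norm (?c n * x ^ n)" by simp
  qed
qed

lemma k_fun_deriv: "\<bar>x\<bar> < 1 \<Longrightarrow> (k_fun has_real_derivative k_fun' x) (at x)"
  unfolding k_fun_def[abs_def] k_fun'_def by (rule termdiffs_strong'[of 1]) (auto intro: k_coeff_summable)

lemma k_fun_smooth: "smooth_on {-1<..<1} k_fun"
  unfolding k_fun_def[abs_def] by (rule smooth_on_power_series) (rule k_coeff_summable)

text \<open>For \<open>x = w\<^sup>2\<close> the left side is the derivative of
  \<open>w k(w\<^sup>2)\<close>; the factor \<open>2 n + 1\<close> it produces cancels the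
  denominator of \<open>k_coeff\<close> and leaves the binomial series.\<close>

lemma k_fun_ode:
  assumes "\<bar>x\<bar> < 1" shows "k_fun x + 2 * x * k_fun' x = 2 / 3 * (1 - x) powr (- (4 / 3))"
proof -
  let ?c = "\<lambda>n. ((- (4 / 3)) gchoose n) * (-1) ^ n :: real"
  have "summable (\<lambda>n. diffs k_coeff n * x ^ n)"
    by (rule termdiff_converges[of x 1]) (use assms k_coeff_summable in auto)
  then have "(\<lambda>n. x * (real n * k_coeff n * x ^ (n - Suc 0))) sums (x * k_fun' x)"
    unfolding k_fun'_def by (intro sums_mult diffs_equiv)
  moreover have "x * (real n * k_coeff n * x ^ (n - Suc 0)) = real n * k_coeff n * x ^ n" for n
    by (cases n) auto
  ultimately have "(\<lambda>n. real n * k_coeff n * x ^ n) sums (x * k_fun' x)" by simp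
  from sums_add[OF summable_sums[OF k_coeff_summable[OF assms]] sums_mult[OF this, of 2]]
  have "(\<lambda>n. k_coeff n * x ^ n + 2 * (real n * k_coeff n * x ^ n)) sums (k_fun x + 2 * (x * k_fun' x))"
    by (simp add: k_fun_def)
  moreover have "k_coeff n * x ^ n + 2 * (real n * k_coeff n * x ^ n) = 2 / 3 * (?c n * x ^ n)" for n
  proof -
    have nz: "2 * real n + 1 \<noteq> 0" by linarith
    have "(2 * real n + 1) * k_coeff n = 2 / 3 * ?c n"
      using nonzero_mult_div_cancel_left[OF nz, of "2 / 3 * ?c n"]
      by (simp only: k_coeff_def times_divide_eq_right)
    moreover have "k_coeff n * x ^ n + 2 * (real n * k_coeff n * x ^ n) = ((2 * real n + 1) * k_coeff n) * x ^ n"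
      by (simp add: algebra_simps)
    ultimately show ?thesis by simp
  qed
  ultimately have "(\<lambda>n. 2 / 3 * (?c n * x ^ n)) sums (k_fun x + 2 * (x * k_fun' x))" by simp
  moreover have "(\<lambda>n. 2 / 3 * (?c n * x ^ n)) sums (2 / 3 * (1 - x) powr (- (4 / 3)))"
    by (intro sums_mult binomial_sums assms)
  ultimately show ?thesis using sums_unique2 by (fastforce simp: mult.assoc)
qed

lemma k_fun_0: "k_fun 0 = 2 / 3" "k_fun' 0 = 8 / 27"
proof -
  show "k_fun 0 = 2 / 3" "k_fun' 0 = 8 / 27"
    unfolding k_fun_def k_fun'_def powser_zero by (simp_all add: k_coeff_def diffs_def)
qed

section \<open>Closed formulas for \<open>r\<close>, \<open>A\<^sub>1\<close> and
  \<open>B\<^sub>1\<close> in the parameter \<open>w\<close>\<close>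

lemma cube_powr_third:
  assumes "0 < u" shows "(u powr (- (1 / 3))) ^ 3 = 1 / (u::real)"
proof -
  have "(u powr (- (1 / 3))) ^ 3 = u powr (3 * - (1 / 3))" using assms by (subst powr_power) auto
  then show ?thesis using assms powr_minus_divide[of u 1] by simp
qed

definition tau :: "real \<Rightarrow> real" where
  "tau w = w * k_fun (w\<^sup>2)"

lemma square_less_1: "\<bar>w\<bar> < 1 \<Longrightarrow> \<bar>w\<^sup>2\<bar> < (1::real)"
  by (simp add: abs_square_less_1)

lemma tau_deriv:
  assumes "\<bar>w\<bar> < 1"
  shows "(tau has_real_derivative 2 / 3 * (1 - w\<^sup>2) powr (- (4 / 3))) (at w)"
proof -
  note w = square_less_1[OF assms]
  have "(tau has_real_derivative 1 * k_fun (w\<^sup>2) + (k_fun' (w\<^sup>2) * (2 * w)) * w) (at w)"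
    unfolding tau_def[abs_def]
    by (intro DERIV_mult DERIV_ident DERIV_chain2[where f = k_fun and g = "\<lambda>w. w\<^sup>2", OF k_fun_deriv[OF w]]) (auto intro!: derivative_eq_intros)
  also have "1 * k_fun (w\<^sup>2) + (k_fun' (w\<^sup>2) * (2 * w)) * w = 2 / 3 * (1 - w\<^sup>2) powr (- (4 / 3))"
    using k_fun_ode[OF w] by (simp add: power2_eq_square algebra_simps)
  finally show ?thesis .
qed

lemma tau_strict_mono:
  assumes "0 \<le> v" "v < w" "w < 1" shows "tau v < tau w"
proof (rule DERIV_pos_imp_increasing[OF assms(2)])
  fix x assume "v \<le> x" "x \<le> w"
  then have "\<bar>x\<bar> < 1" using assms by auto
  then show "\<exists>y. (tau has_real_derivative y) (at x) \<and> 0 < y"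
    using tau_deriv square_less_1[of x] by (intro exI[of _ "2 / 3 * (1 - x\<^sup>2) powr (- (4 / 3))"]) auto
qed

lemma bs_t_eq:
  assumes "1 \<le> r" shows "bs_t r = tau (sqrt (1 - 1 / r ^ 3))"
proof -
  let ?w = "\<lambda>r::real. sqrt (1 - 1 / r ^ 3)"
  have w: "0 \<le> ?w r" "?w r < 1" "(?w r)\<^sup>2 = 1 - 1 / r ^ 3" if "1 \<le> r" for r
  proof -
    have "1 / r ^ 3 \<le> 1" "0 < 1 / r ^ 3" using that one_le_power[of r 3] by (auto simp: divide_le_eq)
    then show "0 \<le> ?w r" "?w r < 1" "(?w r)\<^sup>2 = 1 - 1 / r ^ 3" by auto
  qed
  have "((\<lambda>s. (1 - 1 / s ^ 3) powr (- 1 / 2)) has_integral (tau (?w r) - tau (?w 1))) {1..r}"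
  \<comment> \<open>The integrand is unbounded near \<open>s = 1\<close> and \<open>?w\<close> is
    not differentiable there, so at the endpoints only continuity of the antiderivative is
    required.\<close>
  proof (rule fundamental_theorem_of_calculus_interior[OF assms])
    show "continuous_on {1..r} (\<lambda>s. tau (?w s))"
    proof (rule continuous_on_compose2[where g = tau and f = ?w and t = "{0..<1}"])
      show "continuous_on {0..<1} tau"
        by (intro continuous_at_imp_continuous_on ballI DERIV_isCont[OF tau_deriv]) auto
      show "continuous_on {1..r} ?w" by (intro continuous_intros) auto
    qed (use w in auto)
    fix s assume "s \<in> {1<..<r}"
    then have s: "1 < s" by simp
    have pos: "0 < 1 - 1 / s ^ 3" using one_less_power[OF s, of 3] s by (simp add: divide_less_eq)
    have "((\<lambda>s. 1 - 1 / s ^ 3) has_real_derivative 3 / s ^ 4) (at s)"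
      using s by (auto intro!: derivative_eq_intros simp: field_simps eval_nat_numeral)
    from DERIV_chain2[OF DERIV_real_sqrt[OF pos] this]
    have "(?w has_real_derivative inverse (?w s) / 2 * (3 / s ^ 4)) (at s)" .
    from DERIV_chain2[OF tau_deriv this, of] w[of s] s
    have "((\<lambda>s. tau (?w s)) has_real_derivative
        2 / 3 * (1 - (?w s)\<^sup>2) powr (- (4 / 3)) * (inverse (?w s) / 2 * (3 / s ^ 4))) (at s)"
      by simp
    also have "(1 - (?w s)\<^sup>2) powr (- (4 / 3)) = s ^ 4"
    proof -
      have *: "1 - (?w s)\<^sup>2 = s powr (- 3)" using w[of s] s by (simp add: powr_minus_divide)
      show ?thesis unfolding * using s by (simp add: powr_powr)
    qed
    also have "2 / 3 * s ^ 4 * (inverse (?w s) / 2 * (3 / s ^ 4)) = inverse (?w s)" using s by simp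
    also have "inverse (?w s) = (1 - 1 / s ^ 3) powr (- 1 / 2)"
      using pos by (simp add: powr_minus powr_half_sqrt)
    finally show "((\<lambda>s. tau (?w s)) has_vector_derivative (1 - 1 / s ^ 3) powr (- 1 / 2)) (at s)"
      by (simp add: has_real_derivative_iff_has_vector_derivative)
  qed
  moreover have "tau (?w 1) = 0" by (simp add: tau_def)
  ultimately show ?thesis unfolding bs_t_def by (simp add: integral_unique)
qed

text \<open>\<open>bs_r\<close> is an inverse on \<open>{1..}\<close>, so its value follows from the
  injectivity of \<open>bs_t\<close> there and from one explicit preimage of
  \<open>tau w\<close>.\<close>

lemma bs_r_tau:
  assumes "0 \<le> w" "w < 1" shows "bs_r (tau w) = (1 - w\<^sup>2) powr (- (1 / 3))"
proof -
  let ?w = "\<lambda>r::real. sqrt (1 - 1 / r ^ 3)"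
  have "bs_t r < bs_t s" if "1 \<le> r" "r < s" for r s
  proof -
    have "0 < r ^ 3" using that by simp
    then have "1 / r ^ 3 \<le> 1" using one_le_power[OF that(1), of 3] by (simp only: divide_le_eq_1_pos)
    then have "0 \<le> 1 - 1 / r ^ 3" by simp
    moreover have "1 / s ^ 3 < 1 / r ^ 3"
      using that by (intro divide_strict_left_mono power_strict_mono mult_pos_pos zero_less_power) auto
    moreover have "0 < 1 / s ^ 3" using that by simp
    ultimately have "tau (?w r) < tau (?w s)" by (intro tau_strict_mono) auto
    then show ?thesis using that by (simp add: bs_t_eq)
  qed
  then have inj: "inj_on bs_t {1..}" by (intro linorder_inj_onI) (auto, fastforce)
  define r where "r = (1 - w\<^sup>2) powr (- (1 / 3))"
  have u: "0 < 1 - w\<^sup>2" "1 - w\<^sup>2 \<le> 1" using assms square_less_1[of w] by auto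
  have r3: "r ^ 3 = 1 / (1 - w\<^sup>2)"
    using u by (simp add: r_def cube_powr_third)
  have "1 \<le> r ^ 3" using u by (simp add: r3)
  moreover have "0 < r" using u by (simp add: r_def)
  ultimately have r: "1 \<le> r" using power_strict_mono[of r 1 3] by (cases "r < 1") auto
  have "bs_t r = tau w" using assms by (simp add: bs_t_eq[OF r] r3)
  then show ?thesis using the_inv_into_f_f[OF inj, of r] r unfolding bs_r_def r_def[symmetric] by simp
qed

lemma A1_tau:
  assumes "0 \<le> w" "w < 1" shows "A1 (tau w) = (1 - w\<^sup>2) powr (- (1 / 3)) / 3 * w"
proof -
  have "0 < 1 - w\<^sup>2" using assms square_less_1[of w] by auto
  then have "((1 - w\<^sup>2) powr (- (1 / 3))) ^ 3 = 1 / (1 - w\<^sup>2)" by (rule cube_powr_third)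
  then show ?thesis using assms by (simp add: A1_def bs_r_tau)
qed

lemma B1_tau: "0 \<le> w \<Longrightarrow> w < 1 \<Longrightarrow> B1 (tau w) = (1 - w\<^sup>2) powr (- (1 / 3)) / sqrt 3"
  by (simp add: B1_def bs_r_tau)

section \<open>Inversion of \<open>t\<^sup>2 = z k(z)\<^sup>2\<close>\<close>

text \<open>The map \<open>z k(z)\<^sup>2\<close> has derivative \<open>(k + 2 z k') k\<close>,
  which \<open>k_fun_ode\<close> makes explicit and which is positive near 0. It is inverted on both
  sides of 0, because the value \<open>s = p \<bullet> p = 0\<close> must be interior for smoothness
  across the singular orbit.\<close>

lemma tau_inverse:
  obtains S c :: real and Z where "0 < S" "0 < c" "c < 1" "Z 0 = 0"
    "\<And>s. \<bar>s\<bar> < S \<Longrightarrow> \<bar>Z s\<bar> < c \<and> 0 < k_fun (Z s) \<and> Z s * (k_fun (Z s))\<^sup>2 = s"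
    "\<And>s. \<bar>s\<bar> < S \<Longrightarrow> (Z has_real_derivative 3 / 2 * (1 - Z s) powr (4 / 3) / k_fun (Z s)) (at s)"
    "smooth_on {-S<..<S} Z"
proof -
  let ?\<Psi> = "\<lambda>x. x * (k_fun x)\<^sup>2"
  let ?m = "\<lambda>x. 3 / 2 * (1 - x) powr (4 / 3) / k_fun x"
  have cont: "isCont k_fun x" if "\<bar>x\<bar> < 1" for x using k_fun_deriv[OF that] by (rule DERIV_isCont)
  have "eventually (\<lambda>x. 0 < k_fun x) (at 0)"
    using cont[of 0] by (intro order_tendstoD(1)[of _ "2 / 3"]) (auto simp: isCont_def k_fun_0)
  then obtain d where d: "d > 0" "\<And>x. x \<noteq> 0 \<Longrightarrow> \<bar>x\<bar> < d \<Longrightarrow> 0 < k_fun x"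
    by (auto simp: eventually_at dist_real_def)
  \<comment> \<open>Halving \<open>d\<close> keeps the closed interval from \<open>- c\<close> to
    \<open>c\<close> inside the region where \<open>k_fun\<close> is positive, and
    \<open>1 / 2\<close> keeps it inside the interval of convergence.\<close>
  define c where "c = min (d / 2) (1 / 2)"
  have c: "0 < c" "c < 1" "c < d" using d by (auto simp: c_def)
  have kpos: "0 < k_fun x" if "\<bar>x\<bar> \<le> c" for x using d(2)[of x] that c k_fun_0 by (cases "x = 0") auto
  have D: "(?\<Psi> has_real_derivative inverse (?m x)) (at x)" if "\<bar>x\<bar> \<le> c" for x
  proof -
    have x: "\<bar>x\<bar> < 1" "0 < 1 - x" using that c by auto
    have "(?\<Psi> has_real_derivative (k_fun x + 2 * x * k_fun' x) * k_fun x) (at x)"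
      by (auto intro!: derivative_eq_intros k_fun_deriv x simp: power2_eq_square algebra_simps)
    also have "(k_fun x + 2 * x * k_fun' x) * k_fun x = inverse (?m x)"
      unfolding k_fun_ode[OF x(1)] using kpos[OF that] x by (simp add: powr_minus field_simps)
    finally show ?thesis .
  qed
  have mpos: "0 < ?m x" if "\<bar>x\<bar> \<le> c" for x using kpos[OF that] that c by (auto intro!: divide_pos_pos mult_pos_pos)
  have mono: "?\<Psi> x < ?\<Psi> y" if "- c \<le> x" "x < y" "y \<le> c" for x y
  proof (rule DERIV_pos_imp_increasing[OF that(2)])
    fix z assume "x \<le> z" "z \<le> y"
    then have "\<bar>z\<bar> \<le> c" using that by auto
    then show "\<exists>y. (?\<Psi> has_real_derivative y) (at z) \<and> 0 < y"
      using D mpos positive_imp_inverse_positive by blast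
  qed
  \<comment> \<open>Both end values are taken into account so that the intermediate value theorem
    reaches every \<open>s\<close> of either sign with \<open>\<bar>s\<bar> < S\<close>.\<close>
  define S where "S = min (?\<Psi> c) (- ?\<Psi> (- c))"
  have "0 < ?\<Psi> c" "0 < - ?\<Psi> (- c)" using c kpos[of c] kpos[of "- c"] by (auto simp: mult_pos_pos)
  then have S: "0 < S" by (simp add: S_def)
  have ex: "\<exists>x. \<bar>x\<bar> < c \<and> ?\<Psi> x = s" if "\<bar>s\<bar> < S" for s
  proof -
    have cont': "continuous_on {- c..c} ?\<Psi>"
      by (intro continuous_at_imp_continuous_on ballI DERIV_isCont[OF D]) auto
    have "?\<Psi> (- c) \<le> s" "s \<le> ?\<Psi> c" "- c \<le> c"
      using that c unfolding S_def by linarith+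
    then obtain x where x: "- c \<le> x" "x \<le> c" "?\<Psi> x = s"
      using IVT'[OF _ _ _ cont'] by blast
    moreover have "x \<noteq> c" "x \<noteq> - c" using x(3) that by (auto simp: S_def)
    ultimately show ?thesis by (intro exI[of _ x]) auto
  qed
  define Z where "Z s = (SOME x. \<bar>x\<bar> < c \<and> ?\<Psi> x = s)" for s
  have Z: "\<bar>Z s\<bar> < c" "?\<Psi> (Z s) = s" if "\<bar>s\<bar> < S" for s
    using someI_ex[OF ex[OF that]] unfolding Z_def by auto
  have Z_\<Psi>: "Z (?\<Psi> x) = x" if "\<bar>x\<bar> < c" "\<bar>?\<Psi> x\<bar> < S" for x
    using Z[OF that(2)] that(1) mono[of x "Z (?\<Psi> x)"] mono[of "Z (?\<Psi> x)" x] by (cases x "Z (?\<Psi> x)" rule: linorder_cases) (auto simp: abs_less_iff)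
  have contZ: "isCont Z s" if s: "\<bar>s\<bar> < S" for s
  proof -
    have "isCont ?\<Psi> (Z s)" using D[of "Z s"] Z(1)[OF s] by (intro DERIV_isCont[of _ "inverse (?m (Z s))"]) auto
    then have "((\<lambda>x. \<bar>?\<Psi> x\<bar>) \<longlongrightarrow> \<bar>s\<bar>) (nhds (Z s))"
      using Z(2)[OF s] by (intro tendsto_rabs) (auto simp: isCont_def tendsto_nhds_iff)
    then have "eventually (\<lambda>x. \<bar>?\<Psi> x\<bar> < S) (nhds (Z s))" using s by (rule order_tendstoD(2))
    moreover have "eventually (\<lambda>x. \<bar>x\<bar> < c) (nhds (Z s))"
      using Z(1)[OF s] by (intro order_tendstoD(2)[OF tendsto_rabs[OF filterlim_ident]])
    ultimately have "eventually (\<lambda>x. \<bar>x\<bar> < c \<and> \<bar>?\<Psi> x\<bar> < S) (nhds (Z s))" by eventually_elim simp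
    then obtain e where e: "e > 0" "\<And>x. dist x (Z s) < e \<Longrightarrow> \<bar>x\<bar> < c \<and> \<bar>?\<Psi> x\<bar> < S"
      by (auto simp: eventually_nhds_metric)
    have "isCont Z (?\<Psi> (Z s))"
    proof (rule isCont_inverse_function[where f = ?\<Psi> and x = "Z s" and d = "e / 2"])
      fix x assume "\<bar>x - Z s\<bar> \<le> e / 2"
      then have "\<bar>x\<bar> < c \<and> \<bar>?\<Psi> x\<bar> < S" using e by (auto simp: dist_real_def)
      then show "Z (?\<Psi> x) = x" "isCont ?\<Psi> x" using Z_\<Psi> D[of x] by (auto intro: DERIV_isCont)
    qed (use e in simp)
    then show ?thesis using Z(2)[OF s] by simp
  qed
  have DZ: "(Z has_real_derivative ?m (Z s)) (at s)" if s: "\<bar>s\<bar> < S" for s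
  proof -
    have "(Z has_real_derivative inverse (inverse (?m (Z s)))) (at s)"
    proof (rule DERIV_inverse_function[of ?\<Psi> _ _ _ "- S" S])
      show "(?\<Psi> has_real_derivative inverse (?m (Z s))) (at (Z s))" using Z(1)[OF s] by (intro D) simp
      show "inverse (?m (Z s)) \<noteq> 0" using positive_imp_inverse_positive[OF mpos, of "Z s"] Z(1)[OF s] by (metis less_imp_le less_irrefl)
      show "?\<Psi> (Z y) = y" if "- S < y" "y < S" for y using that by (intro Z) auto
    qed (use s contZ in auto)
    then show ?thesis by simp
  qed
  show thesis
  proof (rule that[OF S c(1,2), of Z])
    show "Z 0 = 0" using Z_\<Psi>[of 0] c S by simp
    show "\<bar>Z s\<bar> < c \<and> 0 < k_fun (Z s) \<and> Z s * (k_fun (Z s))\<^sup>2 = s" if "\<bar>s\<bar> < S" for s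
      using Z[OF that] kpos[of "Z s"] by auto
    show "smooth_on {- S<..<S} Z"
    proof (rule smooth_on_solution[of _ "{-c<..<c}" _ ?m])
      have op: "open {-c<..<c}" by simp
      have k: "smooth_on {-c<..<c} k_fun" by (rule smooth_on_subset[OF k_fun_smooth]) (use c in auto)
      have "smooth_on {-c<..<c} (\<lambda>x. 1 + - x)"
        by (intro smooth_on_add smooth_on_const smooth_on_linear[OF _ bounded_linear_minus[OF bounded_linear_ident]] smooth_on_ident op)
      then have "smooth_on {-c<..<c} (\<lambda>x. (1 + - x) powr (4 / 3))"
        by (rule smooth_on_compose_real[OF op _ smooth_on_powr, rotated]) (use c in auto)
      moreover have "smooth_on {-c<..<c} (\<lambda>x. inverse (k_fun x))"
        by (rule smooth_on_compose_real[OF op _ smooth_on_inverse k]) (use kpos in auto)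
      ultimately have "smooth_on {-c<..<c} (\<lambda>x. 3 / 2 * (1 + - x) powr (4 / 3) * inverse (k_fun x))"
        by (intro smooth_on_mult smooth_on_const op)
      then show "smooth_on {-c<..<c} ?m" by (simp only: divide_inverse diff_conv_add_uminus)
      show "Z ` {- S<..<S} \<subseteq> {-c<..<c}"
        using Z(1) by (force simp: abs_less_iff)
      show "(Z has_real_derivative ?m (Z s)) (at s)" if "s \<in> {- S<..<S}" for s
        by (rule DZ) (use that in auto)
    qed auto
  qed (rule DZ)
qed

section \<open>The instanton equation for the ansatz\<close>

text \<open>The components of the ansatz in the left-invariant frame depend on \<open>t\<close>
  alone, so only the radial part of the vector field differentiates them.\<close>

lemma along_radial:
  assumes z: "(t, a1, a2) \<in> complement \<epsilon>"
    and F: "\<And>w. w \<in> complement \<epsilon> \<Longrightarrow> F w = \<phi> (fst w)"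
    and D: "(\<phi> has_vector_derivative d) (at t)"
  shows "along (\<tau>, u1, u2) F (t, a1, a2) = \<tau> *\<^sub>R d"
proof -
  have "((\<lambda>s. t + s * \<tau>) has_vector_derivative \<tau>) (at 0)"
    by (auto intro!: derivative_eq_intros simp flip: has_real_derivative_iff_has_vector_derivative)
  from vector_diff_chain_at[OF this, of \<phi> d] D
  have 1: "((\<lambda>s. \<phi> (t + s * \<tau>)) has_vector_derivative \<tau> *\<^sub>R d) (at 0)" by (simp add: o_def)
  have "((\<lambda>s. F (flow (\<tau>, u1, u2) s (t, a1, a2))) has_vector_derivative \<tau> *\<^sub>R d) (at 0)"
  proof (rule has_vector_derivative_transform_within_open[OF 1])
    \<comment> \<open>\<open>F\<close> is known only on the complement, so the curve is restricted
      to times at which the flow stays inside the tube.\<close>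
    show "open {s. 0 < t + s * \<tau> \<and> t + s * \<tau> < \<epsilon>}"
      by (intro open_Collect_conj open_Collect_less continuous_intros)
    show "0 \<in> {s. 0 < t + s * \<tau> \<and> t + s * \<tau> < \<epsilon>}" using z by (simp add: complement_def)
    fix s assume "s \<in> {s. 0 < t + s * \<tau> \<and> t + s * \<tau> < \<epsilon>}"
    then have "flow (\<tau>, u1, u2) s (t, a1, a2) \<in> complement \<epsilon>"
      using z by (simp add: complement_def flow_def qmul_mem qexp_mem)
    then show "\<phi> (t + s * \<tau>) = F (flow (\<tau>, u1, u2) s (t, a1, a2))"
      by (subst F) (simp_all add: flow_def)
  qed
  then show ?thesis unfolding along_def by (rule vector_derivative_at)
qed

lemma eta_sums:
  "(\<Sum>i\<in>UNIV. eta_plus i [(\<tau>, u1, u2)] *\<^sub>R T i) = (1 / 2) *\<^sub>R (u1 + u2)"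
  "(\<Sum>i\<in>UNIV. eta_minus i [(\<tau>, u1, u2)] *\<^sub>R T i) = (1 / 2) *\<^sub>R (u1 - u2)"
  by (simp_all add: vec_eq_iff forall_3 sum_3 eta_plus_def eta_minus_def T_def axis_def)

lemma ansatz_eq:
  "ansatz x y (t, a1, a2) (\<tau>, u1, u2) =
     (A1 t * x t) *\<^sub>R (1 / 2) *\<^sub>R (u1 + u2) + (B1 t * y t) *\<^sub>R (1 / 2) *\<^sub>R (u1 - u2)"
  by (simp add: ansatz_def eta_sums)

lemma coframe_eval:
  "coframe 0 [(\<tau>, u1, u2)] = \<tau>"
  "coframe 1 [(\<tau>, u1, u2)] = (u1 $ 1 + u2 $ 1) / 2" "coframe 2 [(\<tau>, u1, u2)] = (u1 $ 2 + u2 $ 2) / 2"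
  "coframe 3 [(\<tau>, u1, u2)] = (u1 $ 3 + u2 $ 3) / 2" "coframe 4 [(\<tau>, u1, u2)] = (u1 $ 1 - u2 $ 1) / 2"
  "coframe 5 [(\<tau>, u1, u2)] = (u1 $ 2 - u2 $ 2) / 2" "coframe 6 [(\<tau>, u1, u2)] = (u1 $ 3 - u2 $ 3) / 2"
  by (simp_all add: coframe_def eta_plus_def eta_minus_def dt_def)

lemma W_W_pair: "W i (W j one) [X, Y] = coframe i [X] * coframe j [Y] - coframe j [X] * coframe i [Y]"
  by (simp add: wedge_1_Cons wedge_1_Nil del: One_nat_def)

lemma curvature_ansatz:
  assumes z: "(t, a1, a2) \<in> complement \<epsilon>"
    and A: "\<And>w X. w \<in> complement \<epsilon> \<Longrightarrow> A w X = ansatz x y w X"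
    and f: "f = A1 t * x t" "((\<lambda>t. A1 t * x t) has_real_derivative f') (at t)"
    and g: "g = B1 t * y t" "((\<lambda>t. B1 t * y t) has_real_derivative g') (at t)"
    and Xs: "length Xs = 2"
  shows "curvature A (t, a1, a2) Xs $ 1 = F_coframe 1 2 3 (f) (g) f' g' Xs"
    "curvature A (t, a1, a2) Xs $ 2 = F_coframe 2 3 1 (f) (g) f' g' Xs"
    "curvature A (t, a1, a2) Xs $ 3 = F_coframe 3 1 2 (f) (g) f' g' Xs"
proof -
  obtain \<tau> u1 u2 \<sigma> v1 v2 where X: "Xs = [(\<tau>, u1, u2), (\<sigma>, v1, v2)]"
    using Xs by (auto simp: length_Suc_conv numeral_2_eq_2)
  have al: "along X (\<lambda>w. A w (\<rho>, q1, q2)) (t, a1, a2) =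
      fst X *\<^sub>R (f' *\<^sub>R (1 / 2) *\<^sub>R (q1 + q2) + g' *\<^sub>R (1 / 2) *\<^sub>R (q1 - q2))" for X \<rho> q1 q2
  proof -
    obtain \<tau> u1 u2 where X: "X = (\<tau>, u1, u2)" by (cases X)
    show ?thesis unfolding X fst_conv
    proof (rule along_radial[OF z, where \<phi> = "\<lambda>t. (A1 t * x t) *\<^sub>R (1 / 2) *\<^sub>R (q1 + q2) + (B1 t * y t) *\<^sub>R (1 / 2) *\<^sub>R (q1 - q2)"])
      show "A w (\<rho>, q1, q2) = (A1 (fst w) * x (fst w)) *\<^sub>R (1 / 2) *\<^sub>R (q1 + q2) + (B1 (fst w) * y (fst w)) *\<^sub>R (1 / 2) *\<^sub>R (q1 - q2)"
        if "w \<in> complement \<epsilon>" for w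
        unfolding A[OF that] by (cases w) (simp add: ansatz_eq)
      show "((\<lambda>t. (A1 t * x t) *\<^sub>R (1 / 2) *\<^sub>R (q1 + q2) + (B1 t * y t) *\<^sub>R (1 / 2) *\<^sub>R (q1 - q2)) has_vector_derivative
          f' *\<^sub>R (1 / 2) *\<^sub>R (q1 + q2) + g' *\<^sub>R (1 / 2) *\<^sub>R (q1 - q2)) (at t)"
        using f(2) g(2) unfolding has_real_derivative_iff_has_vector_derivative
        by (intro has_vector_derivative_add bounded_linear.has_vector_derivative[OF bounded_linear_scaleR_left])
    qed
  qed
  have c: "curvature A (t, a1, a2) Xs =
      \<tau> *\<^sub>R (f' *\<^sub>R (1 / 2) *\<^sub>R (v1 + v2) + g' *\<^sub>R (1 / 2) *\<^sub>R (v1 - v2))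
      - \<sigma> *\<^sub>R (f' *\<^sub>R (1 / 2) *\<^sub>R (u1 + u2) + g' *\<^sub>R (1 / 2) *\<^sub>R (u1 - u2))
      - (f *\<^sub>R (1 / 2) *\<^sub>R (bracket u1 v1 + bracket u2 v2) + g *\<^sub>R (1 / 2) *\<^sub>R (bracket u1 v1 - bracket u2 v2))
      + bracket (f *\<^sub>R (1 / 2) *\<^sub>R (u1 + u2) + g *\<^sub>R (1 / 2) *\<^sub>R (u1 - u2))
          (f *\<^sub>R (1 / 2) *\<^sub>R (v1 + v2) + g *\<^sub>R (1 / 2) *\<^sub>R (v1 - v2))"
    by (simp only: curvature_def X Let_def nth_Cons_0 nth_Cons_Suc One_nat_def al A[OF z] lie_bracket_def case_prod_conv
        ansatz_eq f(1) g(1) fst_conv)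
  have *: "(1::nat) + 3 = 4" "(2::nat) + 3 = 5" "(3::nat) + 3 = 6" by simp_all
  show "curvature A (t, a1, a2) Xs $ 1 = F_coframe 1 2 3 (f) (g) f' g' Xs"
    "curvature A (t, a1, a2) Xs $ 2 = F_coframe 2 3 1 (f) (g) f' g' Xs"
    "curvature A (t, a1, a2) Xs $ 3 = F_coframe 3 1 2 (f) (g) f' g' Xs"
    unfolding c unfolding X F_coframe_def * W_W_pair coframe_eval
    by (simp_all add: bracket_def cross3_def field_simps power2_eq_square)
qed

section \<open>Reduction of the six-form equation to two scalar equations\<close>

text \<open>The instanton equations with denominators cleared, \<open>a\<close> and \<open>b\<close>
  standing for \<open>A\<^sub>1\<close> and \<open>B\<^sub>1\<close>. Up to the factor -16 they are
  the two coefficients in \<open>F_coframe_wedge_psi\<close>.\<close>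

definition eq_f :: "real \<Rightarrow> real \<Rightarrow> real \<Rightarrow> real \<Rightarrow> real \<Rightarrow> real" where
  "eq_f a b f g f' = a^2 * b^2 * f' + a * b^2 * (f^2 - f) - a^3 * (g^2 - f)"

definition eq_g :: "real \<Rightarrow> real \<Rightarrow> real \<Rightarrow> real \<Rightarrow> real \<Rightarrow> real" where
  "eq_g a b f g g' = a^2 * b^2 * g' - 2 * a * b^2 * g * (f - 1)"

definition radial :: lie where "radial = (1, 0, 0)"

text \<open>On these two argument lists the two surviving six-forms give an identity matrix, so each
  scalar equation can be read off separately.\<close>

lemma W_frame:
  "W 0 (W 1 (W 2 (W 3 (W 5 (W 6 one))))) [radial, T_plus 1, T_plus 2, T_plus 3, T_minus 2, T_minus 3] = 1"
  "W 0 (W 4 (W 5 (W 6 (W 2 (W 3 one))))) [radial, T_plus 1, T_plus 2, T_plus 3, T_minus 2, T_minus 3] = 0"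
  "W 0 (W 1 (W 2 (W 3 (W 5 (W 6 one))))) [radial, T_minus 1, T_minus 2, T_minus 3, T_plus 2, T_plus 3] = 0"
  "W 0 (W 4 (W 5 (W 6 (W 2 (W 3 one))))) [radial, T_minus 1, T_minus 2, T_minus 3, T_plus 2, T_plus 3] = 1"
proof -
  have vals: "coframe 0 [radial] = 1" "coframe 0 [T_plus i] = 0" "coframe 0 [T_minus i] = 0"
    "coframe 1 [radial] = 0" "coframe 2 [radial] = 0" "coframe 3 [radial] = 0"
    "coframe 4 [radial] = 0" "coframe 5 [radial] = 0" "coframe 6 [radial] = 0"
    "coframe 1 [T_plus 1] = 1" "coframe 1 [T_plus 2] = 0" "coframe 1 [T_plus 3] = 0" "coframe 1 [T_minus i] = 0"
    "coframe 2 [T_plus 1] = 0" "coframe 2 [T_plus 2] = 1" "coframe 2 [T_plus 3] = 0" "coframe 2 [T_minus i] = 0"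
    "coframe 3 [T_plus 1] = 0" "coframe 3 [T_plus 2] = 0" "coframe 3 [T_plus 3] = 1" "coframe 3 [T_minus i] = 0"
    "coframe 4 [T_minus 1] = 1" "coframe 4 [T_minus 2] = 0" "coframe 4 [T_minus 3] = 0" "coframe 4 [T_plus i] = 0"
    "coframe 5 [T_minus 1] = 0" "coframe 5 [T_minus 2] = 1" "coframe 5 [T_minus 3] = 0" "coframe 5 [T_plus i] = 0"
    "coframe 6 [T_minus 1] = 0" "coframe 6 [T_minus 2] = 0" "coframe 6 [T_minus 3] = 1" "coframe 6 [T_plus i] = 0" for i
    by (simp_all add: coframe_eval T_plus_def T_minus_def radial_def T_def axis_def del: One_nat_def)
  show "W 0 (W 1 (W 2 (W 3 (W 5 (W 6 one))))) [radial, T_plus 1, T_plus 2, T_plus 3, T_minus 2, T_minus 3] = 1"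
    "W 0 (W 4 (W 5 (W 6 (W 2 (W 3 one))))) [radial, T_plus 1, T_plus 2, T_plus 3, T_minus 2, T_minus 3] = 0"
    "W 0 (W 1 (W 2 (W 3 (W 5 (W 6 one))))) [radial, T_minus 1, T_minus 2, T_minus 3, T_plus 2, T_plus 3] = 0"
    "W 0 (W 4 (W 5 (W 6 (W 2 (W 3 one))))) [radial, T_minus 1, T_minus 2, T_minus 3, T_plus 2, T_plus 3] = 1"
    by (simp_all only: wedge_1_Cons wedge_1_Nil vals scaleR_zero_right scaleR_one real_scaleR_def mult_zero_right mult_1_right
        diff_0_right diff_self mult_zero_left ext[OF wedge_zero_right] ext[OF wedge_diff_right] ext[OF wedge_minus_right] diff_0 minus_zero minus_minus)
qed

lemma instanton_iff:
  assumes z: "(t, a1, a2) \<in> complement \<epsilon>"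
    and A: "\<And>w X. w \<in> complement \<epsilon> \<Longrightarrow> A w X = ansatz x y w X"
    and f: "f = A1 t * x t" "((\<lambda>t. A1 t * x t) has_real_derivative f') (at t)"
    and g: "g = B1 t * y t" "((\<lambda>t. B1 t * y t) has_real_derivative g') (at t)"
  shows "(\<forall>Xs. length Xs = 6 \<longrightarrow> wedge 2 (curvature A (t, a1, a2)) (psi t) Xs = 0) \<longleftrightarrow>
     eq_f (A1 t) (B1 t) (f) (g) f' = 0 \<and> eq_g (A1 t) (B1 t) (f) (g) g' = 0"
proof -
  let ?F = "\<lambda>i j k. F_coframe i j k (f) (g) f' g'"
  let ?P = "psi_coframe (A1 t) (B1 t)"
  let ?E = "eq_f (A1 t) (B1 t) (f) (g) f'" and ?G = "eq_g (A1 t) (B1 t) (f) (g) g'"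
  note curv = curvature_ansatz[OF z A f g]
  have comp: "wedge 2 (curvature A (t, a1, a2)) (psi t) Xs $ 1 = wedge 2 (?F 1 2 3) ?P Xs"
      "wedge 2 (curvature A (t, a1, a2)) (psi t) Xs $ 2 = wedge 2 (?F 2 3 1) ?P Xs"
      "wedge 2 (curvature A (t, a1, a2)) (psi t) Xs $ 3 = wedge 2 (?F 3 1 2) ?P Xs" if "length Xs = 6" for Xs
    unfolding wedge_component by (rule wedge_cong; use that in \<open>simp add: curv psi_eq\<close>)+
  have FP: "wedge 2 (?F i j k) ?P Xs = -16 * ?E * W 0 (W i (W j (W k (W (j + 3) (W (k + 3) one))))) Xs
      + (-16) * ?G * W 0 (W (i+3) (W (j + 3) (W (k+3) (W j (W k one))))) Xs"
    if "(i,j,k) \<in> {(1,2,3),(2,3,1),(3,1,2)}" for i j k Xs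
    using F_coframe_wedge_psi[OF that] unfolding eq_f_def eq_g_def .
  show ?thesis
  proof
    assume L: "\<forall>Xs. length Xs = 6 \<longrightarrow> wedge 2 (curvature A (t, a1, a2)) (psi t) Xs = 0"
    \<comment> \<open>Both scalar equations already occur in the first component.\<close>
    have "wedge 2 (?F 1 2 3) ?P Xs = 0" if "length Xs = 6" for Xs
      using L that comp(1)[OF that] by simp
    then have *: "-16 * ?E * W 0 (W 1 (W 2 (W 3 (W (2 + 3) (W (3 + 3) one))))) Xs
      + (-16) * ?G * W 0 (W (1+3) (W (2 + 3) (W (3+3) (W 2 (W 3 one))))) Xs = 0" if "length Xs = 6" for Xs
      using FP[of 1 2 3 Xs] that by simp
    have **: "(1::nat) + 3 = 4" "(2::nat) + 3 = 5" "(3::nat) + 3 = 6" by simp_all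
    have "-16 * ?E * 1 + (-16) * ?G * 0 = 0"
      using *[of "[radial, T_plus 1, T_plus 2, T_plus 3, T_minus 2, T_minus 3]"] unfolding ** W_frame by simp
    moreover have "-16 * ?E * 0 + (-16) * ?G * 1 = 0"
      using *[of "[radial, T_minus 1, T_minus 2, T_minus 3, T_plus 2, T_plus 3]"] unfolding ** W_frame by simp
    ultimately show "?E = 0 \<and> ?G = 0" by simp
  next
    assume "?E = 0 \<and> ?G = 0"
    then have "wedge 2 (?F 1 2 3) ?P Xs = 0" "wedge 2 (?F 2 3 1) ?P Xs = 0" "wedge 2 (?F 3 1 2) ?P Xs = 0" for Xs
      using FP[of 1 2 3 Xs] FP[of 2 3 1 Xs] FP[of 3 1 2 Xs] by simp_all
    then show "\<forall>Xs. length Xs = 6 \<longrightarrow> wedge 2 (curvature A (t, a1, a2)) (psi t) Xs = 0"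
      by (simp add: vec_eq_iff forall_3 comp del: One_nat_def)
  qed
qed

section \<open>Uniqueness for the singular system\<close>

text \<open>With \<open>a = t / A\<close> and \<open>\<beta> = t A / B\<^sup>2\<close> the left side
  is \<open>t E'\<close>. The part from \<open>f\<^sup>2 - f\<close> factors as
  \<open>- 2 a (f + f1 - 1) d\<^sup>2\<close>, of good sign as \<open>f\<close> and
  \<open>f1\<close> are near 1. The weight \<open>q\<close> balances the coupling of
  \<open>d\<close> and \<open>e\<close>: \<open>\<beta> M \<le> q\<close> and
  \<open>q M = 1 / 6\<close> bound each mixed term by \<open>2 P\<close>, and \<open>1 / 12\<close>
  bounds the last diagonal term by \<open>q\<^sup>2 e\<^sup>2\<close>; as
  \<open>2 P \<le> E\<close>, the total is at most \<open>3 E\<close>.\<close>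

lemma energy_estimate:
  fixes a \<beta> f f1 g g1 M q :: real
  assumes "0 \<le> a" "a \<le> 3" "0 \<le> \<beta>" "0 \<le> f + f1 - 1" "\<bar>g + g1\<bar> \<le> M" "\<bar>g1\<bar> \<le> M" "1 \<le> M"
    and q: "q = 1 / (6 * M)" and "\<beta> * M \<le> q" "\<bar>f - 1\<bar> \<le> 1 / 12"
  defines "d \<equiv> f - f1" and "e \<equiv> g - g1"
  shows "2 * d * (- a * (f\<^sup>2 - f) + \<beta> * (g\<^sup>2 - f) - (- a * (f1\<^sup>2 - f1) + \<beta> * (g1\<^sup>2 - f1)))
    + 2 * q\<^sup>2 * e * (2 * a * g * (f - 1) - 2 * a * g1 * (f1 - 1)) \<le> 3 * (d\<^sup>2 + q\<^sup>2 * e\<^sup>2)"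
proof -
  have qM: "q * M = 1 / 6" and q0: "0 < q" using assms(7) by (simp_all add: q)
  define P where "P = \<bar>d\<bar> * \<bar>q * e\<bar>"
  have P: "2 * P \<le> d\<^sup>2 + q\<^sup>2 * e\<^sup>2"
    using sum_squares_bound[of "\<bar>d\<bar>" "\<bar>q * e\<bar>"] by (simp add: P_def power_mult_distrib)
  have P0: "0 \<le> P" by (simp add: P_def)
  have "2 * d * (- a * (f\<^sup>2 - f) + \<beta> * (g\<^sup>2 - f) - (- a * (f1\<^sup>2 - f1) + \<beta> * (g1\<^sup>2 - f1)))
    + 2 * q\<^sup>2 * e * (2 * a * g * (f - 1) - 2 * a * g1 * (f1 - 1))
    = - 2 * (a * (f + f1 - 1) * d\<^sup>2) + 2 * \<beta> * (g + g1) * (d * e) - 2 * (\<beta> * d\<^sup>2)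
      + 4 * q\<^sup>2 * a * g1 * (d * e) + 4 * a * (f - 1) * (q\<^sup>2 * e\<^sup>2)"
    unfolding d_def e_def by (simp add: power2_eq_square algebra_simps)
  moreover have "0 \<le> a * (f + f1 - 1) * d\<^sup>2" "0 \<le> \<beta> * d\<^sup>2" using assms by auto
  moreover have "2 * \<beta> * (g + g1) * (d * e) \<le> 2 * P"
  proof -
    have "\<beta> * \<bar>g + g1\<bar> \<le> q" using mult_left_mono[OF assms(5), of \<beta>] assms by linarith
    have "2 * \<beta> * (g + g1) * (d * e) \<le> \<bar>2 * \<beta> * (g + g1) * (d * e)\<bar>" by simp
    also have "\<dots> = 2 * (\<beta> * \<bar>g + g1\<bar>) * (\<bar>d\<bar> * \<bar>e\<bar>)" using assms by (simp add: abs_mult)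
    also have "\<dots> \<le> 2 * q * (\<bar>d\<bar> * \<bar>e\<bar>)"
      using \<open>\<beta> * \<bar>g + g1\<bar> \<le> q\<close> by (intro mult_right_mono) auto
    also have "\<dots> = 2 * P" using q0 by (simp add: P_def abs_mult)
    finally show ?thesis .
  qed
  moreover have "4 * q\<^sup>2 * a * g1 * (d * e) \<le> 2 * P"
  proof -
    have "a * \<bar>g1\<bar> \<le> 3 * M" using assms by (intro mult_mono) auto
    have "4 * q\<^sup>2 * a * g1 * (d * e) \<le> \<bar>4 * q\<^sup>2 * a * g1 * (d * e)\<bar>" by simp
    also have "\<dots> = 4 * q * (a * \<bar>g1\<bar>) * P" using assms q0 by (simp add: abs_mult P_def power2_eq_square)
    also have "\<dots> \<le> 4 * q * (3 * M) * P"
      using \<open>a * \<bar>g1\<bar> \<le> 3 * M\<close> q0 P0 by (intro mult_right_mono mult_left_mono) auto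
    also have "\<dots> = 12 * (q * M) * P" by simp
    finally show ?thesis unfolding qM by simp
  qed
  moreover have "4 * a * (f - 1) * (q\<^sup>2 * e\<^sup>2) \<le> q\<^sup>2 * e\<^sup>2"
  proof -
    have "a * (f - 1) \<le> a * \<bar>f - 1\<bar>" using assms by (intro mult_left_mono) auto
    also have "\<dots> \<le> 3 * (1 / 12)" using assms by (intro mult_mono) auto
    finally have "4 * a * (f - 1) \<le> 1" by simp
    from mult_right_mono[OF this, of "q\<^sup>2 * e\<^sup>2"] show ?thesis by simp
  qed
  moreover have "0 \<le> d\<^sup>2" by simp
  moreover note P
  moreover have "L \<le> 3 * (x + y)"
    if "L = - 2 * T1 + T2 - 2 * T3 + T4 + T5" "0 \<le> T1" "0 \<le> T3" "T2 \<le> 2 * P" "T4 \<le> 2 * P" "T5 \<le> y"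
      "0 \<le> x" "2 * P \<le> x + y" for L T1 T2 T3 T4 T5 x y :: real
    using that by (simp add: algebra_simps)
  ultimately show ?thesis by blast
qed

text \<open>After multiplication by \<open>t\<close> the coefficients \<open>t / a\<close> and
  \<open>t a / b\<^sup>2\<close> tend to 2 and 0 at the singular orbit, in contrast to the unbounded
  \<open>1 / a\<close>.\<close>

lemma eq_f_solved:
  assumes "eq_f a b f g f' = 0" "a \<noteq> 0" "b \<noteq> 0"
  shows "t * f' = - (t / a) * (f\<^sup>2 - f) + (t * a / b\<^sup>2) * (g\<^sup>2 - f)"
proof -
  have "a\<^sup>2 * b\<^sup>2 * (t * f') = t * (- a * b\<^sup>2 * (f\<^sup>2 - f) + a ^ 3 * (g\<^sup>2 - f))"
    using assms(1) unfolding eq_f_def by algebra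
  then have "t * f' = t * (- a * b\<^sup>2 * (f\<^sup>2 - f) + a ^ 3 * (g\<^sup>2 - f)) / (a\<^sup>2 * b\<^sup>2)"
    using assms by (simp add: field_simps)
  also have "\<dots> = - (t / a) * (f\<^sup>2 - f) + (t * a / b\<^sup>2) * (g\<^sup>2 - f)"
    using assms by (simp add: field_simps power2_eq_square power3_eq_cube)
  finally show ?thesis .
qed

lemma eq_g_solved:
  assumes "eq_g a b f g g' = 0" "a \<noteq> 0" "b \<noteq> 0"
  shows "t * g' = 2 * (t / a) * g * (f - 1)"
proof -
  have "(a * b\<^sup>2) * (a * g' - 2 * g * (f - 1)) = 0"
    using assms(1) unfolding eq_g_def by algebra
  then have "a * g' = 2 * g * (f - 1)" using assms by simp
  then have "g' = 2 * g * (f - 1) / a" using assms by (simp add: field_simps)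
  then show ?thesis by simp
qed

lemma singular_system_unique:
  fixes f g f1 g1 f' g' f1' g1' A B :: "real \<Rightarrow> real"
  assumes \<rho>: "0 < \<rho>"
    and D: "\<And>t. 0 < t \<Longrightarrow> t < \<rho> \<Longrightarrow> (f has_real_derivative f' t) (at t)"
      "\<And>t. 0 < t \<Longrightarrow> t < \<rho> \<Longrightarrow> (g has_real_derivative g' t) (at t)"
      "\<And>t. 0 < t \<Longrightarrow> t < \<rho> \<Longrightarrow> (f1 has_real_derivative f1' t) (at t)"
      "\<And>t. 0 < t \<Longrightarrow> t < \<rho> \<Longrightarrow> (g1 has_real_derivative g1' t) (at t)"
    and eq: "\<And>t. 0 < t \<Longrightarrow> t < \<rho> \<Longrightarrow> eq_f (A t) (B t) (f t) (g t) (f' t) = 0"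
      "\<And>t. 0 < t \<Longrightarrow> t < \<rho> \<Longrightarrow> eq_g (A t) (B t) (f t) (g t) (g' t) = 0"
      "\<And>t. 0 < t \<Longrightarrow> t < \<rho> \<Longrightarrow> eq_f (A t) (B t) (f1 t) (g1 t) (f1' t) = 0"
      "\<And>t. 0 < t \<Longrightarrow> t < \<rho> \<Longrightarrow> eq_g (A t) (B t) (f1 t) (g1 t) (g1' t) = 0"
    and A: "((\<lambda>t. A t / t) \<longlongrightarrow> 1 / 2) (at_right 0)" and B: "(B \<longlongrightarrow> b) (at_right 0)" "0 < b"
    and lim: "(f \<longlongrightarrow> 1) (at_right 0)" "(f1 \<longlongrightarrow> 1) (at_right 0)"
      "(g \<longlongrightarrow> c) (at_right 0)" "(g1 \<longlongrightarrow> c) (at_right 0)"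
    and O: "(\<lambda>t. f t - f1 t) \<in> O[at_right 0](\<lambda>t. t\<^sup>2)" "(\<lambda>t. g t - g1 t) \<in> O[at_right 0](\<lambda>t. t\<^sup>2)"
  obtains \<sigma> where "0 < \<sigma>" "\<sigma> \<le> \<rho>" "\<And>t. 0 < t \<Longrightarrow> t < \<sigma> \<Longrightarrow> f t = f1 t \<and> g t = g1 t"
proof -
  \<comment> \<open>\<open>M\<close> strictly exceeds the limits \<open>2 \<bar>c\<bar>\<close> of
    \<open>\<bar>g + g1\<bar>\<close> and \<open>\<bar>c\<bar>\<close> of
    \<open>\<bar>g1\<bar>\<close>, so both are eventually below it.\<close>
  define M where "M = 2 * \<bar>c\<bar> + 1"
  define q where "q = 1 / (6 * M)"
  have M: "1 \<le> M" by (simp add: M_def)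
  have q0: "0 < q" using M by (simp add: q_def)
  let ?ev = "\<lambda>P. eventually P (at_right (0::real))"
  have "((\<lambda>t. t * A t / (B t)\<^sup>2) \<longlongrightarrow> 0) (at_right 0)"
  proof -
    have "((\<lambda>t. t\<^sup>2 * (A t / t) / (B t)\<^sup>2) \<longlongrightarrow> 0\<^sup>2 * (1 / 2) / b\<^sup>2) (at_right 0)"
      using B by (intro tendsto_intros A B) auto
    moreover have "?ev (\<lambda>t. t\<^sup>2 * (A t / t) / (B t)\<^sup>2 = t * A t / (B t)\<^sup>2)"
      using eventually_at_right_less[of 0] by eventually_elim (simp add: power2_eq_square)
    ultimately show ?thesis by (simp add: tendsto_cong)
  qed
  then have e1: "?ev (\<lambda>t. t * A t / (B t)\<^sup>2 < q / M)"
    using q0 M by (intro order_tendstoD(2)[of _ 0]) auto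
  \<comment> \<open>The limit 1 / 2 leaves room: \<open>A t / t > 1 / 3\<close> turns into the bound
    \<open>a \<le> 3\<close> of the energy estimate.\<close>
  have e2: "?ev (\<lambda>t. A t / t > 1 / 3)" using A by (rule order_tendstoD(1)) simp
  have e3: "?ev (\<lambda>t. B t > 0)" using B by (rule order_tendstoD(1))
  have "((\<lambda>t. f t + f1 t - 1) \<longlongrightarrow> 1 + 1 - 1) (at_right 0)" by (intro tendsto_intros lim)
  then have e4: "?ev (\<lambda>t. f t + f1 t - 1 > 0)" by (rule order_tendstoD(1)) simp
  have "((\<lambda>t. \<bar>g t + g1 t\<bar>) \<longlongrightarrow> \<bar>c + c\<bar>) (at_right 0)" by (intro tendsto_intros lim)
  then have e5: "?ev (\<lambda>t. \<bar>g t + g1 t\<bar> < M)" by (rule order_tendstoD(2)) (simp add: M_def)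
  have "((\<lambda>t. \<bar>g1 t\<bar>) \<longlongrightarrow> \<bar>c\<bar>) (at_right 0)" by (intro tendsto_intros lim)
  then have e6: "?ev (\<lambda>t. \<bar>g1 t\<bar> < M)" by (rule order_tendstoD(2)) (simp add: M_def)
  have "((\<lambda>t. \<bar>f t - 1\<bar>) \<longlongrightarrow> \<bar>1 - 1\<bar>) (at_right 0)" by (intro tendsto_intros lim)
  then have e7: "?ev (\<lambda>t. \<bar>f t - 1\<bar> < 1 / 12)" by (rule order_tendstoD(2)) simp
  have "?ev (\<lambda>t. t * A t / (B t)\<^sup>2 < q / M \<and> A t / t > 1 / 3 \<and> B t > 0 \<and> f t + f1 t - 1 > 0
      \<and> \<bar>g t + g1 t\<bar> < M \<and> \<bar>g1 t\<bar> < M \<and> \<bar>f t - 1\<bar> < 1 / 12)"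
    using e1 e2 e3 e4 e5 e6 e7 by eventually_elim simp
  then obtain r where r: "r > 0" "\<And>t. 0 < t \<Longrightarrow> t < r \<Longrightarrow> t * A t / (B t)\<^sup>2 < q / M \<and> A t / t > 1 / 3 \<and> B t > 0
      \<and> f t + f1 t - 1 > 0 \<and> \<bar>g t + g1 t\<bar> < M \<and> \<bar>g1 t\<bar> < M \<and> \<bar>f t - 1\<bar> < 1 / 12"
    unfolding eventually_at_right_field by auto
  define \<sigma> where "\<sigma> = min r \<rho>"
  define E where "E t = (f t - f1 t)\<^sup>2 + q\<^sup>2 * (g t - g1 t)\<^sup>2" for t
  define E' where "E' t = 2 * (f t - f1 t) * (f' t - f1' t) + 2 * q\<^sup>2 * (g t - g1 t) * (g' t - g1' t)" for t
  have DE: "(E has_real_derivative E' t) (at t)" if "0 < t" "t < \<sigma>" for t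
    unfolding E_def[abs_def] E'_def using that
    by (auto intro!: derivative_eq_intros D simp: \<sigma>_def algebra_simps)
  have est: "t * E' t \<le> 3 * E t" if t: "0 < t" "t < \<sigma>" for t
  proof -
    have t': "t < r" "t < \<rho>" using t by (auto simp: \<sigma>_def)
    note R = r(2)[OF t(1) t'(1)]
    have At: "A t > t / 3" using R t by (simp add: field_simps)
    then have A0: "A t > 0" using t by linarith
    have B0: "B t > 0" using R by blast
    have nz: "A t \<noteq> 0" "B t \<noteq> 0" using A0 B0 by auto
    have "t * A t / (B t)\<^sup>2 * M \<le> q" using R M by (simp add: less_divide_eq less_imp_le)
    moreover have "t / A t \<le> 3" using At A0 by (simp add: divide_le_eq)
    ultimately have "2 * (f t - f1 t) * (- (t / A t) * ((f t)\<^sup>2 - f t) + t * A t / (B t)\<^sup>2 * ((g t)\<^sup>2 - f t)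
        - (- (t / A t) * ((f1 t)\<^sup>2 - f1 t) + t * A t / (B t)\<^sup>2 * ((g1 t)\<^sup>2 - f1 t)))
      + 2 * q\<^sup>2 * (g t - g1 t) * (2 * (t / A t) * g t * (f t - 1) - 2 * (t / A t) * g1 t * (f1 t - 1)) \<le> 3 * E t"
      unfolding E_def using R A0 B0 t M q_def by (intro energy_estimate[where M = M]) auto
    moreover have "t * E' t = 2 * (f t - f1 t) * (t * f' t - t * f1' t) + 2 * q\<^sup>2 * (g t - g1 t) * (t * g' t - t * g1' t)"
      by (simp add: E'_def algebra_simps)
    ultimately show ?thesis
      using eq_f_solved[OF eq(1)[OF t(1) t'(2)] nz, of t] eq_f_solved[OF eq(3)[OF t(1) t'(2)] nz, of t]
        eq_g_solved[OF eq(2)[OF t(1) t'(2)] nz, of t] eq_g_solved[OF eq(4)[OF t(1) t'(2)] nz, of t]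
      by presburger
  qed
  have mono: "E t / t ^ 3 \<le> E s / s ^ 3" if s: "0 < s" "s \<le> t" "t < \<sigma>" for s t
  proof (rule DERIV_nonpos_imp_nonincreasing[OF s(2)])
    fix u assume u: "s \<le> u" "u \<le> t"
    have u0: "0 < u" "u < \<sigma>" using u s by auto
    have "((\<lambda>t. E t / t ^ 3) has_real_derivative (E' u * u ^ 3 - E u * (3 * u ^ 2)) / (u ^ 3 * u ^ 3)) (at u)"
      using u0 by (auto intro!: derivative_eq_intros DE simp: power2_eq_square)
    moreover have "(E' u * u ^ 3 - E u * (3 * u ^ 2)) / (u ^ 3 * u ^ 3) = u ^ 2 * (u * E' u - 3 * E u) / (u ^ 3 * u ^ 3)"
      by (simp add: power2_eq_square power3_eq_cube algebra_simps)
    moreover have "\<dots> \<le> 0" using est[OF u0] u0 by (intro divide_nonpos_pos mult_nonneg_nonpos) auto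
    ultimately show "\<exists>y. ((\<lambda>t. E t / t ^ 3) has_real_derivative y) (at u) \<and> y \<le> 0" by auto
  qed
  \<comment> \<open>Differences of order \<open>t\<^sup>2\<close> make \<open>E\<close> of order
    \<open>t\<^sup>4\<close>, one power better than the rate 3 of the estimate.\<close>
  obtain C1 C2 where C: "?ev (\<lambda>t. \<bar>f t - f1 t\<bar> \<le> C1 * t\<^sup>2)" "?ev (\<lambda>t. \<bar>g t - g1 t\<bar> \<le> C2 * t\<^sup>2)"
    using O by (auto elim!: landau_o.bigE)
  have "((\<lambda>t. E t / t ^ 3) \<longlongrightarrow> 0) (at_right 0)"
  proof (rule tendsto_sandwich)
    show "((\<lambda>t. 0) \<longlongrightarrow> (0::real)) (at_right (0::real))" by simp
    have "((\<lambda>t. (C1\<^sup>2 + q\<^sup>2 * C2\<^sup>2) * t) \<longlongrightarrow> (C1\<^sup>2 + q\<^sup>2 * C2\<^sup>2) * 0) (at_right 0)"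
      by (intro tendsto_intros)
    then show "((\<lambda>t. (C1\<^sup>2 + q\<^sup>2 * C2\<^sup>2) * t) \<longlongrightarrow> 0) (at_right 0)" by simp
    show "?ev (\<lambda>t. 0 \<le> E t / t ^ 3)"
      using eventually_at_right_less[of 0] by eventually_elim (simp add: E_def)
    show "?ev (\<lambda>t. E t / t ^ 3 \<le> (C1\<^sup>2 + q\<^sup>2 * C2\<^sup>2) * t)"
      using C eventually_at_right_less[of 0]
    proof eventually_elim
      case (elim t)
      have "(f t - f1 t)\<^sup>2 \<le> (C1 * t\<^sup>2)\<^sup>2" "(g t - g1 t)\<^sup>2 \<le> (C2 * t\<^sup>2)\<^sup>2"
        using elim by (intro abs_le_square_iff[THEN iffD1]; simp)+
      then have "E t \<le> (C1 * t\<^sup>2)\<^sup>2 + q\<^sup>2 * (C2 * t\<^sup>2)\<^sup>2"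
        unfolding E_def by (intro add_mono mult_left_mono) auto
      also have "\<dots> = ((C1\<^sup>2 + q\<^sup>2 * C2\<^sup>2) * t) * t ^ 3"
        by (simp add: power2_eq_square power3_eq_cube algebra_simps)
      finally show ?case using elim by (simp add: divide_le_eq)
    qed
  qed
  then have nonpos: "E t / t ^ 3 \<le> 0" if t: "0 < t" "t < \<sigma>" for t
  proof (rule tendsto_lowerbound)
    show "?ev (\<lambda>s. E t / t ^ 3 \<le> E s / s ^ 3)"
      using eventually_at_right_real[OF t(1)] by eventually_elim (use t mono in auto)
  qed simp
  show thesis
  proof (rule that[of \<sigma>])
    show "0 < \<sigma>" "\<sigma> \<le> \<rho>" using \<rho> r by (auto simp: \<sigma>_def)
    fix t assume t: "0 < t" "t < \<sigma>"
    have "E t \<le> 0" using nonpos[OF t] t by (simp add: divide_le_0_iff)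
    moreover have "0 \<le> (f t - f1 t)\<^sup>2" "0 \<le> q\<^sup>2 * (g t - g1 t)\<^sup>2" by auto
    ultimately have "(f t - f1 t)\<^sup>2 = 0" "q\<^sup>2 * (g t - g1 t)\<^sup>2 = 0" unfolding E_def by linarith+
    then show "f t = f1 t \<and> g t = g1 t" using q0 by simp
  qed
qed

section \<open>The family of instantons\<close>

text \<open>Here \<open>w\<^sup>2 = z\<close> and \<open>3 * w / r ^ 4\<close> is
  \<open>dz/dt\<close>, so the last arguments are the \<open>t\<close>-derivatives of
  \<open>f = 1 + z h\<close> and \<open>g\<close> given by the chain rule.\<close>

lemma series_solution_implies_eqs:
  fixes w r h g h' g' :: real
  assumes r: "0 < r" "(1 - w\<^sup>2) * r ^ 3 = 1"
    and h: "(1 - w\<^sup>2) * (w\<^sup>2 * h') = - 2 * h + w\<^sup>2 * h - w\<^sup>2 * h\<^sup>2 + (g\<^sup>2 - 1 - w\<^sup>2 * h) / 3"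
    and g: "(1 - w\<^sup>2) * g' = 2 * (g * h)"
  shows "eq_f (r / 3 * w) (r / sqrt 3) (1 + w\<^sup>2 * h) g ((h + w\<^sup>2 * h') * (3 * w / r ^ 4)) = 0"
    and "eq_g (r / 3 * w) (r / sqrt 3) (1 + w\<^sup>2 * h) g (g' * (3 * w / r ^ 4)) = 0"
proof -
  have b2: "(r / sqrt 3)\<^sup>2 = r\<^sup>2 / 3" by (simp add: power_divide)
  have r3: "1 - w\<^sup>2 = 1 / r ^ 3" using r by (simp add: field_simps)
  have hh: "(h + w\<^sup>2 * h') / r ^ 3 = - h - w\<^sup>2 * h\<^sup>2 + (g\<^sup>2 - 1 - w\<^sup>2 * h) / 3"
  proof -
    have "(h + w\<^sup>2 * h') / r ^ 3 = (1 - w\<^sup>2) * h + (1 - w\<^sup>2) * (w\<^sup>2 * h')"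
      unfolding r3 by (simp add: add_divide_distrib)
    also have "\<dots> = - h - w\<^sup>2 * h\<^sup>2 + (g\<^sup>2 - 1 - w\<^sup>2 * h) / 3" unfolding h by (simp add: algebra_simps)
    finally show ?thesis .
  qed
  have "(h + w\<^sup>2 * h') * (3 * w / r ^ 4) = (h + w\<^sup>2 * h') / r ^ 3 * (3 * w / r)"
    using r by (simp add: field_simps eval_nat_numeral)
  then have *: "(h + w\<^sup>2 * h') * (3 * w / r ^ 4) = (- h - w\<^sup>2 * h\<^sup>2 + (g\<^sup>2 - 1 - w\<^sup>2 * h) / 3) * (3 * w / r)"
    unfolding hh .
  show "eq_f (r / 3 * w) (r / sqrt 3) (1 + w\<^sup>2 * h) g ((h + w\<^sup>2 * h') * (3 * w / r ^ 4)) = 0"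
    unfolding eq_f_def b2 * using r(1) by (simp add: field_simps) (simp add: algebra_simps eval_nat_numeral)
  have "g' / r ^ 3 = 2 * (g * h)" using g unfolding r3 by simp
  moreover have "g' * (3 * w / r ^ 4) = g' / r ^ 3 * (3 * w / r)"
    using r by (simp add: field_simps eval_nat_numeral)
  ultimately have **: "g' * (3 * w / r ^ 4) = 2 * (g * h) * (3 * w / r)" by simp
  show "eq_g (r / 3 * w) (r / sqrt 3) (1 + w\<^sup>2 * h) g (g' * (3 * w / r ^ 4)) = 0"
    unfolding eq_g_def b2 ** using r(1) by (simp add: field_simps) (simp add: algebra_simps eval_nat_numeral)
qed

lemma bigo_compose_square:
  assumes "(\<lambda>s. F s - (a + d * s)) \<in> O[nhds 0](\<lambda>s::real. s ^ 2)"
  shows "(\<lambda>t. F (t\<^sup>2) - (a + d * t\<^sup>2)) \<in> O[at_right 0](\<lambda>t::real. t ^ 4)"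
proof -
  have "((\<lambda>t::real. t\<^sup>2) \<longlongrightarrow> 0\<^sup>2) (at_right 0)" by (intro tendsto_intros)
  then have "filterlim (\<lambda>t::real. t\<^sup>2) (nhds 0) (at_right 0)" by simp
  from landau_o.big.compose[OF assms this] show ?thesis
    by (simp flip: power_mult)
qed

text \<open>Shrinking \<open>S\<close> keeps \<open>Z\<close> inside the interval on which the
  series for \<open>h\<close> and \<open>g\<close> converge.\<close>

lemma tau_inverse_small:
  assumes "0 < R"
  obtains S :: real and Z where "0 < S" "Z 0 = 0"
    "\<And>s. \<bar>s\<bar> < S \<Longrightarrow> \<bar>Z s\<bar> < R \<and> \<bar>Z s\<bar> < 1 \<and> 0 < k_fun (Z s) \<and> Z s * (k_fun (Z s))\<^sup>2 = s"
    "\<And>s. \<bar>s\<bar> < S \<Longrightarrow> (Z has_real_derivative 3 / 2 * (1 - Z s) powr (4 / 3) / k_fun (Z s)) (at s)"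
    "smooth_on {-S<..<S} Z"
proof -
  obtain S c Z where S: "0 < S" and c: "0 < c" "c < 1" and Z0: "Z 0 = 0"
    and Z: "\<And>s. \<bar>s\<bar> < S \<Longrightarrow> \<bar>Z s\<bar> < c \<and> 0 < k_fun (Z s) \<and> Z s * (k_fun (Z s))\<^sup>2 = s"
    and D: "\<And>s. \<bar>s\<bar> < S \<Longrightarrow> (Z has_real_derivative 3 / 2 * (1 - Z s) powr (4 / 3) / k_fun (Z s)) (at s)"
    and sm: "smooth_on {-S<..<S} Z"
    by (rule tau_inverse) blast
  have "isCont Z 0" using D[of 0] S by (intro DERIV_isCont) auto
  then have "(Z \<longlongrightarrow> 0) (at 0)" by (simp add: isCont_def Z0)
  then have "eventually (\<lambda>s. dist (Z s) 0 < R) (at 0)" using assms by (rule tendstoD)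
  then obtain d where d: "d > 0" "\<And>s. s \<noteq> 0 \<Longrightarrow> \<bar>s\<bar> < d \<Longrightarrow> \<bar>Z s\<bar> < R"
    by (auto simp: eventually_at dist_real_def)
  show thesis
  proof (rule that[of "min S d" Z])
    show "0 < min S d" "Z 0 = 0" using S d Z0 by auto
    fix s assume s: "\<bar>s\<bar> < min S d"
    have "\<bar>Z s\<bar> < R" using d(2)[of s] s Z0 assms by (cases "s = 0") auto
    then show "\<bar>Z s\<bar> < R \<and> \<bar>Z s\<bar> < 1 \<and> 0 < k_fun (Z s) \<and> Z s * (k_fun (Z s))\<^sup>2 = s"
      using Z[of s] s c by auto
    show "(Z has_real_derivative 3 / 2 * (1 - Z s) powr (4 / 3) / k_fun (Z s)) (at s)" using s by (intro D) simp
  next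
    show "smooth_on {- min S d<..<min S d} Z" by (rule smooth_on_subset[OF sm]) auto
  qed
qed

text \<open>For \<open>t > 0\<close> the root \<open>z\<close> is positive and \<open>sqrt z\<close>
  is the parameter \<open>w\<close> with \<open>tau w = t\<close>, so the closed formulas
  apply.\<close>

lemma BS_at_tau_inverse:
  assumes t: "0 < t" and z: "\<bar>z\<bar> < 1" "0 < k_fun z" "z * (k_fun z)\<^sup>2 = t\<^sup>2"
  defines "r \<equiv> (1 - z) powr (- (1 / 3))"
  shows "0 < z" "t = sqrt z * k_fun z" "0 < r" "(1 - z) * r ^ 3 = 1"
    "A1 t = r / 3 * sqrt z" "B1 t = r / sqrt 3" "(1 - z) powr (4 / 3) = 1 / r ^ 4"
proof -
  have "0 < z * (k_fun z)\<^sup>2" using t z(3) by simp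
  then show z0: "0 < z" using z(2) by (simp add: zero_less_mult_iff)
  have "(sqrt z * k_fun z)\<^sup>2 = t\<^sup>2" using z0 z(3) by (simp add: power_mult_distrib)
  moreover have "0 < sqrt z * k_fun z" using z0 z(2) by simp
  ultimately show tz: "t = sqrt z * k_fun z" using t by (simp add: power2_eq_iff)
  have w: "0 \<le> sqrt z" "sqrt z < 1" "(sqrt z)\<^sup>2 = z" using z0 z(1) by auto
  have tau: "tau (sqrt z) = t" using tz w by (simp add: tau_def)
  have u: "0 < 1 - z" using z(1) by simp
  then show r0: "0 < r" by (simp add: r_def)
  show "(1 - z) * r ^ 3 = 1" using u by (simp add: r_def cube_powr_third)
  show "A1 t = r / 3 * sqrt z" "B1 t = r / sqrt 3"
    using A1_tau[OF w(1,2)] B1_tau[OF w(1,2)] unfolding tau w(3) r_def by simp_all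
  have "r ^ 4 = (1 - z) powr (4 * - (1 / 3))" unfolding r_def using u by (subst powr_power) auto
  then show "(1 - z) powr (4 / 3) = 1 / r ^ 4" using u r0 by (simp add: powr_minus field_simps)
qed

text \<open>Besides the instanton, the statement exports the equations and limits of its coefficient
  functions, since the uniqueness argument compares a competitor with exactly this solution.\<close>

lemma instanton_exists:
  fixes y0 :: real
  obtains \<epsilon> :: real and \<theta> x y f' g' where "0 < \<epsilon>" "G2_instanton \<epsilon> \<theta>" "SU2_cubed_invariant \<epsilon> \<theta>"
    "\<And>z X. z \<in> complement \<epsilon> \<Longrightarrow> local_form \<theta> z X = ansatz x y z X" "expansion y0 x y"
    "\<And>t. 0 < t \<Longrightarrow> t < \<epsilon> \<Longrightarrow> ((\<lambda>t. A1 t * x t) has_real_derivative f' t) (at t)"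
    "\<And>t. 0 < t \<Longrightarrow> t < \<epsilon> \<Longrightarrow> ((\<lambda>t. B1 t * y t) has_real_derivative g' t) (at t)"
    "\<And>t. 0 < t \<Longrightarrow> t < \<epsilon> \<Longrightarrow> eq_f (A1 t) (B1 t) (A1 t * x t) (B1 t * y t) (f' t) = 0"
    "\<And>t. 0 < t \<Longrightarrow> t < \<epsilon> \<Longrightarrow> eq_g (A1 t) (B1 t) (A1 t * x t) (B1 t * y t) (g' t) = 0"
    "((\<lambda>t. A1 t / t) \<longlongrightarrow> 1 / 2) (at_right 0)" "(B1 \<longlongrightarrow> 1 / sqrt 3) (at_right 0)"
    "((\<lambda>t. A1 t * x t) \<longlongrightarrow> 1) (at_right 0)" "((\<lambda>t. B1 t * y t) \<longlongrightarrow> y0 / sqrt 3) (at_right 0)"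
proof -
  \<comment> \<open>\<open>B\<^sub>1\<close> tends to \<open>1 / sqrt 3\<close> at the singular
    orbit, so \<open>y(0) = y0\<close> means \<open>g(0) = y0 / sqrt 3\<close>.\<close>
  define c where "c = y0 / sqrt 3"
  obtain R h h' g g' where R: "0 < R" "R \<le> 1" and smhg: "smooth_on {-R<..<R} h" "smooth_on {-R<..<R} g"
    and Dh: "\<And>x. \<bar>x\<bar> < R \<Longrightarrow> (h has_real_derivative h' x) (at x)"
    and Dg: "\<And>x. \<bar>x\<bar> < R \<Longrightarrow> (g has_real_derivative g' x) (at x)"
    and eqh: "\<And>x. \<bar>x\<bar> < R \<Longrightarrow>
       (1 - x) * (x * h' x) = - 2 * h x + x * h x - x * (h x)\<^sup>2 + ((g x)\<^sup>2 - 1 - x * h x) / 3"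
    and eqg: "\<And>x. \<bar>x\<bar> < R \<Longrightarrow> (1 - x) * g' x = 2 * (g x * h x)"
    and g0: "g 0 = c" and h0: "h 0 = (c\<^sup>2 - 1) / 6"
    by (rule singular_system_solution[of c]) blast
  obtain S Z where S: "0 < S" and Z0: "Z 0 = 0"
    and Z: "\<And>s. \<bar>s\<bar> < S \<Longrightarrow> \<bar>Z s\<bar> < R \<and> \<bar>Z s\<bar> < 1 \<and> 0 < k_fun (Z s) \<and> Z s * (k_fun (Z s))\<^sup>2 = s"
    and DZ: "\<And>s. \<bar>s\<bar> < S \<Longrightarrow> (Z has_real_derivative 3 / 2 * (1 - Z s) powr (4 / 3) / k_fun (Z s)) (at s)"
    and smZ: "smooth_on {-S<..<S} Z"
    by (rule tau_inverse_small[OF R(1)]) blast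
  let ?I = "{-S<..<S}"
  have op: "open ?I" by simp
  have ZI: "Z ` ?I \<subseteq> {-R<..<R}" "Z ` ?I \<subseteq> {-1<..<1}"
  proof -
    have "Z s \<in> {-R<..<R} \<and> Z s \<in> {-1<..<1}" if "s \<in> ?I" for s
      using Z[of s] that by (simp add: abs_less_iff)
    then show "Z ` ?I \<subseteq> {-R<..<R}" "Z ` ?I \<subseteq> {-1<..<1}" by blast+
  qed
  have sh: "smooth_on ?I (\<lambda>s. h (Z s))" "smooth_on ?I (\<lambda>s. g (Z s))"
    by (rule smooth_on_compose_real[OF op ZI(1) smhg(1) smZ], rule smooth_on_compose_real[OF op ZI(1) smhg(2) smZ])
  have sk: "smooth_on ?I (\<lambda>s. k_fun (Z s))"
    by (rule smooth_on_compose_real[OF op ZI(2) k_fun_smooth smZ])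
  have kI: "(\<lambda>s. k_fun (Z s)) ` ?I \<subseteq> {0<..}"
  proof -
    have "k_fun (Z s) \<in> {0<..}" if "s \<in> ?I" for s
      using Z[of s] that by (simp add: abs_less_iff)
    then show ?thesis by blast
  qed
  have sik: "smooth_on ?I (\<lambda>s. inverse (k_fun (Z s)))"
    by (rule smooth_on_compose_real[OF op kI smooth_on_inverse sk])
  have neg: "smooth_on ?I (\<lambda>s. - F s)" if "smooth_on ?I F" for F :: "real \<Rightarrow> real"
    by (rule smooth_on_linear[OF op bounded_linear_minus[OF bounded_linear_ident] that])
  have sf: "smooth_on ?I (\<lambda>s. 1 + Z s * h (Z s))"
    by (intro smooth_on_add smooth_on_const smooth_on_mult op smZ sh)
  define \<beta> where "\<beta> s = 1 / 2 * (1 + Z s * h (Z s) + - g (Z s))" for s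
  \<comment> \<open>\<open>f - 1 = z h\<close> and \<open>t\<^sup>2 = z k\<^sup>2\<close>, so the
    quotient \<open>h / k\<^sup>2\<close> has no singularity at \<open>z = 0\<close>.\<close>
  define \<mu> where "\<mu> s = h (Z s) * (inverse (k_fun (Z s)) * inverse (k_fun (Z s)))" for s
  have s\<beta>: "smooth_on {-S<..<S} \<beta>"
    unfolding \<beta>_def[abs_def] by (rule smooth_on_mult[OF op smooth_on_const[OF op] smooth_on_add[OF op sf neg[OF sh(2)]]])
  have s\<mu>: "smooth_on {-S<..<S} \<mu>"
    unfolding \<mu>_def[abs_def] by (rule smooth_on_mult[OF op sh(1) smooth_on_mult[OF op sik sik]])
  define \<epsilon> where "\<epsilon> = sqrt S"
  have \<epsilon>: "0 < \<epsilon>" "\<epsilon>\<^sup>2 \<le> S" using S by (simp_all add: \<epsilon>_def)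
  define \<theta> where "\<theta> = invariant_form \<beta> \<mu>"
  note conn = invariant_form_connection[OF s\<beta> s\<mu> \<epsilon>, folded \<theta>_def]
  define f where "f t = 1 + Z (t\<^sup>2) * h (Z (t\<^sup>2))" for t
  define G where "G t = g (Z (t\<^sup>2))" for t
  define x where "x t = f t / A1 t" for t
  define y where "y t = G t / B1 t" for t
  define r where "r t = (1 - Z (t\<^sup>2)) powr (- (1 / 3))" for t
  define w where "w t = sqrt (Z (t\<^sup>2))" for t
  have sq: "\<bar>t\<^sup>2\<bar> < S" if "0 < t" "t < \<epsilon>" for t
  proof -
    have "t\<^sup>2 < \<epsilon>\<^sup>2" using that by (intro power_strict_mono) auto
    then show ?thesis using \<epsilon>(2) by simp
  qed
  have BS: "0 < Z (t\<^sup>2)" "t = w t * k_fun (Z (t\<^sup>2))" "0 < r t" "(1 - Z (t\<^sup>2)) * r t ^ 3 = 1"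
    "A1 t = r t / 3 * w t" "B1 t = r t / sqrt 3" "(1 - Z (t\<^sup>2)) powr (4 / 3) = 1 / r t ^ 4"
    "0 < w t" "(w t)\<^sup>2 = Z (t\<^sup>2)" if "0 < t" "t < \<epsilon>" for t
    using BS_at_tau_inverse[OF that(1), of "Z (t\<^sup>2)"] Z[OF sq[OF that]] unfolding r_def w_def by auto
  have nz: "A1 t \<noteq> 0" "B1 t \<noteq> 0" if "0 < t" "t < \<epsilon>" for t
    using BS[OF that] by auto
  have f_eq: "A1 t * x t = f t" and G_eq: "B1 t * y t = G t" if "0 < t" "t < \<epsilon>" for t
    using nz[OF that] by (simp_all add: x_def y_def)
  define f1 where "f1 t = (h (Z (t\<^sup>2)) + Z (t\<^sup>2) * h' (Z (t\<^sup>2))) * (3 * w t / r t ^ 4)" for t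
  define g1 where "g1 t = g' (Z (t\<^sup>2)) * (3 * w t / r t ^ 4)" for t
  have D: "(f has_real_derivative f1 t) (at t)" "(G has_real_derivative g1 t) (at t)" if t: "0 < t" "t < \<epsilon>" for t
  proof -
    note z = Z[OF sq[OF t]]
    have "((\<lambda>t. Z (t\<^sup>2)) has_real_derivative (3 / 2 * (1 - Z (t\<^sup>2)) powr (4 / 3) / k_fun (Z (t\<^sup>2))) * (2 * t)) (at t)"
      by (rule DERIV_chain2[where f = Z and g = "\<lambda>t. t\<^sup>2", OF DZ[OF sq[OF t]]]) (auto intro!: derivative_eq_intros)
    also have "(3 / 2 * (1 - Z (t\<^sup>2)) powr (4 / 3) / k_fun (Z (t\<^sup>2))) * (2 * t) = 3 * w t / r t ^ 4"
    proof -
      have "t / k_fun (Z (t\<^sup>2)) = w t" using BS(2)[OF t] z by (simp add: divide_eq_eq)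
      moreover have "3 / 2 * (1 / r t ^ 4) / k_fun (Z (t\<^sup>2)) * (2 * t) = 3 * (t / k_fun (Z (t\<^sup>2))) / r t ^ 4"
        by simp
      ultimately show ?thesis unfolding BS(7)[OF t] by (simp only:)
    qed
    finally have DZ': "((\<lambda>t. Z (t\<^sup>2)) has_real_derivative 3 * w t / r t ^ 4) (at t)" .
    have "((\<lambda>x. 1 + x * h x) has_real_derivative h (Z (t\<^sup>2)) + Z (t\<^sup>2) * h' (Z (t\<^sup>2))) (at (Z (t\<^sup>2)))"
      using z by (auto intro!: derivative_eq_intros Dh)
    from DERIV_chain2[where f = "\<lambda>x. 1 + x * h x" and g = "\<lambda>t. Z (t\<^sup>2)", OF this DZ']
    show "(f has_real_derivative f1 t) (at t)" unfolding f_def[abs_def] f1_def .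
    from DERIV_chain2[where f = g and g = "\<lambda>t. Z (t\<^sup>2)", OF Dg DZ'] z
    show "(G has_real_derivative g1 t) (at t)" unfolding G_def[abs_def] g1_def by blast
  qed
  have D': "((\<lambda>t. A1 t * x t) has_real_derivative f1 t) (at t)" "((\<lambda>t. B1 t * y t) has_real_derivative g1 t) (at t)"
    if t: "0 < t" "t < \<epsilon>" for t
    by (rule has_field_derivative_transform_within_open[OF D(1)[OF t], of "{0<..<\<epsilon>}"], use t f_eq in simp_all,
        rule has_field_derivative_transform_within_open[OF D(2)[OF t], of "{0<..<\<epsilon>}"], use t G_eq in simp_all)
  have eqs: "eq_f (A1 t) (B1 t) (A1 t * x t) (B1 t * y t) (f1 t) = 0"
      "eq_g (A1 t) (B1 t) (A1 t * x t) (B1 t * y t) (g1 t) = 0" if t: "0 < t" "t < \<epsilon>" for t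
  proof -
    have z: "\<bar>Z (t\<^sup>2)\<bar> < R" using Z[OF sq[OF t]] by simp
    show "eq_f (A1 t) (B1 t) (A1 t * x t) (B1 t * y t) (f1 t) = 0"
      "eq_g (A1 t) (B1 t) (A1 t * x t) (B1 t * y t) (g1 t) = 0"
      unfolding f_eq[OF t] G_eq[OF t] unfolding BS(5,6)[OF t] f_def G_def f1_def g1_def
      using series_solution_implies_eqs[OF BS(3)[OF t], of "w t" "h' (Z (t\<^sup>2))" "h (Z (t\<^sup>2))" "g (Z (t\<^sup>2))" "g' (Z (t\<^sup>2))"]
        BS(4)[OF t] eqh[OF z] eqg[OF z] unfolding BS(9)[OF t] by simp_all
  qed
  have local: "local_form \<theta> z X = ansatz x y z X" if "z \<in> complement \<epsilon>" for z X
  proof -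
    obtain t a1 a2 \<tau> u1 u2 where zX: "z = (t, a1, a2)" "X = (\<tau>, u1, u2)" by (cases z, cases X)
    have t: "0 < t" "t < \<epsilon>" and a: "a1 \<in> SU2" "a2 \<in> SU2" using that by (auto simp: zX complement_def)
    have "t\<^sup>2 * \<mu> (t\<^sup>2) = Z (t\<^sup>2) * h (Z (t\<^sup>2))"
    proof -
      have k: "0 < k_fun (Z (t\<^sup>2))" "Z (t\<^sup>2) * (k_fun (Z (t\<^sup>2)))\<^sup>2 = t\<^sup>2" using Z[OF sq[OF t]] by auto
      have "t\<^sup>2 * \<mu> (t\<^sup>2) = (Z (t\<^sup>2) * (k_fun (Z (t\<^sup>2)))\<^sup>2) * \<mu> (t\<^sup>2)" using k by simp
      also have "\<dots> = Z (t\<^sup>2) * h (Z (t\<^sup>2))"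
      proof -
        have "z * q\<^sup>2 * (e * (inverse q * inverse q)) = z * e" if "0 < q" for z q e :: real
          using that by (simp add: power2_eq_square field_simps)
        then show ?thesis unfolding \<mu>_def using k(1) by blast
      qed
      finally show ?thesis .
    qed
    then have e: "1 + t\<^sup>2 * \<mu> (t\<^sup>2) - \<beta> (t\<^sup>2) = (f t + G t) / 2" "\<beta> (t\<^sup>2) = (f t - G t) / 2"
      by (simp_all add: \<beta>_def f_def G_def field_simps)
    show ?thesis
      unfolding zX \<theta>_def local_form_invariant_form[OF a] ansatz_eq f_eq[OF t] G_eq[OF t] e(1) unfolding e(2)
      by (simp add: vec_eq_iff field_simps)
  qed
  have inst: "G2_instanton \<epsilon> \<theta>"
    unfolding G2_instanton_def
  proof (intro conjI conn(1) ballI)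
    fix z assume z: "z \<in> complement \<epsilon>"
    obtain t a1 a2 where z': "z = (t, a1, a2)" by (cases z)
    have t: "0 < t" "t < \<epsilon>" using z by (auto simp: z' complement_def)
    show "\<forall>Xs. length Xs = 6 \<longrightarrow> wedge 2 (curvature (local_form \<theta>) z) (psi (fst z)) Xs = 0"
      using instanton_iff[OF z[unfolded z'] local refl D'(1)[OF t] refl D'(2)[OF t]] eqs[OF t] by (simp add: z')
  qed
  have small: "eventually (\<lambda>t. 0 < t \<and> t < \<epsilon>) (at_right 0)"
    using eventually_at_right_real[OF \<epsilon>(1)] by (auto elim: eventually_mono)
  \<comment> \<open>The value is \<open>(3 / 2) / k_fun 0\<close>. Thus \<open>z\<close> is
    \<open>9 / 4 t\<^sup>2\<close> to leading order, which converts first-order coefficients in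
    \<open>z\<close> into those in \<open>t\<^sup>2\<close>.\<close>
  have D0: "(Z has_real_derivative 9 / 4) (at 0)" using DZ[of 0] S by (simp add: Z0 k_fun_0)
  have "smooth_on ?I (\<lambda>s. (1 + - Z s) powr (1 / 3))"
  proof (rule smooth_on_compose_real[OF op _ smooth_on_powr])
    show "(\<lambda>s. 1 + - Z s) ` ?I \<subseteq> {0<..}" using ZI(2) by auto
    show "smooth_on ?I (\<lambda>s. 1 + - Z s)" by (intro smooth_on_add smooth_on_const op neg smZ)
  qed
  then have sp: "smooth_on ?I (\<lambda>s. (1 - Z s) powr (1 / 3))" by simp
  \<comment> \<open>From \<open>x = 3 f / (r w)\<close>, \<open>w = t / k\<close> and
    \<open>1 / r = (1 - z) powr (1 / 3)\<close> one gets \<open>t x\<close> as a smooth function of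
    \<open>t\<^sup>2\<close>, and similarly \<open>y\<close>; Taylor expansion in
    \<open>s = t\<^sup>2\<close> then applies.\<close>
  define Xf where "Xf s = 3 * (1 + Z s * h (Z s)) * k_fun (Z s) * (1 - Z s) powr (1 / 3)" for s
  define Yf where "Yf s = sqrt 3 * g (Z s) * (1 - Z s) powr (1 / 3)" for s
  have sX: "smooth_on ?I Xf" and sY: "smooth_on ?I Yf"
    unfolding Xf_def[abs_def] Yf_def[abs_def] by (intro smooth_on_mult smooth_on_const op sf sk sp sh(2))+
  have dg0: "g' 0 = 2 * (c * h 0)" using eqg[of 0] R g0 by simp
  have DX: "(Xf has_real_derivative (y0\<^sup>2 - 1) / 4) (at 0)"
  proof -
    have "((\<lambda>z. 3 * (1 + z * h z) * k_fun z * (1 - z) powr (1 / 3)) has_real_derivative 3 * (h 0 * (2 / 3) + 8 / 27 - 2 / 9)) (at (Z 0))"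
      unfolding Z0 using R by (auto intro!: derivative_eq_intros Dh[of 0] k_fun_deriv[of 0] simp: k_fun_0)
    from DERIV_chain2[where g = Z, OF this D0]
    have "(Xf has_real_derivative 3 * (h 0 * (2 / 3) + 8 / 27 - 2 / 9) * (9 / 4)) (at 0)" unfolding Xf_def[abs_def] .
    also have "3 * (h 0 * (2 / 3) + 8 / 27 - 2 / 9) * (9 / 4) = (y0\<^sup>2 - 1) / 4"
      by (simp add: h0 c_def power_divide field_simps)
    finally show ?thesis .
  qed
  have DY: "(Yf has_real_derivative y0 / 2 * (y0\<^sup>2 / 2 - 3)) (at 0)"
  proof -
    have "((\<lambda>z. sqrt 3 * g z * (1 - z) powr (1 / 3)) has_real_derivative sqrt 3 * (g' 0 - c / 3)) (at (Z 0))"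
      unfolding Z0 using R by (auto intro!: derivative_eq_intros Dg[of 0] simp: g0 algebra_simps)
    from DERIV_chain2[where g = Z, OF this D0]
    have "(Yf has_real_derivative sqrt 3 * (g' 0 - c / 3) * (9 / 4)) (at 0)" unfolding Yf_def[abs_def] .
    also have "sqrt 3 * (g' 0 - c / 3) * (9 / 4) = y0 / 2 * (y0\<^sup>2 / 2 - 3)"
      by (simp add: dg0 h0 c_def power_divide field_simps power2_eq_square)
    finally show ?thesis .
  qed
  have X0: "Xf 0 = 2" "Yf 0 = y0" by (simp_all add: Xf_def Yf_def Z0 k_fun_0 g0 c_def)
  have r_inv: "(1 - Z (t\<^sup>2)) powr (1 / 3) = 1 / r t" if t: "0 < t" "t < \<epsilon>" for t
    unfolding r_def by (simp add: powr_minus_divide)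
  have xX: "x t = Xf (t\<^sup>2) / t" and yY: "y t = Yf (t\<^sup>2)" if t: "0 < t" "t < \<epsilon>" for t
  proof -
    have k: "0 < k_fun (Z (t\<^sup>2))" using Z[OF sq[OF t]] by auto
    have "x t = 3 * f t / (r t * w t)" unfolding x_def BS(5)[OF t] by simp
    also have "\<dots> = 3 * f t * k_fun (Z (t\<^sup>2)) / (r t * (w t * k_fun (Z (t\<^sup>2))))" using k by simp
    also have "\<dots> = Xf (t\<^sup>2) / t" unfolding BS(2)[OF t, symmetric] by (simp add: Xf_def r_inv[OF t] f_def)
    finally show "x t = Xf (t\<^sup>2) / t" .
    show "y t = Yf (t\<^sup>2)" unfolding y_def BS(6)[OF t] Yf_def r_inv[OF t] G_def using BS(3)[OF t] by (simp add: field_simps)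
  qed
  have exp: "expansion y0 x y"
    unfolding expansion_def
  proof
    have "(\<lambda>t. Xf (t\<^sup>2) - (2 + (y0\<^sup>2 - 1) / 4 * t\<^sup>2)) \<in> O[at_right 0](\<lambda>t. t ^ 4)"
      using bigo_compose_square[OF smooth_on_taylor[OF sX S DX]] by (simp add: X0)
    \<comment> \<open>Dividing by \<open>t\<close> lowers the order of the remainder from 4 to
      3.\<close>
    then have "(\<lambda>t. (Xf (t\<^sup>2) - (2 + (y0\<^sup>2 - 1) / 4 * t\<^sup>2)) * (1 / t)) \<in> O[at_right 0](\<lambda>t. t ^ 4 * (1 / t))"
      by (rule landau_o.big.mult) simp
    also have "eventually (\<lambda>t::real. t ^ 4 * (1 / t) = t ^ 3) (at_right 0)"
      using small by eventually_elim (simp add: field_simps eval_nat_numeral)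
    then have "O[at_right 0](\<lambda>t::real. t ^ 4 * (1 / t)) = O[at_right 0](\<lambda>t. t ^ 3)"
      by (rule landau_o.big.cong)
    finally have *: "(\<lambda>t. (Xf (t\<^sup>2) - (2 + (y0\<^sup>2 - 1) / 4 * t\<^sup>2)) * (1 / t)) \<in> O[at_right 0](\<lambda>t. t ^ 3)" .
    have "eventually (\<lambda>t. (Xf (t\<^sup>2) - (2 + (y0\<^sup>2 - 1) / 4 * t\<^sup>2)) * (1 / t) = x t - (2 / t + (y0\<^sup>2 - 1) / 4 * t)) (at_right 0)"
      using small by eventually_elim (simp add: xX field_simps power2_eq_square)
    from * show "(\<lambda>t. x t - (2 / t + (y0\<^sup>2 - 1) / 4 * t)) \<in> O[at_right 0](\<lambda>t. t ^ 3)"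
      by (rule landau_o.big.in_cong[THEN iffD1, rotated]) fact
    have "(\<lambda>t. Yf (t\<^sup>2) - (y0 + y0 / 2 * (y0\<^sup>2 / 2 - 3) * t\<^sup>2)) \<in> O[at_right 0](\<lambda>t. t ^ 4)"
      using bigo_compose_square[OF smooth_on_taylor[OF sY S DY]] by (simp add: X0)
    then show "(\<lambda>t. y t - (y0 + y0 / 2 * (y0\<^sup>2 / 2 - 3) * t\<^sup>2)) \<in> O[at_right 0](\<lambda>t. t ^ 4)"
      by (rule landau_o.big.in_cong[THEN iffD1, rotated]) (use small in eventually_elim, simp add: yY)
  qed
  have tq: "((\<lambda>t::real. t\<^sup>2) \<longlongrightarrow> 0) (at_right 0)" using tendsto_power[OF tendsto_ident_at[of "0::real" "{0<..}"], of 2] by simp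
  have Zlim: "((\<lambda>t. Z (t\<^sup>2)) \<longlongrightarrow> 0) (at_right 0)"
    using isCont_tendsto_compose[OF DERIV_isCont[OF D0] tq] by (simp add: Z0)
  have hlim: "((\<lambda>t. h (Z (t\<^sup>2))) \<longlongrightarrow> h 0) (at_right 0)"
    by (rule isCont_tendsto_compose[OF DERIV_isCont[OF Dh] Zlim]) (use R in simp)
  have glim: "((\<lambda>t. g (Z (t\<^sup>2))) \<longlongrightarrow> c) (at_right 0)"
    using isCont_tendsto_compose[OF DERIV_isCont[OF Dg] Zlim] R g0 by simp
  have klim: "((\<lambda>t. k_fun (Z (t\<^sup>2))) \<longlongrightarrow> 2 / 3) (at_right 0)"
    using isCont_tendsto_compose[OF DERIV_isCont[OF k_fun_deriv] Zlim] by (simp add: k_fun_0)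
  have rlim: "(r \<longlongrightarrow> 1) (at_right 0)"
  proof -
    have "((\<lambda>t. (1 - Z (t\<^sup>2)) powr (- (1 / 3))) \<longlongrightarrow> (1 - 0) powr (- (1 / 3))) (at_right 0)"
      by (intro tendsto_intros Zlim) auto
    then show ?thesis by (simp add: r_def[abs_def])
  qed
  have cong: "(F \<longlongrightarrow> l) (at_right 0)" if "(F' \<longlongrightarrow> l) (at_right 0)" "\<And>t. 0 < t \<Longrightarrow> t < \<epsilon> \<Longrightarrow> F' t = F t" for F F' :: "real \<Rightarrow> real" and l
    by (rule Lim_transform_eventually[OF that(1)]) (use small in eventually_elim, use that(2) in auto)
  show thesis
  proof (rule that[OF \<epsilon>(1) inst conn(2) local exp D' eqs])
    show "((\<lambda>t. A1 t / t) \<longlongrightarrow> 1 / 2) (at_right 0)"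
    proof (rule cong)
      have "((\<lambda>t. r t / (3 * k_fun (Z (t\<^sup>2)))) \<longlongrightarrow> 1 / (3 * (2 / 3))) (at_right 0)"
        by (intro tendsto_intros rlim klim) auto
      then show "((\<lambda>t. r t / (3 * k_fun (Z (t\<^sup>2)))) \<longlongrightarrow> 1 / 2) (at_right 0)" by simp
      fix t assume t: "0 < t" "t < \<epsilon>"
      have "A1 t / t = r t / 3 * w t / (w t * k_fun (Z (t\<^sup>2)))"
        using arg_cong[OF BS(2)[OF t], of "\<lambda>u. r t / 3 * w t / u"] unfolding BS(5)[OF t] .
      then show "r t / (3 * k_fun (Z (t\<^sup>2))) = A1 t / t" using BS(8)[OF t] by simp
    qed
    show "(B1 \<longlongrightarrow> 1 / sqrt 3) (at_right 0)"
      by (rule cong[of "\<lambda>t. r t / sqrt 3"]) (use BS(6) in \<open>auto intro!: tendsto_intros rlim\<close>)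
    show "((\<lambda>t. A1 t * x t) \<longlongrightarrow> 1) (at_right 0)"
    proof (rule cong)
      have "((\<lambda>t. 1 + Z (t\<^sup>2) * h (Z (t\<^sup>2))) \<longlongrightarrow> 1 + 0 * h 0) (at_right 0)"
        by (intro tendsto_intros Zlim hlim)
      then show "(f \<longlongrightarrow> 1) (at_right 0)" by (simp add: f_def[abs_def])
    qed (simp add: f_eq)
    show "((\<lambda>t. B1 t * y t) \<longlongrightarrow> y0 / sqrt 3) (at_right 0)"
    proof (rule cong)
      show "(G \<longlongrightarrow> y0 / sqrt 3) (at_right 0)" using glim by (simp add: G_def[abs_def] c_def)
    qed (simp add: G_eq)
  qed
qed

section \<open>Uniqueness of the germ\<close>

lemma ansatz_frame:
  "ansatz x y (t, a1, a2) (T_plus 1) $ 1 = A1 t * x t" "ansatz x y (t, a1, a2) (T_minus 1) $ 1 = B1 t * y t"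
  by (simp_all add: T_plus_def T_minus_def ansatz_eq T_def axis_def)

lemma ansatz_coefficients_differentiable:
  assumes conn: "connection \<delta> \<theta>"
    and local: "\<And>z X. z \<in> complement \<delta> \<Longrightarrow> local_form \<theta> z X = ansatz x y z X"
    and t: "0 < t" "t < \<delta>"
  shows "\<exists>d. ((\<lambda>t. A1 t * x t) has_real_derivative d) (at t)"
    and "\<exists>d. ((\<lambda>t. B1 t * y t) has_real_derivative d) (at t)"
proof -
  have diff: "\<exists>d. (F has_real_derivative d) (at t)"
    if "\<And>t. 0 < t \<Longrightarrow> t < \<delta> \<Longrightarrow> local_form \<theta> (t, (1, 0), (1, 0)) X $ 1 = F t" for F X
  proof -
    let ?L = "\<lambda>t. local_form \<theta> (t, (1, 0), (1, 0)) X"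
    obtain D where "(?L has_derivative D) (at t)"
      using connection_along_section[OF conn t, of X] unfolding differentiable_def by blast
    then have "((\<lambda>t. ?L t $ 1) has_derivative (\<lambda>s. D s $ 1)) (at t)"
      by (rule bounded_linear.has_derivative[OF bounded_linear_vec_nth])
    then have "(F has_derivative (\<lambda>s. D s $ 1)) (at t)"
      by (rule has_derivative_transform_within_open[of _ _ _ _ "{0<..<\<delta>}"]) (use t that in auto)
    then have "F differentiable (at t)" unfolding differentiable_def by blast
    then show ?thesis by (simp add: real_differentiable_def)
  qed
  have mem: "(t, (1, 0), (1, 0)) \<in> complement \<delta>" if "0 < t" "t < \<delta>" for t
    using that by (simp add: complement_def SU2_def norm_prod_def)
  show "\<exists>d. ((\<lambda>t. A1 t * x t) has_real_derivative d) (at t)"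
    by (rule diff[of "T_plus 1"]) (simp only: local[OF mem] ansatz_frame)
  show "\<exists>d. ((\<lambda>t. B1 t * y t) has_real_derivative d) (at t)"
    by (rule diff[of "T_minus 1"]) (simp only: local[OF mem] ansatz_frame)
qed

text \<open>Equal parameters cancel the explicit terms, the pole \<open>2 / t\<close> included. The
  remainders are weakened to the common order \<open>t\<^sup>2\<close> that the energy argument
  uses.\<close>

lemma expansion_difference:
  assumes "expansion y0 x y" "expansion y0 x' y'"
  shows "(\<lambda>t. x t - x' t) \<in> O[at_right 0](\<lambda>t. t\<^sup>2)" "(\<lambda>t. y t - y' t) \<in> O[at_right 0](\<lambda>t. t\<^sup>2)"
proof -
  have small: "(\<lambda>t::real. t ^ n) \<in> O[at_right 0](\<lambda>t. t\<^sup>2)" if "2 \<le> n" for n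
  proof (rule bigoI[of _ 1])
    have "eventually (\<lambda>t. t \<in> {0<..<1}) (at_right (0::real))" by (rule eventually_at_right_real) simp
    then show "eventually (\<lambda>t::real. norm (t ^ n) \<le> 1 * norm (t\<^sup>2)) (at_right 0)"
      by eventually_elim (use that in \<open>auto intro!: power_decreasing\<close>)
  qed
  have "(\<lambda>t. (x t - (2 / t + (y0\<^sup>2 - 1) / 4 * t)) - (x' t - (2 / t + (y0\<^sup>2 - 1) / 4 * t))) \<in> O[at_right 0](\<lambda>t. t ^ 3)"
    by (rule sum_in_bigo(2)[OF assms[unfolded expansion_def, THEN conjunct1]])
  then show "(\<lambda>t. x t - x' t) \<in> O[at_right 0](\<lambda>t. t\<^sup>2)"
    using landau_o.big_trans[OF _ small[of 3]] by simp
  have "(\<lambda>t. (y t - (y0 + y0 / 2 * (y0\<^sup>2 / 2 - 3) * t\<^sup>2)) - (y' t - (y0 + y0 / 2 * (y0\<^sup>2 / 2 - 3) * t\<^sup>2))) \<in> O[at_right 0](\<lambda>t. t ^ 4)"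
    by (rule sum_in_bigo(2)[OF assms[unfolded expansion_def, THEN conjunct2]])
  then show "(\<lambda>t. y t - y' t) \<in> O[at_right 0](\<lambda>t. t\<^sup>2)"
    using landau_o.big_trans[OF _ small[of 4]] by simp
qed

text \<open>The radius \<rho> depends on the competitor, whose tube may be smaller and whose
  solution enters the energy estimate.\<close>

lemma instanton_unique_germ:
  "\<exists>\<epsilon> \<theta>. instanton_with_parameter y0 \<epsilon> \<theta> \<and>
    (\<forall>\<delta> \<theta>'. instanton_with_parameter y0 \<delta> \<theta>' \<longrightarrow>
       (\<exists>\<rho>>0. \<forall>z\<in>P_id \<rho>. \<forall>v\<in>TP_id z. \<theta>' z v = \<theta> z v))"
proof -
  obtain \<epsilon> \<theta> x y f' g' where \<epsilon>: "0 < \<epsilon>" and inst: "G2_instanton \<epsilon> \<theta>" and inv: "SU2_cubed_invariant \<epsilon> \<theta>"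
    and local: "\<And>z X. z \<in> complement \<epsilon> \<Longrightarrow> local_form \<theta> z X = ansatz x y z X" and exp: "expansion y0 x y"
    and D: "\<And>t. 0 < t \<Longrightarrow> t < \<epsilon> \<Longrightarrow> ((\<lambda>t. A1 t * x t) has_real_derivative f' t) (at t)"
      "\<And>t. 0 < t \<Longrightarrow> t < \<epsilon> \<Longrightarrow> ((\<lambda>t. B1 t * y t) has_real_derivative g' t) (at t)"
    and eqs: "\<And>t. 0 < t \<Longrightarrow> t < \<epsilon> \<Longrightarrow> eq_f (A1 t) (B1 t) (A1 t * x t) (B1 t * y t) (f' t) = 0"
      "\<And>t. 0 < t \<Longrightarrow> t < \<epsilon> \<Longrightarrow> eq_g (A1 t) (B1 t) (A1 t * x t) (B1 t * y t) (g' t) = 0"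
    and limA: "((\<lambda>t. A1 t / t) \<longlongrightarrow> 1 / 2) (at_right 0)" and limB: "(B1 \<longlongrightarrow> 1 / sqrt 3) (at_right 0)"
    and lim: "((\<lambda>t. A1 t * x t) \<longlongrightarrow> 1) (at_right 0)" "((\<lambda>t. B1 t * y t) \<longlongrightarrow> y0 / sqrt 3) (at_right 0)"
    by (rule instanton_exists[of y0]) blast
  have main: "instanton_with_parameter y0 \<epsilon> \<theta>"
    unfolding instanton_with_parameter_def using \<epsilon> inst inv local exp by blast
  have conn: "connection \<epsilon> \<theta>" using inst by (simp add: G2_instanton_def)
  have "((\<lambda>t. t * (A1 t / t)) \<longlongrightarrow> 0) (at_right 0)"
    using tendsto_mult[OF tendsto_ident_at limA] by simp
  then have limA0: "(A1 \<longlongrightarrow> 0) (at_right 0)"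
  proof (rule Lim_transform_eventually)
    show "eventually (\<lambda>t. t * (A1 t / t) = A1 t) (at_right 0)"
      using eventually_at_right_less[of 0] by eventually_elim simp
  qed
  \<comment> \<open>Boundedness of \<open>A1\<close> and \<open>B1\<close> transfers the
    \<open>O(t\<^sup>2)\<close> bounds from \<open>x\<close>, \<open>y\<close> to \<open>f\<close>,
    \<open>g\<close>.\<close>
  have bigA: "A1 \<in> O[at_right 0](\<lambda>_. 1)" by (rule bigoI_tendsto[of _ _ 0]) (use limA0 in simp_all)
  have bigB: "B1 \<in> O[at_right 0](\<lambda>_. 1)" by (rule bigoI_tendsto[of _ _ "1 / sqrt 3"]) (use limB in simp_all)
  have unique: "\<exists>\<rho>>0. \<forall>z\<in>P_id \<rho>. \<forall>v\<in>TP_id z. \<theta>' z v = \<theta> z v"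
    if inst': "instanton_with_parameter y0 \<delta> \<theta>'" for \<delta> \<theta>'
  proof -
    obtain x1 y1 where \<delta>: "0 < \<delta>" and inst1: "G2_instanton \<delta> \<theta>'"
      and all1: "\<forall>z\<in>complement \<delta>. \<forall>X. local_form \<theta>' z X = ansatz x1 y1 z X" and exp1: "expansion y0 x1 y1"
      using inst' unfolding instanton_with_parameter_def by blast
    have local1: "local_form \<theta>' z X = ansatz x1 y1 z X" if "z \<in> complement \<delta>" for z X
      using all1 that by blast
    have conn1: "connection \<delta> \<theta>'" using inst1 by (simp add: G2_instanton_def)
    have "\<forall>t. \<exists>d. 0 < t \<and> t < \<delta> \<longrightarrow> ((\<lambda>t. A1 t * x1 t) has_real_derivative d) (at t)"
      "\<forall>t. \<exists>d. 0 < t \<and> t < \<delta> \<longrightarrow> ((\<lambda>t. B1 t * y1 t) has_real_derivative d) (at t)"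
      using ansatz_coefficients_differentiable[OF conn1 local1] by blast+
    then obtain f1' g1' where D1:
        "\<And>t. 0 < t \<Longrightarrow> t < \<delta> \<Longrightarrow> ((\<lambda>t. A1 t * x1 t) has_real_derivative f1' t) (at t)"
        "\<And>t. 0 < t \<Longrightarrow> t < \<delta> \<Longrightarrow> ((\<lambda>t. B1 t * y1 t) has_real_derivative g1' t) (at t)"
      by (metis (mono_tags))
    have eqs1: "eq_f (A1 t) (B1 t) (A1 t * x1 t) (B1 t * y1 t) (f1' t) = 0"
        "eq_g (A1 t) (B1 t) (A1 t * x1 t) (B1 t * y1 t) (g1' t) = 0" if t: "0 < t" "t < \<delta>" for t
    proof -
      have z: "(t, (1, 0), (1, 0)) \<in> complement \<delta>"
        using t by (simp add: complement_def SU2_def norm_prod_def)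
      then have "\<forall>Xs. length Xs = 6 \<longrightarrow> wedge 2 (curvature (local_form \<theta>') (t, (1, 0), (1, 0))) (psi t) Xs = 0"
        using inst1 unfolding G2_instanton_def by (metis fst_conv)
      then show "eq_f (A1 t) (B1 t) (A1 t * x1 t) (B1 t * y1 t) (f1' t) = 0"
        "eq_g (A1 t) (B1 t) (A1 t * x1 t) (B1 t * y1 t) (g1' t) = 0"
        using instanton_iff[OF z local1 refl D1(1)[OF t] refl D1(2)[OF t]] by blast+
    qed
    have O: "(\<lambda>t. A1 t * x t - A1 t * x1 t) \<in> O[at_right 0](\<lambda>t. t\<^sup>2)"
        "(\<lambda>t. B1 t * y t - B1 t * y1 t) \<in> O[at_right 0](\<lambda>t. t\<^sup>2)"
      using landau_o.big.mult[OF bigA expansion_difference(1)[OF exp exp1]]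
        landau_o.big.mult[OF bigB expansion_difference(2)[OF exp exp1]]
      by (simp_all add: right_diff_distrib)
    have t2: "((\<lambda>t::real. t\<^sup>2) \<longlongrightarrow> 0) (at_right 0)"
      using tendsto_power[OF tendsto_ident_at[of "0::real" "{0<..}"], of 2] by simp
    \<comment> \<open>A competitor inherits the limits of the constructed solution, since the
      differences tend to 0.\<close>
    have lim1: "(F1 \<longlongrightarrow> l) (at_right 0)"
      if F: "(F \<longlongrightarrow> l) (at_right 0)" "(\<lambda>t. F t - F1 t) \<in> O[at_right 0](\<lambda>t. t\<^sup>2)" for F F1 :: "real \<Rightarrow> real" and l
    proof -
      obtain C where "eventually (\<lambda>t. norm (F t - F1 t) \<le> C * norm (t\<^sup>2)) (at_right 0)"
        using F(2) by (elim landau_o.bigE) auto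
      then have "((\<lambda>t. F t - F1 t) \<longlongrightarrow> 0) (at_right 0)"
        by (rule Lim_null_comparison) (use tendsto_mult[OF tendsto_const[of C] t2] in simp)
      from tendsto_diff[OF F(1) this] show ?thesis by simp
    qed
    define \<rho> where "\<rho> = min \<epsilon> \<delta>"
    have \<rho>: "0 < \<rho>" "\<rho> \<le> \<epsilon>" "\<rho> \<le> \<delta>" using \<epsilon> \<delta> by (auto simp: \<rho>_def)
    obtain \<sigma> where \<sigma>: "0 < \<sigma>" "\<sigma> \<le> \<rho>"
      "\<And>t. 0 < t \<Longrightarrow> t < \<sigma> \<Longrightarrow> A1 t * x t = A1 t * x1 t \<and> B1 t * y t = B1 t * y1 t"
    proof (rule singular_system_unique[of \<rho> "\<lambda>t. A1 t * x t" f' "\<lambda>t. B1 t * y t" g' "\<lambda>t. A1 t * x1 t" f1' "\<lambda>t. B1 t * y1 t" g1' A1 B1 "1 / sqrt 3" "y0 / sqrt 3"])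
      show "((\<lambda>t. A1 t * x1 t) \<longlongrightarrow> 1) (at_right 0)" "((\<lambda>t. B1 t * y1 t) \<longlongrightarrow> y0 / sqrt 3) (at_right 0)"
        by (rule lim1[OF lim(1) O(1)], rule lim1[OF lim(2) O(2)])
    qed (use \<rho> D D1 eqs eqs1 limA limB lim O in auto)
    have "local_form \<theta>' z X = local_form \<theta> z X" if "z \<in> complement \<sigma>" for z X
    proof -
      obtain t a1 a2 \<tau> u1 u2 where zX: "z = (t, a1, a2)" "X = (\<tau>, u1, u2)" by (cases z, cases X)
      have z: "z \<in> complement \<epsilon>" "z \<in> complement \<delta>" and t: "0 < t" "t < \<sigma>"
        using that \<sigma>(2) \<rho> by (auto simp: zX complement_def)
      show ?thesis unfolding local[OF z(1)] local1[OF z(2)] unfolding zX ansatz_eq using \<sigma>(3)[OF t] by (elim conjE) (simp only:)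
    qed
    then have "\<theta>' z v = \<theta> z v" if "z \<in> P_id \<sigma>" "v \<in> TP_id z" for z v
      using \<sigma>(1,2) \<rho> that by (intro connection_eqI[OF conn1 conn, of \<sigma>]) auto
    then show ?thesis using \<sigma>(1) by blast
  qed
  show ?thesis using main unique by blast
qed

theorem proposition6:
  shows "\<exists>(\<epsilon> :: real \<Rightarrow> real) (\<theta> :: real \<Rightarrow> bundle_pt \<Rightarrow> bundle_pt \<Rightarrow> su2). \<forall>y0.
    instanton_with_parameter y0 (\<epsilon> y0) (\<theta> y0) \<and>
    (\<forall>\<delta> \<theta>'. instanton_with_parameter y0 \<delta> \<theta>' \<longrightarrow>
       (\<exists>\<rho>>0. \<forall>z\<in>P_id \<rho>. \<forall>v\<in>TP_id z. \<theta>' z v = \<theta> y0 z v))"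
  using instanton_unique_germ by metis

end
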